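(* Let $G=(V,E)$ be drawn from $R(n,d)$ with $d\ge 3$ an integer, or from $G(n,d/n)$ with $d>1$. Let the initial opinions $\{X_0(i)\}_{i\in V}$ be i.i.d. uniform on $\{-1,+1\}$, independent of $G$, and let the opinions evolve by majority dynamics on $G$. Then for every $\varepsilon>0$ there exists a time $t$ (not depending on $n$) such that, with high probability, $X_{t+2}(i)=X_t(i)$ for all $i\in V$ except a set of size at most $\varepsilon\cdot|V|$. Furthermore, at this time $t$, the fraction of vertices $i\in V$ for which $X_t(i)=1$ is, with high probability, in $[1/2-\varepsilon,1/2+\varepsilon]$.
   Context: $R(n,d)$ denotes the uniform distribution over all $d$-regular connected graphs with $n$ vertices (for $n$ such that these exist). $G(n,p)$ is the Erdős–Rényi random graph on $n$ vertices in which each edge is present independently with probability $p$. Here $d$ is fixed and $n\to\infty$; "with high probability" means with probability tending to one as $n\to\infty$. Majority dynamics on a graph $G=(V,E)$: for $t\in\{0,1,2,\dots\}$, $X_t(i)\in\{-1,+1\}$ is the opinion of vertex $i$ at time $t$, and $X_{t+1}(i)=\mathrm{sgn}\sum_{j\in\partial(i)}X_t(j)$, where $\partial(i)$ is the set of neighbors of $i$, with $i$ itself included exactly when its degree is even, so that $|\partial(i)|$ is odd (equivalently ties are broken by keeping the existing opinion). *)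

theory Defs
  imports "HOL-Probability.Probability" "HOL-Probability.Product_PMF"
begin

text \<open>A simple graph with vertex set \<open>{..<n}\<close> is represented by its set of edges, each edge being
  a two-element set of vertices.\<close>

definition all_edges :: "nat \<Rightarrow> nat set set" where
  "all_edges n = {e. e \<subseteq> {..<n} \<and> card e = 2}"

definition nbrs :: "nat set set \<Rightarrow> nat \<Rightarrow> nat set" where
  "nbrs E i = {j. {i, j} \<in> E}"

definition vertex_degree :: "nat set set \<Rightarrow> nat \<Rightarrow> nat" where
  "vertex_degree E i = card (nbrs E i)"

definition connected_graph :: "nat \<Rightarrow> nat set set \<Rightarrow> bool" where
  "connected_graph n E \<longleftrightarrow> (\<forall>i<n. \<forall>j<n. (i, j) \<in> {(u, v). {u, v} \<in> E}\<^sup>*)"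

definition regular_graphs :: "nat \<Rightarrow> nat \<Rightarrow> nat set set set" where
  "regular_graphs n d = {E. E \<subseteq> all_edges n \<and> (\<forall>i<n. vertex_degree E i = d) \<and> connected_graph n E}"

text \<open>\<open>random_regular n d\<close> is the law \<open>R(n, d)\<close>. It is meaningful only if \<open>regular_graphs n d\<close> is
  nonempty, so limits in \<open>n\<close> are taken along \<open>admissible d\<close>.\<close>

definition random_regular :: "nat \<Rightarrow> nat \<Rightarrow> nat set set pmf" where
  "random_regular n d = pmf_of_set (regular_graphs n d)"

definition admissible :: "nat \<Rightarrow> nat filter" where
  "admissible d = inf sequentially (principal {n. regular_graphs n d \<noteq> {}})"

text \<open>The law \<open>G(n, p)\<close>. Values of \<open>p\<close> above 1 (which occur for \<open>p = d / n\<close> with small \<open>n\<close>) are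
  truncated to 1 by \<open>bernoulli_pmf\<close>.\<close>

definition erdos_renyi :: "nat \<Rightarrow> real \<Rightarrow> nat set set pmf" where
  "erdos_renyi n p =
     map_pmf (\<lambda>f. {e \<in> all_edges n. f e}) (Pi_pmf (all_edges n) False (\<lambda>_. bernoulli_pmf p))"

text \<open>Opinions outside the vertex set are given the dummy value 0; no vertex ever looks at them.\<close>

definition initial_opinions :: "nat \<Rightarrow> (nat \<Rightarrow> int) pmf" where
  "initial_opinions n = Pi_pmf {..<n} 0 (\<lambda>_. pmf_of_set {-1, 1})"

definition voters :: "nat set set \<Rightarrow> nat \<Rightarrow> nat set" where
  "voters E i = (if even (vertex_degree E i) then insert i (nbrs E i) else nbrs E i)"

primrec majority_dynamics :: "nat set set \<Rightarrow> (nat \<Rightarrow> int) \<Rightarrow> nat \<Rightarrow> nat \<Rightarrow> int" where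
  "majority_dynamics E x 0 = x"
| "majority_dynamics E x (Suc t) = (\<lambda>i. sgn (\<Sum>j\<in>voters E i. majority_dynamics E x t j))"

text \<open>\<open>whp F G P\<close>: if the graph on \<open>n\<close> vertices has law \<open>G n\<close> and the initial opinions are independent
  of it, then \<open>P n\<close> holds with probability tending to one as \<open>n\<close> tends to infinity along \<open>F\<close>.\<close>

definition whp ::
    "nat filter \<Rightarrow> (nat \<Rightarrow> nat set set pmf) \<Rightarrow> (nat \<Rightarrow> nat set set \<Rightarrow> (nat \<Rightarrow> int) \<Rightarrow> bool) \<Rightarrow> bool" where
  "whp F G P \<longleftrightarrow>
     ((\<lambda>n. measure_pmf.prob (pair_pmf (G n) (initial_opinions n)) {(E, x). P n E x}) \<longlongrightarrow> 1) F"

definition almost_two_periodic :: "real \<Rightarrow> nat \<Rightarrow> nat \<Rightarrow> nat set set \<Rightarrow> (nat \<Rightarrow> int) \<Rightarrow> bool" where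
  "almost_two_periodic \<epsilon> t n E x \<longleftrightarrow>
     real (card {i \<in> {..<n}. majority_dynamics E x (t + 2) i \<noteq> majority_dynamics E x t i}) \<le> \<epsilon> * real n"

definition almost_balanced :: "real \<Rightarrow> nat \<Rightarrow> nat \<Rightarrow> nat set set \<Rightarrow> (nat \<Rightarrow> int) \<Rightarrow> bool" where
  "almost_balanced \<epsilon> t n E x \<longleftrightarrow>
     real (card {i \<in> {..<n}. majority_dynamics E x t i = 1}) / real n \<in> {1/2 - \<epsilon> .. 1/2 + \<epsilon>}"

end

theory Submission
  imports Defs
begin

text \<open>
  A vertex is said to flip at time \<open>t\<close> if its opinions at times \<open>t\<close> and \<open>t + 2\<close> differ. On a finite graph
  the potential \<open>\<Sum>i. \<Sum>j\<in>\<partial>i. X (t + 1) i * X t j\<close> of Goles and Olivos increases by at least 2 for every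
  flip at time \<open>t\<close>, because each vertex looks at an odd number of opinions. Hence the total number of
  flips over all times is at most \<open>\<Sum>i. card (\<partial>i)\<close> (lemma \<open>sum_flips_le\<close>), which is linear in \<open>n\<close> on
  average. So for each \<open>n\<close> some early time has few flips; the task is to choose this time independently
  of \<open>n\<close>.

  For this it is enough that, for each fixed \<open>t\<close>, the proportion of flips at time \<open>t\<close> tends in
  probability to a constant \<open>a t\<close>: the bound on the total passes to the limit, so \<open>\<Sum>t. a t\<close> is bounded
  and some \<open>a t\<close> is at most \<open>\<epsilon> / 2\<close> (lemma \<open>exists_settling_time\<close>). Given the graph, flips at vertices
  whose balls of radius \<open>t + 2\<close> are disjoint are independent, so the proportion of flips is close to its
  conditional mean (lemma \<open>second_moment_given_graph\<close>), and only the conditional mean \<open>mean_flip\<close> as a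
  function of the random graph is left to study. The same conditional variance bound gives the balance
  of opinions, since the symmetry \<open>x \<mapsto> - x\<close> makes the conditional mean exactly \<open>1/2\<close>.

  For random regular graphs, the flip probability of a vertex whose ball is a tree is a constant
  \<open>tree_flip d t\<close>: the opinions around it can be lifted to the universal cover, here the tree of
  reduced words (lemma \<open>flip_prob_good\<close>). Vertices near a short cycle are rare by a switching argument:
  an edge \<open>uv\<close> on a short cycle and a far edge \<open>ab\<close> are replaced by \<open>ua\<close>, \<open>vb\<close>. As \<open>uv\<close> is not a bridge,
  this switching or the one with \<open>a\<close> and \<open>b\<close> exchanged keeps the graph connected, so the argument works
  directly in the set of connected regular graphs (lemma \<open>switching_count\<close>).

  For the Erdos--Renyi graph, the flip probability of a vertex is first truncated to the event that its
  ball has at most \<open>K\<close> vertices. Its expectation is an explicit finite sum over the possible shapes of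
  the ball (lemma \<open>expected_small_flip\<close>), which converges as \<open>n \<rightarrow> \<infinity>\<close> because a connected shape on \<open>k\<close>
  vertices has at least \<open>k - 1\<close> edges. Disjoint balls of size at most \<open>K\<close> are explored almost
  independently: the two explorations share at most \<open>K\<^sup>2\<close> pairs of vertices. This bounds the second
  moment (lemma \<open>expected_mean_flip_square\<close>), and the truncation error is at most a constant over \<open>K\<close>
  because balls have bounded expected size.
\<close>

section \<open>Majority dynamics and its potential\<close>

text \<open>Majority dynamics on an arbitrary vertex type, where \<open>N i\<close> is the set of vertices whose opinions
  are summed at \<open>i\<close>. The generality is needed for the infinite tree that covers a regular graph.\<close>

primrec dyn :: "('a \<Rightarrow> 'a set) \<Rightarrow> ('a \<Rightarrow> int) \<Rightarrow> nat \<Rightarrow> 'a \<Rightarrow> int" where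
  "dyn N x 0 = x"
| "dyn N x (Suc t) = (\<lambda>i. sgn (\<Sum>j\<in>N i. dyn N x t j))"

lemma majority_dynamics_eq_dyn: "majority_dynamics E x t = dyn (voters E) x t"
  by (induction t) auto

text \<open>The initial opinions for which vertex \<open>i\<close> has different opinions at times \<open>t\<close> and \<open>t + 2\<close>.\<close>

definition flips :: "('a \<Rightarrow> 'a set) \<Rightarrow> nat \<Rightarrow> 'a \<Rightarrow> ('a \<Rightarrow> int) set" where
  "flips N t i = {x. dyn N x (t + 2) i \<noteq> dyn N x t i}"

text \<open>A map \<open>\<pi>\<close> which is a bijection from the neighbourhood of each vertex onto the neighbourhood of its
  image commutes with the dynamics. To determine the opinion of \<open>w\<close> at time \<open>t\<close>, this is needed only on
  a family of sets \<open>A s\<close> of vertices whose opinions at time \<open>s\<close> matter. With \<open>\<pi> = id\<close> the lemma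
  expresses locality, with a bijection it expresses invariance under relabelling.\<close>

lemma dyn_covering:
  assumes cover: "\<And>s w. s < t \<Longrightarrow> w \<in> A (Suc s) \<Longrightarrow> N w \<subseteq> A s \<and> N' (\<pi> w) = \<pi> ` N w \<and> inj_on \<pi> (N w)"
    and init: "\<And>w. w \<in> A 0 \<Longrightarrow> y w = x (\<pi> w)"
    and w: "w \<in> A t"
  shows "dyn N y t w = dyn N' x t (\<pi> w)"
  using cover w
proof (induction t arbitrary: w)
  case 0
  then show ?case using init by simp
next
  case (Suc t)
  have c: "N w \<subseteq> A t" "N' (\<pi> w) = \<pi> ` N w" "inj_on \<pi> (N w)"
    using Suc.prems by auto
  have IH: "dyn N y t v = dyn N' x t (\<pi> v)" if "v \<in> N w" for v
  proof (rule Suc.IH)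
    show "N w \<subseteq> A s \<and> N' (\<pi> w) = \<pi> ` N w \<and> inj_on \<pi> (N w)"
      if "s < t" "w \<in> A (Suc s)" for s w using Suc.prems(1) that by (meson less_SucI)
    show "v \<in> A t" using c(1) that by blast
  qed
  show ?case
    using c IH by (simp add: sum.reindex)
qed

lemma finite_all_edges [simp]: "finite (all_edges n)"
  by (rule finite_subset[of _ "Pow {..<n}"]) (auto simp: all_edges_def)

lemma edge_iff: "E \<subseteq> all_edges n \<Longrightarrow> {i, j} \<in> E \<Longrightarrow> i < n \<and> j < n \<and> i \<noteq> j"
  unfolding all_edges_def by (auto simp: card_insert_if split: if_splits)

lemma pair_in_all_edges [simp]: "{i, j} \<in> all_edges n \<longleftrightarrow> i < n \<and> j < n \<and> i \<noteq> j"
  unfolding all_edges_def by (auto simp: card_insert_if split: if_splits)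

lemma edge_obtain:
  assumes "E \<subseteq> all_edges n" "e \<in> E"
  obtains i j where "e = {i, j}" "i < n" "j < n" "i \<noteq> j"
proof -
  have "e \<subseteq> {..<n}" "card e = 2" using assms by (auto simp: all_edges_def)
  then obtain i j where "e = {i, j}" "i \<noteq> j" by (auto simp: card_2_iff)
  then show ?thesis using that \<open>e \<subseteq> {..<n}\<close> by auto
qed

lemma mem_nbrs [simp]: "j \<in> nbrs E i \<longleftrightarrow> {i, j} \<in> E"
  by (simp add: nbrs_def)

lemma nbrs_sym: "j \<in> nbrs E i \<longleftrightarrow> i \<in> nbrs E j"
  by (simp add: insert_commute)

lemma nbrs_subset: "E \<subseteq> all_edges n \<Longrightarrow> nbrs E i \<subseteq> {..<n}"
  unfolding nbrs_def using edge_iff by blast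

lemma finite_nbrs: "E \<subseteq> all_edges n \<Longrightarrow> finite (nbrs E i)"
  by (rule finite_subset[OF nbrs_subset]) auto

lemma not_self_nbr: "E \<subseteq> all_edges n \<Longrightarrow> i \<notin> nbrs E i"
  unfolding nbrs_def using edge_iff by blast

lemma finite_voters: "E \<subseteq> all_edges n \<Longrightarrow> finite (voters E i)"
  by (simp add: voters_def finite_nbrs)

lemma voters_subset: "E \<subseteq> all_edges n \<Longrightarrow> i < n \<Longrightarrow> voters E i \<subseteq> {..<n}"
  using nbrs_subset[of E n i] by (auto simp: voters_def)

lemma voters_sym: "j \<in> voters E i \<longleftrightarrow> i \<in> voters E j"
  by (cases "i = j") (simp_all add: voters_def insert_commute)

lemma odd_card_voters: "E \<subseteq> all_edges n \<Longrightarrow> odd (card (voters E i))"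
  using finite_nbrs[of E n i] not_self_nbr[of E n i]
  by (simp add: voters_def vertex_degree_def)

lemma odd_sum_signs:
  fixes f :: "'a \<Rightarrow> int"
  assumes "finite A" "\<And>a. a \<in> A \<Longrightarrow> f a \<in> {-1, 1}"
  shows "odd (sum f A) \<longleftrightarrow> odd (card A)"
  using assms
proof (induction A rule: finite_induct)
  case (insert a A)
  have "odd (f a)" using insert.prems[of a] by auto
  then show ?case using insert by simp
qed simp

lemma sgn_odd: "odd (s :: int) \<Longrightarrow> sgn s \<in> {-1, 1}"
  by (auto simp: sgn_if)

lemma dyn_values:
  assumes "E \<subseteq> all_edges n" "\<And>i. i < n \<Longrightarrow> x i \<in> {-1, 1}" "i < n"
  shows "dyn (voters E) x t i \<in> {-1, 1}"
  using assms(3)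
proof (induction t arbitrary: i)
  case 0
  then show ?case using assms(2) by simp
next
  case (Suc t)
  have "odd (\<Sum>j\<in>voters E i. dyn (voters E) x t j)"
    using odd_sum_signs[OF finite_voters[OF assms(1)], of i "dyn (voters E) x t"]
      Suc voters_subset[OF assms(1) Suc.prems] odd_card_voters[OF assms(1)] by blast
  then show ?case using sgn_odd by simp
qed

text \<open>The total number of flips is bounded uniformly in time, by the potential argument of Goles and
  Olivos.\<close>

lemma sum_flips_le:
  assumes E: "E \<subseteq> all_edges n" and x: "\<And>i. i < n \<Longrightarrow> x i \<in> {-1, 1}"
  shows "(\<Sum>t<T. card {i \<in> {..<n}. x \<in> flips (voters E) t i}) \<le> (\<Sum>i<n. card (voters E i))"
proof -
  let ?N = "voters E"
  let ?X = "dyn ?N x"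
  \<comment> \<open>The potential is bounded in absolute value by the right-hand side and grows by at least 2 at every flip.\<close>
  define L where "L t = (\<Sum>i<n. \<Sum>j\<in>?N i. ?X (Suc t) i * ?X t j)" for t
  have val: "?X t i \<in> {-1, 1}" if "i < n" for t i
    using dyn_values[OF E x that] .
  have restr: "(\<Sum>j\<in>?N i. f j) = (\<Sum>j<n. if j \<in> ?N i then f j else 0)" if "i < n" for f :: "nat \<Rightarrow> int" and i
    using voters_subset[OF E that] by (intro sum.mono_neutral_cong_left) auto
  \<comment> \<open>The relation \<open>j \<in> voters E i\<close> is symmetric, so the two time indices can be exchanged.\<close>
  have L_sym: "L t = (\<Sum>i<n. \<Sum>j\<in>?N i. ?X t i * ?X (Suc t) j)" for t
  proof -
    have "L t = (\<Sum>i<n. \<Sum>j<n. if j \<in> ?N i then ?X (Suc t) i * ?X t j else 0)"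
      unfolding L_def by (rule sum.cong[OF refl], rule restr) simp
    also have "\<dots> = (\<Sum>j<n. \<Sum>i<n. if j \<in> ?N i then ?X (Suc t) i * ?X t j else 0)"
      by (rule sum.swap)
    also have "\<dots> = (\<Sum>i<n. \<Sum>j<n. if j \<in> ?N i then ?X t i * ?X (Suc t) j else 0)"
      by (intro sum.cong refl) (simp add: voters_sym[of _ E] mult.commute del: dyn.simps)
    also have "\<dots> = (\<Sum>i<n. \<Sum>j\<in>?N i. ?X t i * ?X (Suc t) j)"
      by (rule sum.cong[OF refl], rule restr[symmetric]) simp
    finally show ?thesis .
  qed
  have step: "2 * int (card {i \<in> {..<n}. x \<in> flips ?N t i}) \<le> L (Suc t) - L t" for t
  proof -
    have "2 * int (card {i \<in> {..<n}. x \<in> flips ?N t i}) = (\<Sum>i<n. if x \<in> flips ?N t i then 2 else 0)"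
      by (simp add: sum.If_cases Int_def)
    also have "\<dots> \<le> (\<Sum>i<n. (?X (Suc (Suc t)) i - ?X t i) * (\<Sum>j\<in>?N i. ?X (Suc t) j))"
    proof (rule sum_mono)
      fix i assume i: "i \<in> {..<n}"
      define s where "s = (\<Sum>j\<in>?N i. ?X (Suc t) j)"
      have "?X (Suc t) j \<in> {-1, 1}" if "j \<in> ?N i" for j
        using val voters_subset[OF E, of i] i that by blast
      then have "odd s"
        unfolding s_def using odd_sum_signs[OF finite_voters[OF E]] odd_card_voters[OF E] by blast
      moreover have "?X (Suc (Suc t)) i = sgn s" by (simp add: s_def)
      moreover have "?X t i \<in> {-1, 1}" using val i by blast
      moreover have "(if b \<noteq> c then 2 else 0) \<le> (b - c) * s" if "odd s" "b = sgn s" "c \<in> {-1, 1}" for b c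
        using that by (auto simp: sgn_if)
      ultimately have "(if ?X (Suc (Suc t)) i \<noteq> ?X t i then 2 else 0) \<le> (?X (Suc (Suc t)) i - ?X t i) * s"
        by blast
      then show "(if x \<in> flips ?N t i then 2 else 0)
          \<le> (?X (Suc (Suc t)) i - ?X t i) * (\<Sum>j\<in>?N i. ?X (Suc t) j)"
        unfolding s_def flips_def by (simp del: dyn.simps)
    qed
    also have "\<dots> = L (Suc t) - L t"
      unfolding L_sym[of t] L_def[of "Suc t"]
      by (simp add: left_diff_distrib sum_distrib_left sum_subtractf del: dyn.simps)
    finally show ?thesis .
  qed
  have bound: "\<bar>L t\<bar> \<le> int (\<Sum>i<n. card (?N i))" for t
  proof -
    have "\<bar>L t\<bar> \<le> (\<Sum>i<n. \<Sum>j\<in>?N i. \<bar>?X (Suc t) i * ?X t j\<bar>)"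
      unfolding L_def by (rule order_trans[OF sum_abs sum_mono[OF sum_abs]])
    also have "\<dots> = (\<Sum>i<n. \<Sum>j\<in>?N i. 1)"
    proof (intro sum.cong refl)
      fix i j assume "i \<in> {..<n}" "j \<in> ?N i"
      then have "?X (Suc t) i \<in> {-1,1}" "?X t j \<in> {-1,1}"
        using val voters_subset[OF E, of i] by blast+
      then show "\<bar>?X (Suc t) i * ?X t j\<bar> = 1" by (auto simp: abs_mult)
    qed
    finally show ?thesis by simp
  qed
  have "2 * int (\<Sum>t<T. card {i \<in> {..<n}. x \<in> flips ?N t i}) \<le> (\<Sum>t<T. L (Suc t) - L t)"
    unfolding of_nat_sum sum_distrib_left by (rule sum_mono[OF step])
  also have "\<dots> = L T - L 0" by (rule sum_lessThan_telescope)
  also have "\<dots> \<le> 2 * int (\<Sum>i<n. card (?N i))" using bound[of T] bound[of 0] by linarith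
  finally show ?thesis by (simp only: of_nat_le_iff mult_le_cancel_left_pos zero_less_numeral)
qed

section \<open>Balls and locality of the dynamics\<close>

text \<open>The ball of radius \<open>r\<close> around \<open>i\<close> in the graph metric of \<open>E\<close>.\<close>

primrec gball :: "nat set set \<Rightarrow> nat \<Rightarrow> nat \<Rightarrow> nat set" where
  "gball E 0 i = {i}"
| "gball E (Suc r) i = gball E r i \<union> (\<Union>v\<in>gball E r i. nbrs E v)"

lemma gball_Suc_mono: "gball E r i \<subseteq> gball E (Suc r) i"
  by simp

lemma gball_mono: "r \<le> s \<Longrightarrow> gball E r i \<subseteq> gball E s i"
  by (rule lift_Suc_mono_le[of "\<lambda>r. gball E r i"]) simp_all

lemma self_in_gball [simp]: "i \<in> gball E r i"
  by (induction r) auto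

lemma nbrs_gball: "v \<in> gball E r i \<Longrightarrow> nbrs E v \<subseteq> gball E (Suc r) i"
  by auto

lemma voters_gball: "v \<in> gball E r i \<Longrightarrow> voters E v \<subseteq> gball E (Suc r) i"
  by (auto simp: voters_def split: if_splits)

lemma gball_trans: "j \<in> gball E r i \<Longrightarrow> k \<in> gball E s j \<Longrightarrow> k \<in> gball E (r + s) i"
proof (induction s arbitrary: k)
  case (Suc s)
  show ?case
  proof (cases "k \<in> gball E s j")
    case True
    then show ?thesis using Suc gball_Suc_mono[of E "r + s" i] by auto
  next
    case False
    then obtain v where "v \<in> gball E s j" "k \<in> nbrs E v" using Suc.prems by auto
    then show ?thesis using Suc.IH[of v] Suc.prems by auto
  qed
qed simp

lemma gball_sym: "j \<in> gball E r i \<Longrightarrow> i \<in> gball E r j"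
proof (induction r arbitrary: j)
  case (Suc r)
  show ?case
  proof (cases "j \<in> gball E r i")
    case True
    then show ?thesis using Suc gball_Suc_mono[of E r j] by blast
  next
    case False
    then obtain v where v: "v \<in> gball E r i" "j \<in> nbrs E v" using Suc.prems by auto
    have "v \<in> gball E 1 j" using v(2) by (simp add: insert_commute)
    then have "i \<in> gball E (1 + r) j" using Suc.IH[OF v(1)] gball_trans by blast
    then show ?thesis by simp
  qed
qed simp

lemma gball_subset: "E \<subseteq> all_edges n \<Longrightarrow> i < n \<Longrightarrow> gball E r i \<subseteq> {..<n}"
proof (induction r)
  case (Suc r)
  then show ?case using nbrs_subset[OF Suc.prems(1)] by auto
qed simp

lemma finite_gball: "E \<subseteq> all_edges n \<Longrightarrow> finite (gball E r i)"
  by (induction r) (auto simp: finite_nbrs)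

lemma gball_meet:
  assumes "gball E r i \<inter> gball E r j \<noteq> {}"
  shows "j \<in> gball E (2 * r) i"
proof -
  obtain v where "v \<in> gball E r i" "v \<in> gball E r j" using assms by blast
  then show ?thesis using gball_trans[OF _ gball_sym[of v E r j]] by (simp add: mult_2)
qed

text \<open>The number of ordered pairs of vertices at distance at most \<open>R\<close>.\<close>

definition ball_pairs :: "nat \<Rightarrow> nat \<Rightarrow> nat set set \<Rightarrow> real" where
  "ball_pairs n R E = (\<Sum>i<n. real (card (gball E R i)))"

lemma dyn_local:
  assumes same: "\<And>v. v \<in> gball E t i \<Longrightarrow> x v = y v"
  shows "dyn (voters E) x t i = dyn (voters E) y t i"
proof -
  have "dyn (voters E) x t i = dyn (voters E) y t (id i)"
  proof (rule dyn_covering[where A = "\<lambda>s. gball E (t - s) i"])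
    fix s w assume "s < t" "w \<in> gball E (t - Suc s) i"
    then show "voters E w \<subseteq> gball E (t - s) i \<and> voters E (id w) = id ` voters E w \<and> inj_on id (voters E w)"
      using voters_gball[of w E "t - Suc s" i] by (simp add: Suc_diff_Suc)
  qed (use same in auto)
  then show ?thesis by simp
qed

section \<open>Random opinions\<close>

text \<open>The law of independent uniform opinions on \<open>A\<close>, with the default value 0 outside \<open>A\<close>.\<close>

definition opinions :: "'a set \<Rightarrow> ('a \<Rightarrow> int) pmf" where
  "opinions A = Pi_pmf A 0 (\<lambda>_. pmf_of_set {-1, 1})"

lemma initial_opinions_eq: "initial_opinions n = opinions {..<n}"
  by (simp add: initial_opinions_def opinions_def)

lemma set_opinions:
  assumes "finite A" "x \<in> set_pmf (opinions A)"
  shows "a \<in> A \<Longrightarrow> x a \<in> {-1, 1}" "a \<notin> A \<Longrightarrow> x a = 0"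
  using assms by (auto simp: opinions_def set_Pi_pmf PiE_dflt_def)

lemma finite_set_opinions [simp]: "finite A \<Longrightarrow> finite (set_pmf (opinions A))"
  unfolding opinions_def by (subst set_Pi_pmf) (auto intro!: finite_PiE_dflt)

abbreviation restr0 :: "'a set \<Rightarrow> ('a \<Rightarrow> int) \<Rightarrow> 'a \<Rightarrow> int" where
  "restr0 S x \<equiv> (\<lambda>a. if a \<in> S then x a else 0)"

text \<open>Random opinions on \<open>V\<close>, read through a map that is injective on \<open>A\<close>, are random opinions on \<open>A\<close>.\<close>

lemma opinions_reindex:
  fixes \<pi> :: "'a \<Rightarrow> nat"
  assumes "finite A" "inj_on \<pi> A" "finite V" "\<pi> ` A \<subseteq> V"
  shows "map_pmf (\<lambda>x. restr0 A (x \<circ> \<pi>)) (opinions V) = opinions A"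
proof -
  \<comment> \<open>Outside \<open>A\<close> the map is redirected to a point that is not in the image of \<open>A\<close>.\<close>
  obtain z where z: "z \<notin> \<pi> ` A" using assms(1) ex_new_if_finite[of "\<pi> ` A"] by auto
  define h where "h a = (if a \<in> A then \<pi> a else z)" for a
  have b: "bij_betw h A (\<pi> ` A)"
    using assms(2) by (auto simp: bij_betw_def h_def inj_on_def)
  have "opinions A = map_pmf (\<lambda>g. g \<circ> h) (opinions (\<pi> ` A))"
    unfolding opinions_def by (rule Pi_pmf_bij_betw[OF assms(1) b]) (auto simp: h_def z)
  also have "opinions (\<pi> ` A) = map_pmf (restr0 (\<pi> ` A)) (opinions V)"
    unfolding opinions_def by (rule Pi_pmf_subset[OF assms(3,4)])
  finally have "opinions A = map_pmf (\<lambda>x. restr0 (\<pi> ` A) x \<circ> h) (opinions V)"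
    by (simp add: map_pmf_comp o_def)
  moreover have "restr0 (\<pi> ` A) x \<circ> h = restr0 A (x \<circ> \<pi>)" for x
    using z by (auto simp: h_def)
  ultimately show ?thesis by simp
qed

text \<open>The probability that \<open>i\<close> flips at time \<open>t\<close>, when the opinions on \<open>A\<close> are random.\<close>

definition flip_prob :: "'a set \<Rightarrow> ('a \<Rightarrow> 'a set) \<Rightarrow> nat \<Rightarrow> 'a \<Rightarrow> real" where
  "flip_prob A N t i = measure_pmf.prob (opinions A) (flips N t i)"

text \<open>If \<open>\<pi>\<close> is a covering and is injective on all vertices that matter, the lifted opinions are again
  independent, so the flip probability of \<open>\<pi> i\<close> is the flip probability of \<open>i\<close>.\<close>

lemma flip_prob_covering:
  fixes \<pi> :: "'a \<Rightarrow> nat"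
  assumes A: "finite (A 0)" "inj_on \<pi> (A 0)" and V: "finite V" "\<pi> ` A 0 \<subseteq> V"
    and cover: "\<And>s w. s < t + 2 \<Longrightarrow> w \<in> A (Suc s) \<Longrightarrow> N w \<subseteq> A s \<and> N' (\<pi> w) = \<pi> ` N w"
    and mono: "\<And>s. A (Suc s) \<subseteq> A s" and root: "i \<in> A (t + 2)"
  shows "flip_prob V N' t (\<pi> i) = flip_prob (A 0) N t i"
proof -
  have anti: "A s' \<subseteq> A s" if "s \<le> s'" for s s'
    using that by (rule lift_Suc_antimono_le[of A, OF mono])
  have c: "N w \<subseteq> A s \<and> N' (\<pi> w) = \<pi> ` N w \<and> inj_on \<pi> (N w)" if "s < t + 2" "w \<in> A (Suc s)" for s w
    using cover[OF that] anti[of 0 s] inj_on_subset[OF A(2)] by blast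
  have eq: "dyn N (restr0 (A 0) (x \<circ> \<pi>)) u i = dyn N' x u (\<pi> i)" if "u \<le> t + 2" for x u
  proof (rule dyn_covering[where A = A])
    show "i \<in> A u" using root anti[OF that] by auto
    show "N w \<subseteq> A s \<and> N' (\<pi> w) = \<pi> ` N w \<and> inj_on \<pi> (N w)" if "s < u" "w \<in> A (Suc s)" for s w
      by (rule c) (use that \<open>u \<le> t + 2\<close> in auto)
  qed simp
  have "flip_prob (A 0) N t i
      = measure_pmf.prob (map_pmf (\<lambda>x. restr0 (A 0) (x \<circ> \<pi>)) (opinions V)) (flips N t i)"
    unfolding flip_prob_def opinions_reindex[OF A V] ..
  also have "\<dots> = measure_pmf.prob (opinions V) (flips N' t (\<pi> i))"
    using eq[of "t + 2"] eq[of t] by (simp add: flips_def vimage_def del: dyn.simps)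
  finally show ?thesis unfolding flip_prob_def ..
qed

section \<open>Expectations over finitely supported laws\<close>

lemma expectation_pair:
  fixes f :: "'a \<times> 'b \<Rightarrow> real"
  assumes "finite (set_pmf M)" "finite (set_pmf N)"
  shows "measure_pmf.expectation (pair_pmf M N) f
    = measure_pmf.expectation M (\<lambda>a. measure_pmf.expectation N (\<lambda>b. f (a, b)))"
proof -
  have "measure_pmf.expectation (pair_pmf M N) f
      = (\<Sum>(a, b)\<in>set_pmf M \<times> set_pmf N. pmf M a * (pmf N b * f (a, b)))"
    using assms by (subst integral_measure_pmf[of "set_pmf M \<times> set_pmf N"])
      (auto simp: pmf_pair mult.assoc intro!: sum.cong)
  also have "\<dots> = (\<Sum>a\<in>set_pmf M. pmf M a * (\<Sum>b\<in>set_pmf N. pmf N b * f (a, b)))"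
    by (simp add: sum.cartesian_product sum_distrib_left)
  also have "\<dots> = measure_pmf.expectation M (\<lambda>a. measure_pmf.expectation N (\<lambda>b. f (a, b)))"
    using assms by (simp add: integral_measure_pmf[of "set_pmf M"] integral_measure_pmf[of "set_pmf N"])
  finally show ?thesis .
qed

lemma prob_eq_expectation: "measure_pmf.prob M A = measure_pmf.expectation M (indicator A)"
  by simp

lemma prob_pair_times:
  assumes "finite (set_pmf M)" "finite (set_pmf N)"
  shows "measure_pmf.prob (pair_pmf M N) (A \<times> B) = measure_pmf.prob M A * measure_pmf.prob N B"
  unfolding prob_eq_expectation expectation_pair[OF assms]
  by (simp add: indicator_times)

lemma markov_prob:
  assumes "finite (set_pmf M)" "\<And>x. x \<in> set_pmf M \<Longrightarrow> 0 \<le> u x" "0 < (c::real)"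
    and "\<And>x. x \<in> set_pmf M \<Longrightarrow> x \<in> A \<Longrightarrow> c \<le> u x"
  shows "measure_pmf.prob M A \<le> measure_pmf.expectation M u / c"
proof -
  have "measure_pmf.prob M A \<le> measure_pmf.prob M {x. c \<le> u x}"
    by (rule measure_pmf.finite_measure_mono_AE) (use assms(4) in \<open>auto simp: AE_measure_pmf_iff\<close>)
  also have "\<dots> \<le> measure_pmf.expectation M u / c"
    using integral_Markov_inequality_measure[of "measure_pmf M" u "{}" c] assms
    by (auto simp: AE_measure_pmf_iff intro!: integrable_measure_pmf_finite)
  finally show ?thesis .
qed

text \<open>Events that depend on the opinions in two disjoint sets are independent.\<close>

lemma indep_events:
  assumes V: "finite V" "S \<union> S' \<subseteq> V" "S \<inter> S' = {}"
    and F: "\<And>x. x \<in> F \<longleftrightarrow> restr0 S x \<in> F" and F': "\<And>x. x \<in> F' \<longleftrightarrow> restr0 S' x \<in> F'"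
  shows "measure_pmf.prob (opinions V) (F \<inter> F')
    = measure_pmf.prob (opinions V) F * measure_pmf.prob (opinions V) F'"
proof -
  have fin: "finite S" "finite S'" using V finite_subset by auto
  have marg: "measure_pmf.prob (opinions V) G = measure_pmf.prob (opinions W) G"
    if "W \<subseteq> V" "\<And>x. x \<in> G \<longleftrightarrow> restr0 W x \<in> G" for W G
  proof -
    have "opinions W = map_pmf (restr0 W) (opinions V)"
      unfolding opinions_def by (rule Pi_pmf_subset[OF V(1) that(1)])
    then show ?thesis using that(2) by (simp add: vimage_def)
  qed
  have comb: "x \<in> F \<inter> F' \<longleftrightarrow> restr0 (S \<union> S') x \<in> F \<inter> F'" for x
  proof -
    have "restr0 S (restr0 (S \<union> S') x) = restr0 S x" "restr0 S' (restr0 (S \<union> S') x) = restr0 S' x"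
      by auto
    then have "x \<in> F \<longleftrightarrow> restr0 (S \<union> S') x \<in> F" "x \<in> F' \<longleftrightarrow> restr0 (S \<union> S') x \<in> F'"
      using F[of x] F[of "restr0 (S \<union> S') x"] F'[of x] F'[of "restr0 (S \<union> S') x"] by argo+
    then show ?thesis by blast
  qed
  have "measure_pmf.prob (opinions V) (F \<inter> F') = measure_pmf.prob (opinions (S \<union> S')) (F \<inter> F')"
    by (rule marg[OF V(2) comb])
  also have "opinions (S \<union> S') = map_pmf (\<lambda>(f, g) x. if x \<in> S then f x else g x) (pair_pmf (opinions S) (opinions S'))"
    unfolding opinions_def by (rule Pi_pmf_union[OF fin V(3)])
  also have "measure_pmf.prob \<dots> (F \<inter> F') = measure_pmf.prob (pair_pmf (opinions S) (opinions S')) (F \<times> F')"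
  proof -
    have "(\<lambda>x. if x \<in> S then f x else g x) \<in> F \<longleftrightarrow> f \<in> F" for f g
    proof -
      have "restr0 S (\<lambda>x. if x \<in> S then f x else g x) = restr0 S f" by auto
      then show ?thesis using F[of f] F[of "\<lambda>x. if x \<in> S then f x else g x"] by argo
    qed
    moreover have "(\<lambda>x. if x \<in> S then f x else g x) \<in> F' \<longleftrightarrow> g \<in> F'" for f g
    proof -
      have "restr0 S' (\<lambda>x. if x \<in> S then f x else g x) = restr0 S' g" using V(3) by (intro ext) auto
      then show ?thesis using F'[of g] F'[of "\<lambda>x. if x \<in> S then f x else g x"] by argo
    qed
    ultimately have "(\<lambda>(f, g) x. if x \<in> S then f x else g x) -` (F \<inter> F') = F \<times> F'" by auto
    then show ?thesis by simp
  qed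
  also have "\<dots> = measure_pmf.prob (opinions S) F * measure_pmf.prob (opinions S') F'"
    using fin by (simp add: prob_pair_times)
  also have "\<dots> = measure_pmf.prob (opinions V) F * measure_pmf.prob (opinions V) F'"
    using marg[OF _ F] marg[OF _ F'] V(2) by simp
  finally show ?thesis .
qed

text \<open>Second moment of the proportion of vertices \<open>i\<close> for which an event \<open>F i\<close> occurs, where \<open>F i\<close> depends
  on the opinions within distance \<open>R\<close> of \<open>i\<close>: only pairs of vertices at distance at most \<open>2 * R\<close> can be
  correlated.\<close>

lemma second_moment_given_graph:
  fixes a :: real
  assumes E: "E \<subseteq> all_edges n"
    and loc: "\<And>i x y. i < n \<Longrightarrow> (\<And>v. v \<in> gball E R i \<Longrightarrow> x v = y v) \<Longrightarrow> x \<in> F i \<longleftrightarrow> y \<in> F i"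
  shows "measure_pmf.expectation (opinions {..<n}) (\<lambda>x. (real (card {i \<in> {..<n}. x \<in> F i}) / n - a)\<^sup>2)
    \<le> ((\<Sum>i<n. measure_pmf.prob (opinions {..<n}) (F i)) / n - a)\<^sup>2 + ball_pairs n (2 * R) E / n\<^sup>2"
proof -
  let ?M = "opinions {..<n}"
  let ?P = "measure_pmf.prob ?M"
  let ?E = "measure_pmf.expectation ?M"
  have int [simp]: "integrable (measure_pmf ?M) f" for f :: "_ \<Rightarrow> real"
    by (rule integrable_measure_pmf_finite) simp
  have pair: "?P (F i \<inter> F j) \<le> ?P (F i) * ?P (F j) + indicator (gball E (2 * R) i) j"
    if "i < n" "j < n" for i j
  proof (cases "gball E R i \<inter> gball E R j = {}")
    case True
    have "?P (F i \<inter> F j) = ?P (F i) * ?P (F j)"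
      by (rule indep_events[OF _ _ True])
        (use gball_subset[OF E] that in \<open>auto intro!: loc\<close>)
    then show ?thesis by simp
  next
    case False
    then have "indicator (gball E (2 * R) i) j = (1::real)" using gball_meet by auto
    then show ?thesis using measure_pmf.prob_le_1[of ?M "F i \<inter> F j"] by (simp add: add_increasing)
  qed
  have card_eq: "real (card {i \<in> {..<n}. x \<in> F i}) = (\<Sum>i<n. indicator (F i) x)" for x
    by (simp add: indicator_def sum.If_cases Int_def)
  have sq: "(real (card {i \<in> {..<n}. x \<in> F i}) / n - a)\<^sup>2
      = (\<Sum>i<n. \<Sum>j<n. indicator (F i \<inter> F j) x) / n\<^sup>2 - 2 * a / n * (\<Sum>i<n. indicator (F i) x) + a\<^sup>2" for x
  proof -
    have "(\<Sum>i<n. indicator (F i) x :: real)\<^sup>2 = (\<Sum>i<n. \<Sum>j<n. indicator (F i \<inter> F j) x)"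
      by (simp add: power2_eq_square sum_product indicator_inter_arith)
    then show ?thesis
      unfolding card_eq by (simp add: power2_diff power_divide)
  qed
  have "?E (\<lambda>x. (real (card {i \<in> {..<n}. x \<in> F i}) / n - a)\<^sup>2)
      = (\<Sum>i<n. \<Sum>j<n. ?P (F i \<inter> F j)) / n\<^sup>2 - 2 * a / n * (\<Sum>i<n. ?P (F i)) + a\<^sup>2"
    unfolding sq by simp
  also have "(\<Sum>i<n. \<Sum>j<n. ?P (F i \<inter> F j)) \<le> (\<Sum>i<n. \<Sum>j<n. ?P (F i) * ?P (F j) + indicator (gball E (2 * R) i) j)"
    by (intro sum_mono pair) auto
  also have "\<dots> = (\<Sum>i<n. ?P (F i))\<^sup>2 + ball_pairs n (2 * R) E"
  proof -
    have "(\<Sum>j<n. indicator (gball E (2 * R) i) j) = real (card (gball E (2 * R) i))" if "i < n" for i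
    proof -
      have "{..<n} \<inter> gball E (2 * R) i = gball E (2 * R) i" using gball_subset[OF E that] by blast
      then show ?thesis by (simp add: indicator_def sum.If_cases)
    qed
    then show ?thesis
      by (simp add: sum.distrib power2_eq_square sum_product ball_pairs_def)
  qed
  finally have "?E (\<lambda>x. (real (card {i \<in> {..<n}. x \<in> F i}) / n - a)\<^sup>2)
      \<le> ((\<Sum>i<n. ?P (F i))\<^sup>2 + ball_pairs n (2 * R) E) / n\<^sup>2 - 2 * a / n * (\<Sum>i<n. ?P (F i)) + a\<^sup>2"
    by (simp add: divide_right_mono)
  also have "\<dots> = ((\<Sum>i<n. ?P (F i)) / n - a)\<^sup>2 + ball_pairs n (2 * R) E / n\<^sup>2"
    by (simp add: power2_diff power_divide add_divide_distrib)
  finally show ?thesis .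
qed

section \<open>From concentration of the mean flip rate to the conclusion\<close>

text \<open>The expected proportion of flips at time \<open>t\<close> given the graph.\<close>

definition mean_flip :: "nat \<Rightarrow> nat \<Rightarrow> nat set set \<Rightarrow> real" where
  "mean_flip n t E = (\<Sum>i<n. flip_prob {..<n} (voters E) t i) / n"

lemma flip_prob_bounds: "0 \<le> flip_prob A N t i" "flip_prob A N t i \<le> 1"
  by (auto simp: flip_prob_def)

lemma mean_flip_bounds: "0 \<le> mean_flip n t E" "mean_flip n t E \<le> 1"
proof -
  show "0 \<le> mean_flip n t E" by (auto simp: mean_flip_def intro!: divide_nonneg_nonneg sum_nonneg flip_prob_bounds)
  have "(\<Sum>i<n. flip_prob {..<n} (voters E) t i) \<le> (\<Sum>i<n. 1)"
    by (intro sum_mono flip_prob_bounds)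
  then show "mean_flip n t E \<le> 1" by (simp add: mean_flip_def divide_le_eq)
qed

lemma flips_local:
  assumes "\<And>v. v \<in> gball E (t + 2) i \<Longrightarrow> x v = y v"
  shows "x \<in> flips (voters E) t i \<longleftrightarrow> y \<in> flips (voters E) t i"
proof -
  have "dyn (voters E) x (t + 2) i = dyn (voters E) y (t + 2) i"
    by (rule dyn_local) (use assms in auto)
  moreover have "dyn (voters E) x t i = dyn (voters E) y t i"
    by (rule dyn_local) (use assms gball_mono[of t "t + 2" E i] in auto)
  ultimately show ?thesis by (simp add: flips_def del: dyn.simps)
qed

lemma sum_mean_flip_le:
  assumes E: "E \<subseteq> all_edges n"
  shows "(\<Sum>t<T. mean_flip n t E) \<le> ball_pairs n 1 E / n"
proof -
  let ?M = "opinions {..<n}"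
  have int [simp]: "integrable (measure_pmf ?M) f" for f :: "_ \<Rightarrow> real"
    by (rule integrable_measure_pmf_finite) simp
  have "(\<Sum>t<T. \<Sum>i<n. flip_prob {..<n} (voters E) t i)
      = measure_pmf.expectation ?M (\<lambda>x. \<Sum>t<T. \<Sum>i<n. indicator (flips (voters E) t i) x)"
    by (simp add: flip_prob_def)
  also have "\<dots> = measure_pmf.expectation ?M (\<lambda>x. real (\<Sum>t<T. card {i \<in> {..<n}. x \<in> flips (voters E) t i}))"
    by (simp add: indicator_def sum.If_cases Int_def)
  also have "\<dots> \<le> measure_pmf.expectation ?M (\<lambda>x. real (\<Sum>i<n. card (voters E i)))"
  proof (rule integral_mono_AE)
    show "AE x in measure_pmf ?M. real (\<Sum>t<T. card {i \<in> {..<n}. x \<in> flips (voters E) t i})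
        \<le> real (\<Sum>i<n. card (voters E i))"
      unfolding AE_measure_pmf_iff
    proof
      fix x assume x: "x \<in> set_pmf ?M"
      have "x i \<in> {-1, 1}" if "i < n" for i
        using set_opinions(1)[OF _ x, of i] that by simp
      from sum_flips_le[OF E this] show "real (\<Sum>t<T. card {i \<in> {..<n}. x \<in> flips (voters E) t i})
        \<le> real (\<Sum>i<n. card (voters E i))" unfolding of_nat_le_iff .
    qed
  qed auto
  also have "\<dots> = (\<Sum>i<n. real (card (voters E i)))" by simp
  also have "\<dots> \<le> ball_pairs n 1 E"
    unfolding ball_pairs_def
  proof (intro sum_mono of_nat_mono card_mono)
    show "finite (gball E 1 i)" for i by (rule finite_gball[OF E])
    show "voters E i \<subseteq> gball E 1 i" for i using voters_gball[of i E 0 i] by simp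
  qed
  finally show ?thesis
    by (simp add: mean_flip_def sum_divide_distrib[symmetric] divide_right_mono)
qed

lemma map_uminus_opinions:
  assumes "finite A"
  shows "map_pmf (\<lambda>x i. - x i) (opinions A) = opinions A"
proof -
  have "map_pmf uminus (pmf_of_set {-1, 1::int}) = pmf_of_set {-1, 1}"
    by (subst map_pmf_of_set_inj) (auto simp: insert_commute)
  then have "opinions A = Pi_pmf A 0 (\<lambda>_. map_pmf uminus (pmf_of_set {-1, 1}))"
    by (simp add: opinions_def)
  also have "\<dots> = map_pmf (\<lambda>h. uminus \<circ> h) (opinions A)"
    unfolding opinions_def by (rule Pi_pmf_map) (use assms in auto)
  finally show ?thesis by (simp add: o_def)
qed

lemma dyn_uminus: "dyn N (\<lambda>i. - x i) t i = - dyn N x t i"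
  by (induction t arbitrary: i) (simp_all add: sum_negf sgn_minus)

text \<open>The dynamics is odd in the initial opinions, whose law is symmetric.\<close>

lemma prob_opinion_half:
  assumes E: "E \<subseteq> all_edges n" and i: "i < n"
  shows "measure_pmf.prob (opinions {..<n}) {x. dyn (voters E) x t i = 1} = 1 / 2"
proof -
  let ?M = "opinions {..<n}" and ?X = "\<lambda>x. dyn (voters E) x t i"
  have "measure_pmf.prob ?M {x. ?X x = 1} = measure_pmf.prob (map_pmf (\<lambda>x i. - x i) ?M) {x. ?X x = 1}"
    by (simp add: map_uminus_opinions)
  also have "\<dots> = measure_pmf.prob ?M {x. ?X x = -1}"
    by (simp add: vimage_def dyn_uminus eq_neg_iff_add_eq_0 neg_eq_iff_add_eq_0)
  finally have sym: "measure_pmf.prob ?M {x. ?X x = 1} = measure_pmf.prob ?M {x. ?X x = -1}" .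
  have "measure_pmf.prob ?M ({x. ?X x = 1} \<union> {x. ?X x = -1}) = 1"
  proof -
    have "set_pmf ?M \<subseteq> {x. ?X x = 1} \<union> {x. ?X x = -1}"
    proof
      fix x assume x: "x \<in> set_pmf ?M"
      have "x j \<in> {-1, 1}" if "j < n" for j
        using set_opinions(1)[OF _ x, of j] that by simp
      then have "?X x \<in> {-1, 1}" by (rule dyn_values[OF E _ i])
      then show "x \<in> {x. ?X x = 1} \<union> {x. ?X x = -1}" by auto
    qed
    then show ?thesis by (simp add: measure_pmf.prob_eq_1 AE_measure_pmf_iff subset_iff)
  qed
  moreover have "measure_pmf.prob ?M ({x. ?X x = 1} \<union> {x. ?X x = -1})
      = measure_pmf.prob ?M {x. ?X x = 1} + measure_pmf.prob ?M {x. ?X x = -1}"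
    by (rule measure_pmf.finite_measure_Union) auto
  ultimately show ?thesis using sym by simp
qed

lemma square_expectation_le:
  fixes f :: "'a \<Rightarrow> real"
  assumes "finite (set_pmf M)"
  shows "(measure_pmf.expectation M f - a)\<^sup>2 \<le> measure_pmf.expectation M (\<lambda>x. (f x - a)\<^sup>2)"
proof -
  have int [simp]: "integrable (measure_pmf M) f" for f :: "_ \<Rightarrow> real"
    by (rule integrable_measure_pmf_finite) (rule assms)
  define m where "m = measure_pmf.expectation M f"
  have "0 \<le> measure_pmf.expectation M (\<lambda>x. (f x - m)\<^sup>2)"
    by simp
  also have "(\<lambda>x. (f x - m)\<^sup>2) = (\<lambda>x. (f x - a)\<^sup>2 - 2 * (m - a) * f x + (m\<^sup>2 - a\<^sup>2))"
    by (auto simp: power2_eq_square algebra_simps)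
  also have "measure_pmf.expectation M \<dots>
      = measure_pmf.expectation M (\<lambda>x. (f x - a)\<^sup>2) - 2 * (m - a) * m + (m\<^sup>2 - a\<^sup>2)"
    by (simp add: m_def)
  finally show ?thesis by (simp add: m_def power2_eq_square algebra_simps)
qed

lemma whp_mono:
  assumes "whp F G P" and "\<And>n E x. P n E x \<Longrightarrow> Q n E x"
  shows "whp F G Q"
  unfolding whp_def
proof (rule tendsto_sandwich[OF _ _ assms(1)[unfolded whp_def] tendsto_const])
  show "\<forall>\<^sub>F n in F. measure_pmf.prob (pair_pmf (G n) (initial_opinions n)) {(E, x). P n E x}
      \<le> measure_pmf.prob (pair_pmf (G n) (initial_opinions n)) {(E, x). Q n E x}"
    by (intro always_eventually allI measure_pmf.finite_measure_mono) (use assms(2) in auto)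
qed simp

text \<open>A sequence of random graphs in which the number of pairs at bounded distance is linear in \<open>n\<close> on
  average. Limits are taken along \<open>F\<close>, which is finer than \<open>sequentially\<close>.\<close>

locale graph_laws =
  fixes F :: "nat filter" and G :: "nat \<Rightarrow> nat set set pmf"
  assumes F_le: "F \<le> sequentially"
    and graphs: "\<forall>\<^sub>F n in F. set_pmf (G n) \<subseteq> Pow (all_edges n)"
    and balls: "\<And>R. \<exists>C::real. \<forall>\<^sub>F n in F. measure_pmf.expectation (G n) (ball_pairs n R) \<le> C * n"
begin

lemma tendsto_F: "(f \<longlongrightarrow> l) sequentially \<Longrightarrow> (f \<longlongrightarrow> l) F"
  using F_le filterlim_mono by blast

lemma finite_support: "\<forall>\<^sub>F n in F. finite (set_pmf (G n))"
  using graphs by eventually_elim (auto intro: finite_subset)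

lemma eventually_pos: "\<forall>\<^sub>F n in F. n > 0"
  using F_le eventually_gt_at_top[of 0] by (rule filter_leD)

text \<open>If the conditional mean of the proportion tends to the constant \<open>a\<close> in mean square, the proportion
  tends to \<open>a\<close> in probability.\<close>

lemma whp_of_second_moment:
  assumes loc: "\<And>n E i x y. i < n \<Longrightarrow> (\<And>v. v \<in> gball E R i \<Longrightarrow> x v = y v) \<Longrightarrow> x \<in> A E i \<longleftrightarrow> y \<in> A E i"
    and conc: "((\<lambda>n. measure_pmf.expectation (G n)
      (\<lambda>E. ((\<Sum>i<n. measure_pmf.prob (opinions {..<n}) (A E i)) / n - a)\<^sup>2)) \<longlongrightarrow> 0) F"
    and \<delta>: "\<delta> > 0"
  shows "whp F G (\<lambda>n E x. \<bar>real (card {i \<in> {..<n}. x \<in> A E i}) / n - a\<bar> < \<delta>)"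
proof -
  let ?Z = "\<lambda>n x E. real (card {i \<in> {..<n}. x \<in> A E i}) / n"
  let ?f = "\<lambda>n E. (\<Sum>i<n. measure_pmf.prob (opinions {..<n}) (A E i)) / n"
  obtain C :: real where C: "\<forall>\<^sub>F n in F. measure_pmf.expectation (G n) (ball_pairs n (2 * R)) \<le> C * n"
    using balls by blast
  let ?b = "\<lambda>n. (measure_pmf.expectation (G n) (\<lambda>E. (?f n E - a)\<^sup>2) + C / n) / \<delta>\<^sup>2"
  let ?p = "\<lambda>n. measure_pmf.prob (pair_pmf (G n) (initial_opinions n))"
  have low: "\<forall>\<^sub>F n in F. 1 - ?b n \<le> ?p n {(E, x). \<bar>?Z n x E - a\<bar> < \<delta>}"
    using graphs finite_support C eventually_pos
  proof eventually_elim
    case (elim n)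
    have int [simp]: "integrable (measure_pmf (G n)) f" for f :: "_ \<Rightarrow> real"
      by (rule integrable_measure_pmf_finite) (rule elim)
    have fin: "finite (set_pmf (pair_pmf (G n) (opinions {..<n})))"
      using elim by simp
    have "?p n {(E, x). \<not> \<bar>?Z n x E - a\<bar> < \<delta>}
        \<le> measure_pmf.expectation (pair_pmf (G n) (opinions {..<n})) (\<lambda>(E, x). (?Z n x E - a)\<^sup>2) / \<delta>\<^sup>2"
      unfolding initial_opinions_eq
    proof (rule markov_prob[OF fin])
      fix z assume "z \<in> {(E, x). \<not> \<bar>?Z n x E - a\<bar> < \<delta>}"
      then show "\<delta>\<^sup>2 \<le> (case z of (E, x) \<Rightarrow> (?Z n x E - a)\<^sup>2)"
        using \<delta> by (auto simp: not_less abs_le_square_iff[symmetric])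
    qed (use \<delta> in auto)
    also have "measure_pmf.expectation (pair_pmf (G n) (opinions {..<n})) (\<lambda>(E, x). (?Z n x E - a)\<^sup>2)
        = measure_pmf.expectation (G n) (\<lambda>E. measure_pmf.expectation (opinions {..<n}) (\<lambda>x. (?Z n x E - a)\<^sup>2))"
      using elim by (simp add: expectation_pair)
    also have "\<dots> \<le> measure_pmf.expectation (G n) (\<lambda>E. (?f n E - a)\<^sup>2 + ball_pairs n (2 * R) E / n\<^sup>2)"
    proof (rule integral_mono_AE)
      show "AE E in measure_pmf (G n). measure_pmf.expectation (opinions {..<n}) (\<lambda>x. (?Z n x E - a)\<^sup>2)
          \<le> (?f n E - a)\<^sup>2 + ball_pairs n (2 * R) E / n\<^sup>2"
        unfolding AE_measure_pmf_iff
      proof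
        fix E assume "E \<in> set_pmf (G n)"
        then have E: "E \<subseteq> all_edges n" using elim by auto
        show "measure_pmf.expectation (opinions {..<n}) (\<lambda>x. (?Z n x E - a)\<^sup>2)
          \<le> (?f n E - a)\<^sup>2 + ball_pairs n (2 * R) E / n\<^sup>2"
          by (rule second_moment_given_graph[OF E loc])
      qed
    qed simp_all
    also have "\<dots> = measure_pmf.expectation (G n) (\<lambda>E. (?f n E - a)\<^sup>2)
        + measure_pmf.expectation (G n) (ball_pairs n (2 * R)) / n\<^sup>2"
      by simp
    also have "measure_pmf.expectation (G n) (ball_pairs n (2 * R)) / n\<^sup>2 \<le> C * n / n\<^sup>2"
      by (rule divide_right_mono) (use elim in auto)
    also have "C * n / n\<^sup>2 = C / n" by (simp add: power2_eq_square)
    finally have "?p n {(E, x). \<not> \<bar>?Z n x E - a\<bar> < \<delta>} \<le> ?b n"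
      by (simp add: divide_right_mono)
    moreover have "?p n {(E, x). \<not> \<bar>?Z n x E - a\<bar> < \<delta>} = 1 - ?p n {(E, x). \<bar>?Z n x E - a\<bar> < \<delta>}"
    proof -
      have "{(E, x). \<not> \<bar>?Z n x E - a\<bar> < \<delta>} = - {(E, x). \<bar>?Z n x E - a\<bar> < \<delta>}" by auto
      then show ?thesis by (simp add: measure_pmf.prob_compl[of "{(E, x). \<bar>?Z n x E - a\<bar> < \<delta>}", simplified] Compl_eq_Diff_UNIV)
    qed
    ultimately show ?case by linarith
  qed
  have "(?b \<longlongrightarrow> (0 + 0) / \<delta>\<^sup>2) F"
    by (intro tendsto_intros conc tendsto_F[OF lim_const_over_n]) (use \<delta> in auto)
  then have "((\<lambda>n. 1 - ?b n) \<longlongrightarrow> 1) F"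
    by (auto intro: tendsto_eq_intros)
  then show ?thesis
    unfolding whp_def
    by (intro tendsto_sandwich[OF low _ _ tendsto_const]) auto
qed

lemma balanced:
  assumes "\<epsilon> > 0"
  shows "whp F G (almost_balanced \<epsilon> t)"
proof -
  have "whp F G (\<lambda>n E x. \<bar>real (card {i \<in> {..<n}. x \<in> {x. dyn (voters E) x t i = 1}}) / n - 1/2\<bar> < \<epsilon>)"
  proof (rule whp_of_second_moment[where R = t])
    show "((\<lambda>n. measure_pmf.expectation (G n) (\<lambda>E. ((\<Sum>i<n. measure_pmf.prob (opinions {..<n})
        {x. dyn (voters E) x t i = 1}) / n - 1/2)\<^sup>2)) \<longlongrightarrow> 0) F"
    proof (rule tendsto_eventually)
      show "\<forall>\<^sub>F n in F. measure_pmf.expectation (G n) (\<lambda>E. ((\<Sum>i<n. measure_pmf.prob (opinions {..<n})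
        {x. dyn (voters E) x t i = 1}) / n - 1/2)\<^sup>2) = 0"
        using graphs eventually_pos
      proof eventually_elim
        case (elim n)
        have "measure_pmf.expectation (G n) (\<lambda>E. ((\<Sum>i<n. measure_pmf.prob (opinions {..<n})
          {x. dyn (voters E) x t i = 1}) / n - 1/2)\<^sup>2) = measure_pmf.expectation (G n) (\<lambda>E. 0)"
        proof (rule integral_cong_AE)
          have "(\<Sum>i<n. measure_pmf.prob (opinions {..<n}) {x. dyn (voters E) x t i = 1}) / n = 1 / 2"
            if "E \<in> set_pmf (G n)" for E
          proof -
            have "E \<subseteq> all_edges n" using elim that by auto
            then have "(\<Sum>i<n. measure_pmf.prob (opinions {..<n}) {x. dyn (voters E) x t i = 1}) = (\<Sum>i<n. 1 / 2)"
              by (intro sum.cong prob_opinion_half) auto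
            then show ?thesis using elim by simp
          qed
          then show "AE E in measure_pmf (G n). ((\<Sum>i<n. measure_pmf.prob (opinions {..<n})
            {x. dyn (voters E) x t i = 1}) / n - 1/2)\<^sup>2 = 0"
            unfolding AE_measure_pmf_iff by (intro ballI) (simp only: diff_self power_zero_numeral)
        qed simp_all
        then show ?case by simp
      qed
    qed
  next
    fix n E i x y assume "\<And>v. v \<in> gball E t i \<Longrightarrow> x v = (y v :: int)"
    then have "dyn (voters E) x t i = dyn (voters E) y t i" by (rule dyn_local)
    then show "x \<in> {x. dyn (voters E) x t i = 1} \<longleftrightarrow> y \<in> {x. dyn (voters E) x t i = 1}" by simp
  qed (rule assms)
  then show ?thesis
  proof (rule whp_mono)
    fix n E x
    assume "\<bar>real (card {i \<in> {..<n}. x \<in> {x. dyn (voters E) x t i = 1}}) / n - 1/2\<bar> < \<epsilon>"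
    then show "almost_balanced \<epsilon> t n E x"
      unfolding almost_balanced_def majority_dynamics_eq_dyn mem_Collect_eq atLeastAtMost_iff by argo
  qed
qed

text \<open>Concentration of \<open>mean_flip\<close> at every fixed time yields the desired time. If \<open>F\<close> is the trivial filter
  the claim is vacuous; otherwise the bound on the total number of flips passes to the limits \<open>a t\<close>.\<close>

lemma exists_settling_time:
  assumes conc: "\<And>t. \<exists>a. ((\<lambda>n. measure_pmf.expectation (G n) (\<lambda>E. (mean_flip n t E - a)\<^sup>2)) \<longlongrightarrow> 0) F"
    and \<epsilon>: "\<epsilon> > 0"
  shows "\<exists>t. whp F G (almost_two_periodic \<epsilon> t) \<and> whp F G (almost_balanced \<epsilon> t)"
proof (cases "F = bot")
  case True
  then show ?thesis by (simp add: whp_def)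
next
  case False
  have "\<forall>t. \<exists>a. ((\<lambda>n. measure_pmf.expectation (G n) (\<lambda>E. (mean_flip n t E - a)\<^sup>2)) \<longlongrightarrow> 0) F"
    using conc by blast
  from choice[OF this] obtain a
    where a: "((\<lambda>n. measure_pmf.expectation (G n) (\<lambda>E. (mean_flip n t E - a t)\<^sup>2)) \<longlongrightarrow> 0) F" for t
    by blast
  have lim: "((\<lambda>n. measure_pmf.expectation (G n) (mean_flip n t)) \<longlongrightarrow> a t) F" for t
  proof -
    have "((\<lambda>n. (measure_pmf.expectation (G n) (mean_flip n t) - a t)\<^sup>2) \<longlongrightarrow> 0) F"
    proof (rule tendsto_sandwich[OF _ _ tendsto_const a[of t]])
      show "\<forall>\<^sub>F n in F. (measure_pmf.expectation (G n) (mean_flip n t) - a t)\<^sup>2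
          \<le> measure_pmf.expectation (G n) (\<lambda>E. (mean_flip n t E - a t)\<^sup>2)"
        by (rule eventually_mono[OF finite_support square_expectation_le])
    qed simp
    then have "((\<lambda>n. sqrt ((measure_pmf.expectation (G n) (mean_flip n t) - a t)\<^sup>2)) \<longlongrightarrow> sqrt 0) F"
      by (rule tendsto_real_sqrt)
    then have "((\<lambda>n. measure_pmf.expectation (G n) (mean_flip n t) - a t) \<longlongrightarrow> 0) F"
      by (simp add: tendsto_rabs_zero_iff)
    then show ?thesis by (simp add: LIM_zero_iff)
  qed
  obtain C :: real where C: "\<forall>\<^sub>F n in F. measure_pmf.expectation (G n) (ball_pairs n 1) \<le> C * n"
    using balls by blast
  have bound: "(\<Sum>t<T. a t) \<le> C" for T
  proof (rule tendsto_upperbound[OF _ _ False])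
    show "((\<lambda>n. \<Sum>t<T. measure_pmf.expectation (G n) (mean_flip n t)) \<longlongrightarrow> (\<Sum>t<T. a t)) F"
      by (intro tendsto_sum lim)
    show "\<forall>\<^sub>F n in F. (\<Sum>t<T. measure_pmf.expectation (G n) (mean_flip n t)) \<le> C"
      using C graphs finite_support eventually_pos
    proof eventually_elim
      case (elim n)
      have int [simp]: "integrable (measure_pmf (G n)) f" for f :: "_ \<Rightarrow> real"
        by (rule integrable_measure_pmf_finite) (rule elim)
      have "(\<Sum>t<T. measure_pmf.expectation (G n) (mean_flip n t))
          = measure_pmf.expectation (G n) (\<lambda>E. \<Sum>t<T. mean_flip n t E)"
        by simp
      also have "\<dots> \<le> measure_pmf.expectation (G n) (\<lambda>E. ball_pairs n 1 E / n)"
      proof (rule integral_mono_AE)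
        show "AE E in measure_pmf (G n). (\<Sum>t<T. mean_flip n t E) \<le> ball_pairs n 1 E / n"
          unfolding AE_measure_pmf_iff using elim(2) sum_mean_flip_le by blast
      qed simp_all
      also have "\<dots> \<le> C"
        using elim by (simp add: divide_le_eq)
      finally show ?case .
    qed
  qed
  \<comment> \<open>The sum of \<open>a t\<close> over \<open>t < T\<close> is at most \<open>C\<close>, so some term is at most \<open>C / T < \<epsilon> / 2\<close>.\<close>
  obtain T :: nat where T: "real T > C / (\<epsilon> / 2)" using reals_Archimedean2 by blast
  have "\<exists>t<T. a t \<le> \<epsilon> / 2"
  proof (rule ccontr)
    assume "\<not> ?thesis"
    then have "(\<Sum>t<T. \<epsilon> / 2) \<le> (\<Sum>t<T. a t)" by (intro sum_mono) (auto simp: not_le less_imp_le)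
    then show False using bound[of T] T \<epsilon> by (simp add: field_simps)
  qed
  then obtain t where t: "a t \<le> \<epsilon> / 2" by blast
  have "whp F G (\<lambda>n E x. \<bar>real (card {i \<in> {..<n}. x \<in> flips (voters E) t i}) / n - a t\<bar> < \<epsilon> / 2)"
  proof (rule whp_of_second_moment[where R = "t + 2"])
    show "((\<lambda>n. measure_pmf.expectation (G n) (\<lambda>E. ((\<Sum>i<n. measure_pmf.prob (opinions {..<n})
        (flips (voters E) t i)) / n - a t)\<^sup>2)) \<longlongrightarrow> 0) F"
      using a[of t] unfolding mean_flip_def flip_prob_def .
  next
    fix n E i x y assume "\<And>v. v \<in> gball E (t + 2) i \<Longrightarrow> x v = (y v :: int)"
    then show "x \<in> flips (voters E) t i \<longleftrightarrow> y \<in> flips (voters E) t i" by (rule flips_local)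
  qed (use \<epsilon> in simp)
  then have "whp F G (almost_two_periodic \<epsilon> t)"
  proof (rule whp_mono)
    fix n E x assume *: "\<bar>real (card {i \<in> {..<n}. x \<in> flips (voters E) t i}) / n - a t\<bar> < \<epsilon> / 2"
    have "real (card {i \<in> {..<n}. x \<in> flips (voters E) t i}) \<le> \<epsilon> * n"
    proof (cases "n = 0")
      case False
      moreover have "real (card {i \<in> {..<n}. x \<in> flips (voters E) t i}) / n \<le> \<epsilon>"
        using * t by argo
      ultimately show ?thesis by (simp add: divide_le_eq)
    qed simp
    then show "almost_two_periodic \<epsilon> t n E x"
      unfolding almost_two_periodic_def majority_dynamics_eq_dyn by (simp add: flips_def del: dyn.simps)
  qed
  then show ?thesis using balanced[OF \<epsilon>] by blast
qed

end

section \<open>The universal cover of a regular graph\<close>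

text \<open>The vertices of the \<open>d\<close>-regular tree are encoded as words: the empty word is the root, and the
  children of \<open>w\<close> are the words \<open>k # w\<close>, so that the parent of a word is its tail. The root has \<open>d\<close>
  children and every other vertex has \<open>d - 1\<close>. The parent is given as a set with at most one element.\<close>

definition parent :: "nat list \<Rightarrow> nat list set" where
  "parent w = (case w of [] \<Rightarrow> {} | _ # w' \<Rightarrow> {w'})"

lemma parent_simps [simp]: "parent [] = {}" "parent (k # w) = {w}"
  by (simp_all add: parent_def)

text \<open>The words that are vertices of the \<open>d\<close>-regular tree.\<close>

fun tree_word :: "nat \<Rightarrow> nat list \<Rightarrow> bool" where
  "tree_word d [] \<longleftrightarrow> True"
| "tree_word d (k # w) \<longleftrightarrow> k < d - card (parent w) \<and> tree_word d w"

definition tree_nbrs :: "nat \<Rightarrow> nat list \<Rightarrow> nat list set" where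
  "tree_nbrs d w = (\<lambda>k. k # w) ` {..<d - card (parent w)} \<union> parent w"

text \<open>The vertices whose opinions are summed at \<open>w\<close>, including \<open>w\<close> itself if the degree \<open>d\<close> is even.\<close>

definition tree_voters :: "nat \<Rightarrow> nat list \<Rightarrow> nat list set" where
  "tree_voters d w = (if even d then insert w (tree_nbrs d w) else tree_nbrs d w)"

text \<open>The ball of radius \<open>r\<close> around the root.\<close>

definition tree_ball :: "nat \<Rightarrow> nat \<Rightarrow> nat list set" where
  "tree_ball d r = {w. tree_word d w \<and> length w \<le> r}"

lemma finite_tree_ball: "finite (tree_ball d r)"
proof (rule finite_subset)
  have "set w \<subseteq> {..<d}" if "tree_word d w" for w
    using that by (induction w) auto
  then show "tree_ball d r \<subseteq> {w. set w \<subseteq> {..<d} \<and> length w \<le> r}"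
    by (auto simp: tree_ball_def)
qed (rule finite_lists_length_le, simp)

lemma tree_voters_subset:
  assumes "w \<in> tree_ball d r"
  shows "tree_voters d w \<subseteq> tree_ball d (Suc r)"
  using assms by (cases w) (auto simp: tree_voters_def tree_nbrs_def tree_ball_def split: if_splits)

text \<open>For a regular graph, the universal covering map that sends the root to \<open>i\<close>: the child \<open>k # w\<close> of \<open>w\<close> is sent to the \<open>k\<close>-th
  neighbour of the image of \<open>w\<close> in a fixed enumeration that omits the image of the parent of \<open>w\<close>. Thus words are mapped to
  the end points of non-backtracking walks from \<open>i\<close>.\<close>

fun cover :: "nat set set \<Rightarrow> nat \<Rightarrow> nat list \<Rightarrow> nat" where
  "cover E i [] = i"
| "cover E i [k] = from_nat_into (nbrs E i) k"
| "cover E i (k # l # w) = from_nat_into (nbrs E (cover E i (l # w)) - {cover E i w}) k"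

lemma cover_Cons: "cover E i (k # w) = from_nat_into (nbrs E (cover E i w) - cover E i ` parent w) k"
  by (cases w) simp_all

text \<open>The flip probability of the root of the \<open>d\<close>-regular tree. The opinions within distance \<open>t + 2\<close>
  determine whether the root flips.\<close>

definition tree_flip :: "nat \<Rightarrow> nat \<Rightarrow> real" where
  "tree_flip d t = flip_prob (tree_ball d (t + 2)) (tree_voters d) t []"

text \<open>The oriented edges \<open>uv\<close> that lie on a cycle of length at most \<open>L + 1\<close>: the vertex \<open>v\<close> can be reached
  from \<open>u\<close> in at most \<open>L\<close> steps without using the edge.\<close>

definition short_cycle_edges :: "nat set set \<Rightarrow> nat \<Rightarrow> (nat \<times> nat) set" where
  "short_cycle_edges E L = {(u, v). {u, v} \<in> E \<and> v \<in> gball (E - {{u, v}}) L u}"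

locale regular_graph =
  fixes n d :: nat and E :: "nat set set"
  assumes edges: "E \<subseteq> all_edges n" and regular: "\<And>i. i < n \<Longrightarrow> vertex_degree E i = d"
begin

text \<open>The covering map is a local isomorphism: it maps the children of \<open>w\<close> bijectively onto the
  neighbours of the image of \<open>w\<close> other than the image of the parent.\<close>

lemma cover_children_aux:
  assumes "i < n" "tree_word d w"
  shows "cover E i w < n \<and> cover E i ` parent w \<subseteq> nbrs E (cover E i w)"
    and "bij_betw (\<lambda>k. cover E i (k # w)) {..<d - card (parent w)}
      (nbrs E (cover E i w) - cover E i ` parent w)"
proof -
  have bij: "bij_betw (\<lambda>k. cover E i (k # w)) {..<d - card (parent w)}
      (nbrs E (cover E i w) - cover E i ` parent w)"
    if "cover E i w < n" "cover E i ` parent w \<subseteq> nbrs E (cover E i w)" for w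
  proof -
    let ?C = "nbrs E (cover E i w) - cover E i ` parent w"
    have "card (cover E i ` parent w) = card (parent w)"
      by (cases w) simp_all
    moreover have "card (nbrs E (cover E i w)) = d"
      using regular[OF that(1)] by (simp add: vertex_degree_def)
    ultimately have "card ?C = d - card (parent w)"
      using card_Diff_subset[OF finite_subset[OF that(2) finite_nbrs[OF edges]] that(2)] by simp
    moreover have "finite ?C" by (simp add: finite_nbrs[OF edges])
    ultimately show ?thesis
      using bij_betw_from_nat_into_finite[of ?C] by (simp add: cover_Cons)
  qed
  show *: "cover E i w < n \<and> cover E i ` parent w \<subseteq> nbrs E (cover E i w)"
    using assms(2)
  proof (induction w)
    case Nil
    then show ?case using assms(1) by simp
  next
    case (Cons k w)
    then have IH: "cover E i w < n" "cover E i ` parent w \<subseteq> nbrs E (cover E i w)" "k < d - card (parent w)"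
      by simp_all
    have "cover E i (k # w) \<in> nbrs E (cover E i w) - cover E i ` parent w"
      using bij_betw_apply[OF bij[OF IH(1,2)]] IH(3) by simp
    then have "cover E i (k # w) \<in> nbrs E (cover E i w)" by blast
    then have "cover E i (k # w) < n" "cover E i w \<in> nbrs E (cover E i (k # w))"
      using nbrs_subset[OF edges] nbrs_sym by blast+
    then show ?case by (simp del: cover.simps)
  qed
  show "bij_betw (\<lambda>k. cover E i (k # w)) {..<d - card (parent w)}
      (nbrs E (cover E i w) - cover E i ` parent w)"
    using bij * by blast
qed

lemma cover_child:
  assumes "i < n" "tree_word d (k # w)"
  shows "{cover E i w, cover E i (k # w)} \<in> E" "cover E i (k # w) \<notin> cover E i ` parent w"
    "cover E i (k # w) \<noteq> cover E i w"
proof -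
  have "cover E i (k # w) \<in> nbrs E (cover E i w) - cover E i ` parent w"
    using bij_betw_apply[OF cover_children_aux(2)[OF assms(1), of w]] assms(2) by simp
  then show "{cover E i w, cover E i (k # w)} \<in> E" "cover E i (k # w) \<notin> cover E i ` parent w"
    by (simp_all del: cover.simps)
  then show "cover E i (k # w) \<noteq> cover E i w" using edge_iff[OF edges] by metis
qed

lemma cover_child_inj:
  assumes "i < n" "tree_word d (k # w)" "tree_word d (l # w)" "cover E i (k # w) = cover E i (l # w)"
  shows "k = l"
  using bij_betw_imp_inj_on[OF cover_children_aux(2)[OF assms(1), of w]] assms
  by (simp add: inj_on_def del: cover.simps)

lemma cover_voters:
  assumes "i < n" "tree_word d w"
  shows "voters E (cover E i w) = cover E i ` tree_voters d w"
proof -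
  have "cover E i ` tree_nbrs d w = nbrs E (cover E i w)"
    using bij_betw_imp_surj_on[OF cover_children_aux(2)[OF assms]] cover_children_aux(1)[OF assms]
    by (auto simp: tree_nbrs_def image_Un image_image)
  then show ?thesis
    using regular cover_children_aux(1)[OF assms] by (simp add: voters_def tree_voters_def)
qed

lemma cover_in_gball:
  assumes "i < n" "tree_word d w"
  shows "cover E i w \<in> gball E (length w) i"
  using assms(2)
proof (induction w)
  case (Cons k w)
  then have "cover E i w \<in> gball E (length w) i" by simp
  moreover have "cover E i (k # w) \<in> nbrs E (cover E i w)"
    using cover_child(1)[OF assms(1) Cons.prems] by simp
  ultimately show ?case using nbrs_gball by fastforce
qed simp

text \<open>If no edge near \<open>i\<close> lies on a short cycle, the covering map is injective near the root. By induction
  on the radius, consider two words \<open>w = k # p\<close> and \<open>w'\<close> with the same image, where \<open>w\<close> has maximal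
  length. The walks to the images of \<open>p\<close> and of \<open>w'\<close> avoid the edge \<open>e\<close> between the images of \<open>p\<close> and \<open>w\<close>, by the
  injectivity already known, and together they join the two ends of \<open>e\<close>.\<close>

lemma cover_inj:
  assumes i: "i < n"
    and good: "\<And>u v. (u, v) \<in> short_cycle_edges E (2 * r + 1) \<Longrightarrow> u \<notin> gball E r i"
  shows "inj_on (cover E i) (tree_ball d (Suc r))"
proof -
  have "inj_on (cover E i) (tree_ball d l)" if "l \<le> Suc r" for l
    using that
  proof (induction l)
    case 0
    then show ?case by (auto simp: tree_ball_def inj_on_def)
  next
    case (Suc l)
    then have inj: "v = v'" if "cover E i v = cover E i v'" "tree_word d v" "tree_word d v'" "length v \<le> l" "length v' \<le> l"
      for v v' using that by (auto simp: tree_ball_def inj_on_def)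
    have new: "w = w'" if w: "tree_word d w" "tree_word d w'" "length w = Suc l" "length w' \<le> Suc l"
      and eq: "cover E i w = cover E i w'" for w w'
    proof (rule ccontr)
      assume "w \<noteq> w'"
      obtain k p where kp: "w = k # p" "length p = l" using w(3) by (cases w) auto
      define e where "e = {cover E i p, cover E i w}"
      have A: "cover E i v \<in> gball (E - {e}) (length v) i" if "tree_word d v" "length v \<le> l" for v
        using that
      proof (induction v)
        case (Cons j v)
        have wv: "tree_word d v" "length v \<le> l" and IH: "cover E i v \<in> gball (E - {e}) (length v) i"
          using Cons by auto
        have "{cover E i v, cover E i (j # v)} \<noteq> e"
        proof
          assume "{cover E i v, cover E i (j # v)} = e"
          then consider "cover E i v = cover E i p" "cover E i (j # v) = cover E i w"
            | "cover E i v = cover E i w" "cover E i (j # v) = cover E i p"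
            unfolding e_def doubleton_eq_iff by blast
          then show False
          proof cases
            case 1
            then have "v = p" using inj[of v p] w kp wv by simp
            then show False using Cons.prems kp by simp
          next
            case 2
            then have "j # v = p" using inj[of "j # v" p] w kp Cons.prems by simp
            then have "cover E i w \<notin> cover E i ` {v}"
              using cover_child(2)[OF i w(1)[unfolded kp]] kp by (metis parent_simps(2))
            then show False using 2(1) by simp
          qed
        qed
        then have "cover E i (j # v) \<in> nbrs (E - {e}) (cover E i v)"
          using cover_child(1)[OF i Cons.prems(1)] by simp
        then have "cover E i (j # v) \<in> gball (E - {e}) (Suc (length v)) i"
          using nbrs_gball[OF IH] by blast
        then show ?case by (simp only: list.size add_Suc_right add_0_right)
      qed simp
      have B: "cover E i w' \<in> gball (E - {e}) (Suc l) i"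
      proof (cases "length w' \<le> l")
        case True
        then show ?thesis using A[OF w(2)] gball_mono[OF le_SucI] by blast
      next
        case False
        then obtain k' p' where kp': "w' = k' # p'" "length p' = l" using w(4) by (cases w') auto
        have "{cover E i p', cover E i w'} \<noteq> e"
        proof
          assume "{cover E i p', cover E i w'} = e"
          then have "cover E i p' = cover E i p"
            using eq cover_child(3)[OF i w(1)[unfolded kp]] kp(1) unfolding e_def doubleton_eq_iff by metis
          then have "p' = p" using inj[of p' p] w kp kp' by simp
          then show False using cover_child_inj[of i k p k'] i w kp kp' eq \<open>w \<noteq> w'\<close> by auto
        qed
        then have "cover E i w' \<in> nbrs (E - {e}) (cover E i p')"
          using cover_child(1)[OF i w(2)[unfolded kp']] kp'(1) by simp
        moreover have "cover E i p' \<in> gball (E - {e}) l i" using A[of p'] w(2) kp' by simp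
        ultimately show ?thesis using nbrs_gball by blast
      qed
      have p: "cover E i p \<in> gball (E - {e}) l i" using A[of p] w(1) kp by simp
      have "cover E i w \<in> gball (E - {e}) (l + Suc l) (cover E i p)"
        using gball_trans[OF gball_sym[OF p] B] eq by simp
      then have "cover E i w \<in> gball (E - {e}) (2 * r + 1) (cover E i p)"
        by (rule subsetD[OF gball_mono, rotated]) (use Suc.prems in simp)
      moreover have "{cover E i p, cover E i w} \<in> E"
        using cover_child(1)[OF i w(1)[unfolded kp(1)]] kp(1) by simp
      ultimately have "(cover E i p, cover E i w) \<in> short_cycle_edges E (2 * r + 1)"
        unfolding short_cycle_edges_def e_def by blast
      moreover have "cover E i p \<in> gball E r i"
        using cover_in_gball[of i p] i w(1) kp gball_mono[of l r E i] Suc.prems by auto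
      ultimately show False using good by blast
    qed
    show ?case
    proof (rule inj_onI)
      fix w w' assume *: "w \<in> tree_ball d (Suc l)" "w' \<in> tree_ball d (Suc l)" "cover E i w = cover E i w'"
      then have **: "tree_word d w" "tree_word d w'" "length w \<le> Suc l" "length w' \<le> Suc l"
        by (auto simp: tree_ball_def)
      consider "length w = Suc l" | "length w' = Suc l" | "length w \<le> l" "length w' \<le> l"
        using ** by linarith
      then show "w = w'"
      proof cases
        case 1 then show ?thesis using new[of w w'] * ** by blast
      next
        case 2 then show ?thesis using new[of w' w] *(3) ** by metis
      next
        case 3 then show ?thesis using inj[of w w'] * ** by blast
      qed
    qed
  qed
  then show ?thesis by simp
qed

lemma flip_prob_good:
  assumes i: "i < n"
    and good: "\<And>u v. (u, v) \<in> short_cycle_edges E (2 * t + 3) \<Longrightarrow> u \<notin> gball E (t + 1) i"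
  shows "flip_prob {..<n} (voters E) t i = tree_flip d t"
proof -
  let ?A = "\<lambda>s. tree_ball d (t + 2 - s)"
  have "flip_prob {..<n} (voters E) t (cover E i []) = flip_prob (?A 0) (tree_voters d) t []"
  proof (rule flip_prob_covering)
    have "inj_on (cover E i) (tree_ball d (Suc (t + 1)))"
      by (rule cover_inj[OF i]) (use good in \<open>simp add: numeral_eq_Suc\<close>)
    then show "inj_on (cover E i) (?A 0)" by simp
    show "cover E i ` ?A 0 \<subseteq> {..<n}"
      using cover_children_aux(1)[OF i] by (auto simp: tree_ball_def)
    fix s w
    show "?A (Suc s) \<subseteq> ?A s" by (auto simp: tree_ball_def)
    assume s: "s < t + 2" "w \<in> ?A (Suc s)"
    then have "t + 2 - s = Suc (t + 2 - Suc s)" by simp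
    then have "tree_voters d w \<subseteq> ?A s" using tree_voters_subset[OF s(2)] by metis
    moreover have "tree_word d w" using s(2) by (simp add: tree_ball_def)
    ultimately show "tree_voters d w \<subseteq> ?A s \<and> voters E (cover E i w) = cover E i ` tree_voters d w"
      using cover_voters[OF i] by blast
  qed (auto simp: tree_ball_def finite_tree_ball[unfolded tree_ball_def])
  then show ?thesis by (simp add: tree_flip_def)
qed

lemma card_gball: "i < n \<Longrightarrow> card (gball E r i) \<le> (d + 1) ^ r"
proof (induction r)
  case (Suc r)
  have "card (gball E (Suc r) i) \<le> card (gball E r i) + card (\<Union>v\<in>gball E r i. nbrs E v)"
    by (simp add: card_Un_le)
  also have "card (\<Union>v\<in>gball E r i. nbrs E v) \<le> (\<Sum>v\<in>gball E r i. card (nbrs E v))"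
    by (rule card_UN_le[OF finite_gball[OF edges]])
  also have "\<dots> = (\<Sum>v\<in>gball E r i. d)"
    by (rule sum.cong) (use regular gball_subset[OF edges Suc.prems] in \<open>auto simp: vertex_degree_def\<close>)
  also have "card (gball E r i) + \<dots> = (d + 1) * card (gball E r i)" by simp
  also have "\<dots> \<le> (d + 1) ^ Suc r" using mult_le_mono2[OF Suc.IH[OF Suc.prems], of "d + 1"] by simp
  finally show ?case by simp
qed simp

lemma finite_short_cycle_edges: "finite (short_cycle_edges E L)"
  by (rule finite_subset[of _ "{..<n} \<times> {..<n}"]) (use edge_iff[OF edges] in \<open>auto simp: short_cycle_edges_def\<close>)

text \<open>Only vertices near an edge on a short cycle have a flip probability other than \<open>tree_flip d t\<close>. As
  both quantities lie between 0 and 1, the square of their difference is at most its absolute value.\<close>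

lemma mean_flip_near_tree_flip:
  assumes "n > 0"
  shows "(mean_flip n t E - tree_flip d t)\<^sup>2 \<le> real ((d + 1) ^ (t + 1)) * card (short_cycle_edges E (2 * t + 3)) / n"
proof -
  let ?S = "short_cycle_edges E (2 * t + 3)"
  let ?\<phi> = "\<lambda>i. flip_prob {..<n} (voters E) t i"
  \<comment> \<open>The vertices near an edge on a short cycle.\<close>
  define B where "B = (\<Union>(u, v)\<in>?S. gball E (t + 1) u)"
  have S_less: "u < n" if "(u, v) \<in> ?S" for u v
    using that edge_iff[OF edges] by (auto simp: short_cycle_edges_def)
  have "card B \<le> (\<Sum>e\<in>?S. card (gball E (t + 1) (fst e)))"
    unfolding B_def split_def by (rule card_UN_le[OF finite_short_cycle_edges])
  also have "\<dots> \<le> (\<Sum>e\<in>?S. (d + 1) ^ (t + 1))"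
    by (intro sum_mono card_gball) (use S_less in auto)
  finally have cB: "real (card B) \<le> real ((d + 1) ^ (t + 1)) * card ?S"
    unfolding of_nat_mult[symmetric] of_nat_le_iff by (simp add: mult.commute)
  have finB: "finite B"
    unfolding B_def by (intro finite_UN_I finite_short_cycle_edges) (auto simp: finite_gball[OF edges] simp del: gball.simps)
  have good: "?\<phi> i = tree_flip d t" if "i < n" "i \<notin> B" for i
    by (rule flip_prob_good[OF that(1)]) (use that(2) gball_sym in \<open>fastforce simp: B_def simp del: gball.simps\<close>)
  have tree: "0 \<le> tree_flip d t" "tree_flip d t \<le> 1" by (simp_all add: tree_flip_def flip_prob_bounds)
  have dev: "\<bar>?\<phi> i - tree_flip d t\<bar> \<le> indicator B i" if "i < n" for i
    using good[OF that] tree flip_prob_bounds[of "{..<n}" "voters E" t i]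
    by (cases "i \<in> B") (auto simp: abs_le_iff)
  have "mean_flip n t E - tree_flip d t = (\<Sum>i<n. ?\<phi> i - tree_flip d t) / n"
    using assms by (simp add: mean_flip_def sum_subtractf diff_divide_distrib)
  then have "\<bar>mean_flip n t E - tree_flip d t\<bar> = \<bar>\<Sum>i<n. ?\<phi> i - tree_flip d t\<bar> / n" by simp
  also have "\<dots> \<le> (\<Sum>i<n. indicator B i) / n"
    by (intro divide_right_mono order_trans[OF sum_abs] sum_mono dev) auto
  also have "(\<Sum>i<n. indicator B i :: real) \<le> card B"
    using finB by (simp add: indicator_def sum.If_cases card_mono)
  finally have 1: "\<bar>mean_flip n t E - tree_flip d t\<bar> \<le> card B / n" by (simp add: divide_right_mono)
  have "\<bar>mean_flip n t E - tree_flip d t\<bar> \<le> 1"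
    using tree mean_flip_bounds[of n t E] by (auto simp: abs_le_iff)
  then have "\<bar>mean_flip n t E - tree_flip d t\<bar>\<^sup>2 \<le> \<bar>mean_flip n t E - tree_flip d t\<bar>"
    by (simp add: power2_eq_square mult_left_le_one_le del: abs_mult_self_eq)
  then have "(mean_flip n t E - tree_flip d t)\<^sup>2 \<le> card B / n" using 1 by simp
  also have "\<dots> \<le> real ((d + 1) ^ (t + 1)) * card ?S / n" by (rule divide_right_mono[OF cB]) simp
  finally show ?thesis .
qed

end

section \<open>Short cycles in random regular graphs\<close>

text \<open>The switching that replaces the edges \<open>uv\<close> and \<open>ab\<close> by \<open>ua\<close> and \<open>vb\<close>.\<close>

definition switch :: "nat set set \<Rightarrow> nat \<Rightarrow> nat \<Rightarrow> nat \<Rightarrow> nat \<Rightarrow> nat set set" where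
  "switch E u v a b = E - {{u, v}, {a, b}} \<union> {{u, a}, {v, b}}"

lemma card_replace:
  assumes "finite A" "x \<in> A" "y \<notin> A"
  shows "card (insert y (A - {x})) = card A"
  using assms by (simp add: card_Suc_Diff1 del: card_Diff_singleton card_Diff_insert)

text \<open>The relation of being in the same connected component.\<close>

definition reach :: "nat set set \<Rightarrow> (nat \<times> nat) set" where
  "reach E = {(u, v). {u, v} \<in> E}\<^sup>*"

lemma reach_refl [simp]: "(x, x) \<in> reach E"
  by (simp add: reach_def)

lemma reach_trans: "(x, y) \<in> reach E \<Longrightarrow> (y, z) \<in> reach E \<Longrightarrow> (x, z) \<in> reach E"
  unfolding reach_def by (rule rtrancl_trans)

lemma reach_sym: "(x, y) \<in> reach E \<Longrightarrow> (y, x) \<in> reach E"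
proof -
  have "sym ({(u, v). {u, v} \<in> E}\<^sup>*)"
    by (rule sym_rtrancl) (auto simp: sym_def insert_commute)
  then show "(x, y) \<in> reach E \<Longrightarrow> (y, x) \<in> reach E" unfolding reach_def by (rule symD)
qed

lemma reach_edge: "{x, y} \<in> E \<Longrightarrow> (x, y) \<in> reach E"
  unfolding reach_def by auto

lemma reach_mono:
  assumes "E \<subseteq> E'" "(x, y) \<in> reach E"
  shows "(x, y) \<in> reach E'"
  using assms(2) rtrancl_mono[of "{(u, v). {u, v} \<in> E}" "{(u, v). {u, v} \<in> E'}"] assms(1)
  unfolding reach_def by blast

lemma reach_replace:
  assumes "\<And>u v. {u, v} \<in> E \<Longrightarrow> (u, v) \<in> reach E'" "(x, y) \<in> reach E"
  shows "(x, y) \<in> reach E'"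
  using assms(2) unfolding reach_def[of E]
proof (induction rule: rtrancl_induct)
  case (step y z)
  then show ?case using assms(1)[of y z] reach_trans by blast
qed simp

lemma gball_reach: "j \<in> gball E r i \<Longrightarrow> (i, j) \<in> reach E"
proof (induction r arbitrary: j)
  case (Suc r)
  then consider "j \<in> gball E r i" | v where "v \<in> gball E r i" "{v, j} \<in> E" by auto
  then show ?case
  proof cases
    case 2
    then show ?thesis using Suc.IH reach_edge reach_trans by blast
  qed (rule Suc.IH)
qed simp

lemma connected_graph_reach: "connected_graph n E \<longleftrightarrow> (\<forall>i<n. \<forall>j<n. (i, j) \<in> reach E)"
  by (simp add: connected_graph_def reach_def)

text \<open>After removing the edge \<open>ab\<close>, every vertex of the component of \<open>a\<close> is still connected to \<open>a\<close> or to \<open>b\<close>.\<close>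

lemma reach_remove_edge:
  assumes "(x, a) \<in> reach E"
  shows "(x, a) \<in> reach (E - {{a, b}}) \<or> (x, b) \<in> reach (E - {{a, b}})"
  using assms unfolding reach_def[of E]
proof (induction rule: converse_rtrancl_induct)
  case (step x y)
  show ?case
  proof (cases "{x, y} = {a, b}")
    case True
    then have "x = a \<or> x = b" by (auto simp: doubleton_eq_iff)
    then show ?thesis by auto
  next
    case False
    then have "(x, y) \<in> reach (E - {{a, b}})" using step(1) by (intro reach_edge) auto
    then show ?thesis using step(3) reach_trans by blast
  qed
qed simp

text \<open>If \<open>uv\<close> is not a bridge, removing \<open>uv\<close> and \<open>ab\<close> leaves every vertex connected to \<open>a\<close> or to \<open>b\<close>. If
  \<open>u\<close> is still connected to \<open>a\<close>, the new edge \<open>ub\<close> joins \<open>a\<close> to \<open>b\<close>, and otherwise the new edge \<open>ua\<close> does.\<close>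

lemma switch_connected:
  assumes conn: "connected_graph n E"
    and cyc: "(u, v) \<in> reach (E - {{u, v}})" and lt: "u < n" "a < n" "b < n"
  shows "connected_graph n (switch E u v a b) \<or> connected_graph n (switch E u v b a)"
proof -
  define E1 where "E1 = E - {{u, v}}"
  define H where "H = E1 - {{a, b}}"
  have "(x, y) \<in> reach E1" if "(x, y) \<in> reach E" for x y
  proof (rule reach_replace[OF _ that])
    fix p q assume pq: "{p, q} \<in> E"
    show "(p, q) \<in> reach E1"
    proof (cases "{p, q} = {u, v}")
      case True
      then consider "p = u" "q = v" | "p = v" "q = u" unfolding doubleton_eq_iff by blast
      then show ?thesis using cyc reach_sym[OF cyc] unfolding E1_def by cases simp_all
    next
      case False
      then show ?thesis using pq unfolding E1_def by (intro reach_edge) simp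
    qed
  qed
  then have two: "(x, a) \<in> reach H \<or> (x, b) \<in> reach H" if "x < n" for x
    using conn that lt reach_remove_edge[of x a E1 b] unfolding connected_graph_reach H_def by blast
  have join: "connected_graph n E'" if "H \<subseteq> E'" "(a, b) \<in> reach E'" for E'
  proof -
    have *: "(x, a) \<in> reach E'" if "x < n" for x
      using two[OF that]
    proof
      assume "(x, b) \<in> reach H"
      then have "(x, b) \<in> reach E'" by (rule reach_mono[OF \<open>H \<subseteq> E'\<close>])
      then show ?thesis by (rule reach_trans[OF _ reach_sym[OF \<open>(a, b) \<in> reach E'\<close>]])
    qed (rule reach_mono[OF \<open>H \<subseteq> E'\<close>])
    show ?thesis
      unfolding connected_graph_reach
    proof (intro allI impI)
      fix i j assume "i < n" "j < n"
      then show "(i, j) \<in> reach E'" by (intro reach_trans[OF * reach_sym[OF *]])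
    qed
  qed
  from two[OF lt(1)] show ?thesis
  proof
    assume ua: "(u, a) \<in> reach H"
    have sub: "H \<subseteq> switch E u v b a"
      unfolding H_def E1_def switch_def insert_commute[of b a "{}"] by blast
    have "(u, b) \<in> reach (switch E u v b a)" by (rule reach_edge) (simp add: switch_def)
    then have "(a, b) \<in> reach (switch E u v b a)"
      by (rule reach_trans[OF reach_sym[OF reach_mono[OF sub ua]]])
    then show ?thesis using join[OF sub] by blast
  next
    assume ub: "(u, b) \<in> reach H"
    have sub: "H \<subseteq> switch E u v a b" unfolding H_def E1_def switch_def by blast
    have "(a, u) \<in> reach (switch E u v a b)" by (rule reach_sym, rule reach_edge) (simp add: switch_def)
    then have "(a, b) \<in> reach (switch E u v a b)"
      by (rule reach_trans[OF _ reach_mono[OF sub ub]])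
    then show ?thesis using join[OF sub] by blast
  qed
qed

text \<open>An edge \<open>ab\<close> with both ends at distance more than 2 from \<open>u\<close> has no end in common with \<open>uv\<close> and is not
  joined to it by an edge, so the switching neither creates loops nor multiple edges.\<close>

lemma far_edge:
  assumes E: "E \<subseteq> all_edges n" and e: "{u, v} \<in> E" "{a, b} \<in> E"
    and far: "a \<notin> gball E (Suc (Suc L)) u" "b \<notin> gball E (Suc (Suc L)) u"
  shows "u < n" "v < n" "a < n" "b < n" "distinct [u, v, a, b]"
    "{u, a} \<notin> E" "{u, b} \<notin> E" "{v, a} \<notin> E" "{v, b} \<notin> E"
proof -
  show lt: "u < n" "v < n" "a < n" "b < n" using edge_iff[OF E] e by blast+
  have 0: "u \<in> gball E (Suc L) u" by simp
  have 1: "v \<in> gball E (Suc L) u" using nbrs_gball[of u E L u] e by (auto simp del: gball.simps)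
  note sub = nbrs_gball[OF 0] nbrs_gball[OF 1]
  show "{u, a} \<notin> E" "{u, b} \<notin> E" "{v, a} \<notin> E" "{v, b} \<notin> E"
    using sub far mem_nbrs by blast+
  have "u \<noteq> v" "a \<noteq> b" using edge_iff[OF E] e by blast+
  moreover have "u \<noteq> a" "u \<noteq> b" "v \<noteq> a" "v \<noteq> b"
    using far 0 1 gball_Suc_mono[of E "Suc L" u] by blast+
  ultimately show "distinct [u, v, a, b]" by simp
qed

lemma switch_regular:
  assumes E: "E \<subseteq> all_edges n" and e: "{u, v} \<in> E" "{a, b} \<in> E"
    and far: "a \<notin> gball E (Suc (Suc L)) u" "b \<notin> gball E (Suc (Suc L)) u"
  shows "switch E u v a b \<subseteq> all_edges n" "vertex_degree (switch E u v a b) w = vertex_degree E w"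
proof -
  note f = far_edge[OF assms]
  show "switch E u v a b \<subseteq> all_edges n"
    using E f by (auto simp: switch_def)
  have ne: "u \<noteq> v" "u \<noteq> a" "u \<noteq> b" "v \<noteq> a" "v \<noteq> b" "a \<noteq> b" using f(5) by auto
  note fin = finite_nbrs[OF E]
  have nb: "j \<in> nbrs (switch E u v a b) w \<longleftrightarrow>
    ({w, j} \<in> E \<and> \<not> (w = u \<and> j = v) \<and> \<not> (w = v \<and> j = u) \<and> \<not> (w = a \<and> j = b) \<and> \<not> (w = b \<and> j = a))
    \<or> (w = u \<and> j = a) \<or> (w = a \<and> j = u) \<or> (w = v \<and> j = b) \<or> (w = b \<and> j = v)" for w j
    by (auto simp: switch_def doubleton_eq_iff)
  have sym: "{v, u} \<in> E" "{b, a} \<in> E" "{a, u} \<notin> E" "{b, v} \<notin> E"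
    using e f by (simp_all add: insert_commute)
  consider "w = u" | "w = v" | "w = a" | "w = b" | "w \<notin> {u, v, a, b}" by blast
  then show "vertex_degree (switch E u v a b) w = vertex_degree E w"
  proof cases
    case 1
    have "nbrs (switch E u v a b) u = insert a (nbrs E u - {v})"
      unfolding set_eq_iff nb using ne by auto
    then show ?thesis using card_replace[OF fin, of v u a] e f 1 by (simp add: vertex_degree_def)
  next
    case 2
    have "nbrs (switch E u v a b) v = insert b (nbrs E v - {u})"
      unfolding set_eq_iff nb using ne by auto
    then show ?thesis using card_replace[OF fin, of u v b] sym f 2 by (simp add: vertex_degree_def)
  next
    case 3
    have "nbrs (switch E u v a b) a = insert u (nbrs E a - {b})"
      unfolding set_eq_iff nb using ne by auto
    then show ?thesis using card_replace[OF fin, of b a u] e sym 3 by (simp add: vertex_degree_def)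
  next
    case 4
    have "nbrs (switch E u v a b) b = insert v (nbrs E b - {a})"
      unfolding set_eq_iff nb using ne by auto
    then show ?thesis using card_replace[OF fin, of a b v] sym 4 by (simp add: vertex_degree_def)
  next
    case 5
    then have "nbrs (switch E u v a b) w = nbrs E w"
      unfolding set_eq_iff nb by auto
    then show ?thesis by (simp add: vertex_degree_def)
  qed
qed

text \<open>A short walk from \<open>u\<close> that avoids \<open>uv\<close> does not reach the far edge \<open>ab\<close>, hence it survives the
  switching.\<close>

lemma switch_short_path:
  assumes E: "E \<subseteq> all_edges n" and far: "a \<notin> gball E (Suc (Suc L)) u" "b \<notin> gball E (Suc (Suc L)) u"
    and s: "s \<le> Suc (Suc L)"
  shows "gball (E - {{u, v}}) s u \<subseteq> gball (switch E u v a b) s u"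
  using s
proof (induction s)
  case (Suc s)
  have "gball (E - {{u, v}}) s u \<subseteq> gball E s u"
  proof (induction s)
    case (Suc s) then show ?case by (auto; blast)
  qed simp
  moreover have "gball E s u \<subseteq> gball E (Suc (Suc L)) u" using Suc.prems by (intro gball_mono) simp
  ultimately have "w \<noteq> a \<and> w \<noteq> b" if "w \<in> gball (E - {{u, v}}) s u" for w
    using far that by blast
  then have "nbrs (E - {{u, v}}) w \<subseteq> nbrs (switch E u v a b) w" if "w \<in> gball (E - {{u, v}}) s u" for w
    using that by (auto simp: switch_def doubleton_eq_iff)
  moreover have "gball (E - {{u, v}}) s u \<subseteq> gball (switch E u v a b) s u"
    using Suc by simp
  ultimately show ?case by (simp del: mem_nbrs) blast
qed simp

lemma finite_regular_graphs: "finite (regular_graphs n d)"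
  by (rule finite_subset[of _ "Pow (all_edges n)"]) (auto simp: regular_graphs_def)

lemma regular_graphs_regular:
  "E \<in> regular_graphs n d \<Longrightarrow> regular_graph n d E"
  by (simp add: regular_graphs_def regular_graph_def)

text \<open>Double counting of switchings that start at an edge on a short cycle. Each such edge admits all but
  boundedly many of the \<open>n * d\<close> oriented edges \<open>ab\<close>, and for at least half of the choices the result is a
  connected regular graph. The switching is determined by its result and \<open>u, v, a, b\<close>, and in the result
  \<open>v\<close> is within bounded distance of \<open>u\<close> while \<open>a\<close> and \<open>b\<close> are neighbours of \<open>u\<close> and \<open>v\<close>, which leaves
  only \<open>O(n)\<close> possibilities for each resulting graph.\<close>

lemma switching_count:
  fixes n d L :: nat
  defines "R \<equiv> regular_graphs n d" and "L' \<equiv> Suc (Suc L)"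
  shows "(\<Sum>E\<in>R. card (short_cycle_edges E L')) * (n * d - 2 * d * (d + 1) ^ L')
    \<le> 2 * (card R * (n * ((d + 1) ^ L' * (d * d))))"
proof -
  \<comment> \<open>The far edges, the admissible switchings, those with a connected result, and the data from which
    a switching can be recovered.\<close>
  define P where "P E u = {(a, b). {a, b} \<in> E \<and> a \<notin> gball E L' u \<and> b \<notin> gball E L' u}" for E u
  define D where "D = (SIGMA E:R. SIGMA e:short_cycle_edges E L'. P E (fst e))"
  define D1 where "D1 = {(E, (u, v), (a, b)) \<in> D. switch E u v a b \<in> R}"
  define T where "T = (SIGMA E:R. SIGMA u:{..<n}. SIGMA v:gball E L' u. nbrs E u \<times> nbrs E v)"
  have R: "E \<subseteq> all_edges n" "regular_graph n d E" "connected_graph n E" if "E \<in> R" for E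
    using that regular_graphs_regular by (auto simp: R_def regular_graphs_def)
  have finR: "finite R" by (simp add: R_def finite_regular_graphs)
  have card_nbrs: "card (nbrs E i) = d" if "E \<in> R" "i < n" for E i
    using regular_graph.regular[OF R(2)[OF that(1)] that(2)] by (simp add: vertex_degree_def)
  have finP: "finite (P E u)" if "E \<in> R" for E u
    by (rule finite_subset[of _ "{..<n} \<times> {..<n}"]) (use edge_iff[OF R(1)[OF that]] in \<open>auto simp: P_def\<close>)
  have finS: "finite (short_cycle_edges E L')" if "E \<in> R" for E
    by (rule regular_graph.finite_short_cycle_edges[OF R(2)[OF that]])
  have cardP: "n * d - 2 * d * (d + 1) ^ L' \<le> card (P E u)" if E: "E \<in> R" and u: "u < n" for E u
  proof -
    let ?B = "gball E L' u"
    let ?near = "SIGMA a:?B. nbrs E a"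
    have B: "card ?B \<le> (d + 1) ^ L'" by (rule regular_graph.card_gball[OF R(2)[OF E] u])
    have finB: "finite ?B" by (rule finite_gball[OF R(1)[OF E]])
    have "card ?near = (\<Sum>a\<in>?B. card (nbrs E a))"
      using finB finite_nbrs[OF R(1)[OF E]] by (intro card_SigmaI) auto
    also have "\<dots> = card ?B * d"
      using card_nbrs[OF E] gball_subset[OF R(1)[OF E] u] by (simp add: subset_iff)
    finally have near: "card ?near \<le> (d + 1) ^ L' * d" using B by simp
    have finnear: "finite ?near" using finB finite_nbrs[OF R(1)[OF E]] by blast
    have "n * d = card (SIGMA a:{..<n}. nbrs E a)"
      using card_nbrs[OF E] finite_nbrs[OF R(1)[OF E]] by (subst card_SigmaI) auto
    also have "\<dots> \<le> card (P E u \<union> (?near \<union> prod.swap ` ?near))"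
    proof (rule card_mono)
      show "(SIGMA a:{..<n}. nbrs E a) \<subseteq> P E u \<union> (?near \<union> prod.swap ` ?near)"
        by (auto simp: P_def image_iff insert_commute)
    qed (use finP[OF E] finnear in simp)
    also have "\<dots> \<le> card (P E u) + (card ?near + card (prod.swap ` ?near))"
      by (intro order_trans[OF card_Un_le] add_left_mono card_Un_le)
    also have "card (prod.swap ` ?near) \<le> card ?near" by (rule card_image_le[OF finnear])
    finally show ?thesis using near by (simp add: algebra_simps)
  qed
  have finD: "finite D" unfolding D_def using finR finS finP by (intro finite_SigmaI) auto
  have S_less: "fst e < n" if "E \<in> R" "e \<in> short_cycle_edges E L'" for E e
    using that edge_iff[OF R(1)[OF that(1)]] by (auto simp: short_cycle_edges_def)
  have "(\<Sum>E\<in>R. card (short_cycle_edges E L')) * (n * d - 2 * d * (d + 1) ^ L')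
      = (\<Sum>E\<in>R. \<Sum>e\<in>short_cycle_edges E L'. n * d - 2 * d * (d + 1) ^ L')"
    by (simp add: sum_distrib_right)
  also have "\<dots> \<le> (\<Sum>E\<in>R. \<Sum>e\<in>short_cycle_edges E L'. card (P E (fst e)))"
    by (intro sum_mono cardP S_less)
  also have "\<dots> = card D"
    unfolding D_def using finR finS finP by (simp add: card_SigmaI)
  also have "\<dots> \<le> card (D1 \<union> (\<lambda>(E, e, (a, b)). (E, e, (b, a))) ` D1)"
  proof (rule card_mono)
    show "finite (D1 \<union> (\<lambda>(E, e, (a, b)). (E, e, (b, a))) ` D1)"
      using finite_subset[of D1 D] finD by (auto simp: D1_def)
    \<comment> \<open>For each switching, it or the one with \<open>a\<close> and \<open>b\<close> exchanged preserves connectedness.\<close>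
    show "D \<subseteq> D1 \<union> (\<lambda>(E, e, (a, b)). (E, e, (b, a))) ` D1"
    proof
      fix z assume z: "z \<in> D"
      obtain E u v a b where zz: "z = (E, (u, v), (a, b))" by (metis surj_pair)
      have E: "E \<in> R" and sc: "{u, v} \<in> E" "v \<in> gball (E - {{u, v}}) L' u"
        and ab: "{a, b} \<in> E" "a \<notin> gball E L' u" "b \<notin> gball E L' u"
        using z unfolding zz D_def P_def short_cycle_edges_def by auto
      have ba: "{b, a} \<in> E" using ab(1) by (simp add: insert_commute)
      note r1 = switch_regular[OF R(1)[OF E] sc(1) ab(1) ab(2,3)[unfolded L'_def]]
      note r2 = switch_regular[OF R(1)[OF E] sc(1) ba ab(3,2)[unfolded L'_def]]
      note lt = far_edge(1,3,4)[OF R(1)[OF E] sc(1) ab(1) ab(2,3)[unfolded L'_def]]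
      have deg: "vertex_degree E i = d" if "i < n" for i using E that by (simp add: R_def regular_graphs_def)
      have "connected_graph n (switch E u v a b) \<or> connected_graph n (switch E u v b a)"
        by (rule switch_connected[OF R(3)[OF E] gball_reach[OF sc(2)] lt])
      then have "switch E u v a b \<in> R \<or> switch E u v b a \<in> R"
        using r1 r2 deg by (auto simp: R_def regular_graphs_def)
      moreover have "(E, (u, v), (b, a)) \<in> D"
        using E sc ba ab by (simp add: D_def P_def short_cycle_edges_def)
      ultimately have "z \<in> D1 \<or> (E, (u, v), (b, a)) \<in> D1" using z by (auto simp: zz D1_def)
      then show "z \<in> D1 \<union> (\<lambda>(E, e, (a, b)). (E, e, (b, a))) ` D1"
        unfolding zz by force
    qed
  qed
  also have "\<dots> \<le> card D1 + card ((\<lambda>(E, e, (a, b)). (E, e, (b, a))) ` D1)" by (rule card_Un_le)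
  also have "card ((\<lambda>(E, e, (a, b)). (E, e, (b, a))) ` D1) \<le> card D1"
    by (rule card_image_le) (use finite_subset[of D1 D] finD in \<open>auto simp: D1_def\<close>)
  also have "card D1 \<le> card T"
  proof (rule card_inj_on_le)
    let ?g = "\<lambda>(E, (u, v), (a, b)). (switch E u v a b, u, v, a, b)"
    have D1D: "E \<in> R" "{u, v} \<in> E" "v \<in> gball (E - {{u, v}}) L' u" "{a, b} \<in> E"
        "a \<notin> gball E L' u" "b \<notin> gball E L' u" "switch E u v a b \<in> R"
      if "(E, (u, v), (a, b)) \<in> D1" for E u v a b
      using that by (auto simp: D1_def D_def P_def short_cycle_edges_def)
    \<comment> \<open>The switching is undone by restoring \<open>uv\<close> and \<open>ab\<close>.\<close>
    have undo: "switch E u v a b - {{u, a}, {v, b}} \<union> {{u, v}, {a, b}} = E"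
      if "(E, (u, v), (a, b)) \<in> D1" for E u v a b
    proof -
      note h = D1D[OF that]
      note f = far_edge(6,9)[OF R(1)[OF h(1)] h(2,4) h(5,6)[unfolded L'_def]]
      have undo_set: "E - X \<union> Y - Y \<union> X = E" if "X \<subseteq> E" "Y \<inter> E = {}" for X Y
        using that by blast
      show ?thesis unfolding switch_def by (rule undo_set) (use h(2,4) f in simp_all)
    qed
    show "inj_on ?g D1"
    proof (rule inj_onI)
      fix z z' assume zs: "z \<in> D1" "z' \<in> D1" "?g z = ?g z'"
      obtain E u v a b where z: "z = (E, (u, v), (a, b))" by (metis surj_pair)
      obtain E' u' v' a' b' where z': "z' = (E', (u', v'), (a', b'))" by (metis surj_pair)
      have same: "u' = u" "v' = v" "a' = a" "b' = b"
        using zs(3) unfolding z z' by simp_all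
      have sw: "switch E u v a b = switch E' u v a b"
        using zs(3) unfolding z z' same by simp
      have "E = switch E u v a b - {{u, a}, {v, b}} \<union> {{u, v}, {a, b}}"
        using undo zs(1) unfolding z by simp
      also have "\<dots> = E'"
        using undo zs(2) unfolding z' same sw by simp
      finally show "z = z'" unfolding z z' using same by simp
    qed
    show "?g ` D1 \<subseteq> T"
    proof
      fix y assume "y \<in> ?g ` D1"
      then obtain E u v a b where z: "(E, (u, v), (a, b)) \<in> D1" and y: "y = (switch E u v a b, u, v, a, b)"
        by auto
      note h = D1D[OF z]
      have "v \<in> gball (switch E u v a b) L' u"
        using switch_short_path[OF R(1)[OF h(1)] h(5,6)[unfolded L'_def], of L' v] h(3) by (auto simp: L'_def simp del: gball.simps)
      moreover have "u < n" using edge_iff[OF R(1)[OF h(1)] h(2)] by simp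
      ultimately show "y \<in> T" using h(7) unfolding y T_def by (simp add: switch_def)
    qed
    show "finite T"
      unfolding T_def using finR finite_gball[OF R(1)] finite_nbrs[OF R(1)] by (intro finite_SigmaI) auto
  qed
  also have "card T = (\<Sum>E\<in>R. \<Sum>u<n. \<Sum>v\<in>gball E L' u. card (nbrs E u) * card (nbrs E v))"
    unfolding T_def using finR finite_gball[OF R(1)] finite_nbrs[OF R(1)]
    by (simp add: card_SigmaI card_cartesian_product)
  also have "\<dots> \<le> (\<Sum>E\<in>R. \<Sum>u<n. (d + 1) ^ L' * (d * d))"
  proof (intro sum_mono)
    fix E u assume E: "E \<in> R" and u: "u \<in> {..<n}"
    have "(\<Sum>v\<in>gball E L' u. card (nbrs E u) * card (nbrs E v)) = (\<Sum>v\<in>gball E L' u. d * d)"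
      by (rule sum.cong) (use card_nbrs[OF E] u gball_subset[OF R(1)[OF E]] in auto)
    also have "\<dots> \<le> (d + 1) ^ L' * (d * d)"
      using regular_graph.card_gball[OF R(2)[OF E], of u L'] u by (simp del: power_Suc)
    finally show "(\<Sum>v\<in>gball E L' u. card (nbrs E u) * card (nbrs E v)) \<le> (d + 1) ^ L' * (d * d)" .
  qed
  also have "\<dots> = card R * (n * ((d + 1) ^ L' * (d * d)))" by simp
  finally show ?thesis by simp
qed

text \<open>Dividing the count by \<open>n * d - O(1)\<close> leaves a bound that does not depend on \<open>n\<close>.\<close>

lemma expected_short_cycle_edges:
  assumes ne: "regular_graphs n d \<noteq> {}" and d: "d > 0" and n: "n > 4 * (d + 1) ^ Suc (Suc L)"
  shows "measure_pmf.expectation (random_regular n d) (\<lambda>E. card (short_cycle_edges E (Suc (Suc L))))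
    \<le> real (4 * (d + 1) ^ Suc (Suc L) * d)"
proof -
  let ?R = "regular_graphs n d" and ?L = "Suc (Suc L)"
  define S where "S = (\<Sum>E\<in>?R. card (short_cycle_edges E ?L))"
  have fin: "finite ?R" by (rule finite_regular_graphs)
  have cR: "card ?R > 0" using fin ne by (simp add: card_gt_0_iff)
  have "4 * (d * (d + 1) ^ ?L) \<le> n * d" using n d by (simp del: power_Suc)
  then have "n * d \<le> 2 * (n * d - 2 * d * (d + 1) ^ ?L)" by (simp add: algebra_simps)
  then have "S * (n * d) \<le> 2 * (S * (n * d - 2 * d * (d + 1) ^ ?L))"
    by (metis mult.left_commute mult_le_mono2)
  also have "\<dots> \<le> 2 * (2 * (card ?R * (n * ((d + 1) ^ ?L * (d * d)))))"
    unfolding S_def using switching_count[where n = n and d = d and L = L] by (rule mult_le_mono2)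
  finally have "(n * d) * S \<le> (n * d) * (4 * (d + 1) ^ ?L * d * card ?R)" by (simp add: algebra_simps)
  then have "S \<le> 4 * (d + 1) ^ ?L * d * card ?R" using n d by (simp del: power_Suc)
  then have "real S \<le> real (4 * (d + 1) ^ ?L * d) * real (card ?R)"
    unfolding of_nat_mult[symmetric] of_nat_le_iff .
  moreover have "measure_pmf.expectation (random_regular n d) (\<lambda>E. card (short_cycle_edges E ?L)) = S / card ?R"
    unfolding random_regular_def by (simp add: integral_pmf_of_set[OF ne fin] S_def)
  ultimately show ?thesis using cR by (simp add: divide_le_eq del: power_Suc)
qed

lemma regular_graph_laws: "graph_laws (admissible d) (\<lambda>n. random_regular n d)"
proof
  show "admissible d \<le> sequentially" by (simp add: admissible_def)
  have ne: "\<forall>\<^sub>F n in admissible d. regular_graphs n d \<noteq> {}"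
    by (simp add: admissible_def eventually_inf_principal)
  have set: "set_pmf (random_regular n d) = regular_graphs n d" if "regular_graphs n d \<noteq> {}" for n
    using that finite_regular_graphs by (simp add: random_regular_def)
  show "\<forall>\<^sub>F n in admissible d. set_pmf (random_regular n d) \<subseteq> Pow (all_edges n)"
    using ne by eventually_elim (auto simp: set regular_graphs_def)
  show "\<exists>C::real. \<forall>\<^sub>F n in admissible d. measure_pmf.expectation (random_regular n d) (ball_pairs n R) \<le> C * n" for R
  proof (intro exI)
    show "\<forall>\<^sub>F n in admissible d. measure_pmf.expectation (random_regular n d) (ball_pairs n R) \<le> real ((d + 1) ^ R) * n"
      using ne
    proof eventually_elim
      case (elim n)
      have "measure_pmf.expectation (random_regular n d) (ball_pairs n R)
          \<le> measure_pmf.expectation (random_regular n d) (\<lambda>_. real ((d + 1) ^ R) * n)"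
      proof (rule integral_mono_AE)
        show "AE E in measure_pmf (random_regular n d). ball_pairs n R E \<le> real ((d + 1) ^ R) * n"
          unfolding AE_measure_pmf_iff set[OF elim]
        proof
          fix E assume "E \<in> regular_graphs n d"
          then interpret regular_graph n d E by (rule regular_graphs_regular)
          have "ball_pairs n R E \<le> (\<Sum>i<n. real ((d + 1) ^ R))"
            unfolding ball_pairs_def by (intro sum_mono of_nat_mono card_gball) auto
          then show "ball_pairs n R E \<le> real ((d + 1) ^ R) * n" by (simp add: mult.commute)
        qed
      qed (auto intro: integrable_measure_pmf_finite simp: set[OF elim] finite_regular_graphs)
      then show ?case by simp
    qed
  qed
qed

lemma regular_mean_flip_tendsto:
  assumes d: "d > 0"
  shows "((\<lambda>n. measure_pmf.expectation (random_regular n d) (\<lambda>E. (mean_flip n t E - tree_flip d t)\<^sup>2))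
    \<longlongrightarrow> 0) (admissible d)"
proof -
  interpret graph_laws "admissible d" "\<lambda>n. random_regular n d" by (rule regular_graph_laws)
  let ?L = "2 * t + 3"
  have L: "?L = Suc (Suc (2 * t + 1))" by simp
  let ?C = "real ((d + 1) ^ (t + 1)) * real (4 * (d + 1) ^ ?L * d)"
  have ne: "\<forall>\<^sub>F n in admissible d. regular_graphs n d \<noteq> {}"
    by (simp add: admissible_def eventually_inf_principal)
  have large: "\<forall>\<^sub>F n in admissible d. n > 4 * (d + 1) ^ ?L"
    using F_le eventually_gt_at_top by (rule filter_leD)
  show ?thesis
  proof (rule tendsto_sandwich[OF _ _ tendsto_const tendsto_F[OF lim_const_over_n[of ?C]]])
    show "\<forall>\<^sub>F n in admissible d. measure_pmf.expectation (random_regular n d) (\<lambda>E. (mean_flip n t E - tree_flip d t)\<^sup>2) \<le> ?C / n"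
      using ne large finite_support eventually_pos
    proof eventually_elim
      case (elim n)
      have int [simp]: "integrable (measure_pmf (random_regular n d)) f" for f :: "_ \<Rightarrow> real"
        by (rule integrable_measure_pmf_finite) (rule elim)
      have set: "set_pmf (random_regular n d) = regular_graphs n d"
        using elim(1) finite_regular_graphs by (simp add: random_regular_def)
      have "measure_pmf.expectation (random_regular n d) (\<lambda>E. (mean_flip n t E - tree_flip d t)\<^sup>2)
          \<le> measure_pmf.expectation (random_regular n d)
            (\<lambda>E. real ((d + 1) ^ (t + 1)) * card (short_cycle_edges E ?L) / n)"
      proof (rule integral_mono_AE)
        show "AE E in measure_pmf (random_regular n d). (mean_flip n t E - tree_flip d t)\<^sup>2
            \<le> real ((d + 1) ^ (t + 1)) * card (short_cycle_edges E ?L) / n"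
          unfolding AE_measure_pmf_iff set
          using regular_graph.mean_flip_near_tree_flip[OF regular_graphs_regular elim(4)] by blast
      qed simp_all
      also have "\<dots> = real ((d + 1) ^ (t + 1)) *
          measure_pmf.expectation (random_regular n d) (\<lambda>E. card (short_cycle_edges E ?L)) / n"
        by simp
      also have "\<dots> \<le> ?C / n"
        using expected_short_cycle_edges[OF elim(1) d, of "2 * t + 1"] elim(2)
        unfolding L by (intro divide_right_mono mult_left_mono of_nat_0_le_iff)
      finally show ?case .
    qed
  qed (simp add: always_eventually)
qed

section \<open>Ball sizes in the Erdos--Renyi graph\<close>

lemma set_erdos_renyi: "set_pmf (erdos_renyi n p) \<subseteq> Pow (all_edges n)"
  by (auto simp: erdos_renyi_def)

lemma finite_set_erdos_renyi [simp]: "finite (set_pmf (erdos_renyi n p))"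
  by (rule finite_subset[OF set_erdos_renyi]) simp

lemma integrable_erdos_renyi [simp]: "integrable (measure_pmf (erdos_renyi n p)) (f :: _ \<Rightarrow> real)"
  by (rule integrable_measure_pmf_finite) simp

text \<open>The probability that the graph agrees with \<open>H\<close> on a given set \<open>A\<close> of pairs of vertices.\<close>

lemma erdos_renyi_prob:
  assumes p: "0 \<le> p" "p \<le> 1" and A: "A \<subseteq> all_edges n" "H \<subseteq> A"
  shows "measure_pmf.prob (erdos_renyi n p) {E. E \<inter> A = H} = p ^ card H * (1 - p) ^ (card A - card H)"
proof -
  let ?B = "\<lambda>e. if e \<in> A then {e \<in> H} else UNIV"
  have finA: "finite A" by (rule finite_subset[OF A(1)]) simp
  have "(\<lambda>f. {e \<in> all_edges n. f e}) -` {E. E \<inter> A = H} = Pi (all_edges n) ?B"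
    using A by (auto simp: Pi_def split: if_splits)
  then have "measure_pmf.prob (erdos_renyi n p) {E. E \<inter> A = H}
      = measure_pmf.prob (Pi_pmf (all_edges n) False (\<lambda>_. bernoulli_pmf p)) (Pi (all_edges n) ?B)"
    by (simp add: erdos_renyi_def)
  also have "\<dots> = (\<Prod>e\<in>all_edges n. measure_pmf.prob (bernoulli_pmf p) (?B e))"
    by (rule measure_Pi_pmf_Pi) simp
  also have "\<dots> = (\<Prod>e\<in>A. if e \<in> H then p else 1 - p)"
    by (rule prod.mono_neutral_cong_right) (use A p in \<open>auto simp: measure_pmf_single\<close>)
  also have "\<dots> = p ^ card (A \<inter> H) * (1 - p) ^ card (A - H)"
    using finA by (subst prod.If_cases) (auto simp: Diff_eq)
  also have "A \<inter> H = H" using A by blast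
  also have "card (A - H) = card A - card H"
    using A(2) finA by (simp add: card_Diff_subset finite_subset)
  finally show ?thesis .
qed

lemma erdos_renyi_prob_superset:
  assumes "0 \<le> p" "p \<le> 1" "A \<subseteq> all_edges n"
  shows "measure_pmf.prob (erdos_renyi n p) {E. A \<subseteq> E} = p ^ card A"
proof -
  have "{E. A \<subseteq> E} = {E. E \<inter> A = A}" by auto
  then show ?thesis using erdos_renyi_prob[OF assms order_refl] by simp
qed

text \<open>The edges of the path through the given vertices.\<close>

fun path_edges :: "'a list \<Rightarrow> 'a set set" where
  "path_edges (x # y # xs) = insert {x, y} (path_edges (y # xs))"
| "path_edges _ = {}"

lemma path_edges_subset: "e \<in> path_edges xs \<Longrightarrow> e \<subseteq> set xs"
  by (induction xs rule: path_edges.induct) auto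

lemma finite_path_edges [simp]: "finite (path_edges xs)"
  by (induction xs rule: path_edges.induct) auto

lemma card_path_edges: "distinct xs \<Longrightarrow> card (path_edges xs) = length xs - 1"
proof (induction xs rule: path_edges.induct)
  case (1 x y xs)
  have "{x, y} \<notin> path_edges (y # xs)" using path_edges_subset[of "{x, y}" "y # xs"] 1(2) by auto
  then show ?case using 1 by simp
qed auto

lemma path_edges_all_edges:
  "distinct xs \<Longrightarrow> set xs \<subseteq> {..<n} \<Longrightarrow> path_edges xs \<subseteq> all_edges n"
  by (induction xs rule: path_edges.induct) auto

text \<open>A point of the ball is joined to the centre by a path without repetition, whose edges are therefore
  independent in the random graph.\<close>

lemma gball_path:
  assumes "j \<in> gball E r i"
  shows "\<exists>xs. length xs \<le> r \<and> distinct (j # xs) \<and> last (j # xs) = i \<and> path_edges (j # xs) \<subseteq> E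
    \<and> set (j # xs) \<subseteq> gball E r i"
  using assms
proof (induction r arbitrary: j)
  case 0
  then show ?case by (intro exI[of _ "[]"]) simp
next
  case (Suc r)
  show ?case
  proof (cases "j \<in> gball E r i")
    case True
    from Suc.IH[OF this] obtain xs where "length xs \<le> r" "distinct (j # xs)" "last (j # xs) = i"
      "path_edges (j # xs) \<subseteq> E" "set (j # xs) \<subseteq> gball E r i" by blast
    then show ?thesis
      using gball_Suc_mono[of E r i] by (intro exI[of _ xs] conjI) (assumption | simp | blast)+
  next
    case False
    then obtain v where v: "v \<in> gball E r i" "{v, j} \<in> E" using Suc.prems by auto
    from Suc.IH[OF v(1)] obtain xs where xs: "length xs \<le> r" "distinct (v # xs)" "last (v # xs) = i"
      "path_edges (v # xs) \<subseteq> E" "set (v # xs) \<subseteq> gball E r i" by blast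
    have "distinct (j # v # xs)" using False xs(2,5) by auto
    moreover have "path_edges (j # v # xs) \<subseteq> E" using xs(4) v(2) by (simp add: insert_commute)
    moreover have "set (j # v # xs) \<subseteq> gball E (Suc r) i"
      using Suc.prems xs(5) gball_Suc_mono[of E r i] by auto
    ultimately show ?thesis using xs(1,3) by (intro exI[of _ "v # xs"]) simp
  qed
qed

text \<open>The expected number of paths of length \<open>k\<close> from \<open>i\<close> is at most \<open>n ^ k * p ^ k = d ^ k\<close>.\<close>

lemma expected_card_gball:
  assumes p: "0 \<le> p" "p \<le> 1" and d: "d = real n * p" and i: "i < n"
  shows "measure_pmf.expectation (erdos_renyi n p) (\<lambda>E. card (gball E R i)) \<le> (\<Sum>k\<le>R. d ^ k)"
proof -
  \<comment> \<open>The possible paths of length \<open>k\<close> that end at \<open>i\<close>, listed from the other end.\<close>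
  define P where "P k = {xs. length xs = Suc k \<and> set xs \<subseteq> {..<n} \<and> distinct xs \<and> last xs = i}" for k
  have P_sub: "P k \<subseteq> (\<lambda>ys. ys @ [i]) ` {ys. set ys \<subseteq> {..<n} \<and> length ys = k}" for k
  proof
    fix xs assume xs: "xs \<in> P k"
    then have "xs = butlast xs @ [i]" by (cases xs rule: rev_cases) (auto simp: P_def)
    moreover have "set (butlast xs) \<subseteq> {..<n}" "length (butlast xs) = k"
      using xs by (auto simp: P_def dest: in_set_butlastD)
    ultimately show "xs \<in> (\<lambda>ys. ys @ [i]) ` {ys. set ys \<subseteq> {..<n} \<and> length ys = k}" by blast
  qed
  have finL: "finite {ys. set ys \<subseteq> {..<n} \<and> length ys = k}" for k
    by (rule finite_lists_length_eq) simp
  have finP [simp]: "finite (P k)" for k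
    by (rule finite_subset[OF P_sub]) (simp add: finL)
  have cardP: "card (P k) \<le> n ^ k" for k
  proof -
    have "card (P k) \<le> card ((\<lambda>ys. ys @ [i]) ` {ys. set ys \<subseteq> {..<n} \<and> length ys = k})"
      by (rule card_mono[OF _ P_sub]) (simp add: finL)
    also have "\<dots> \<le> card {ys. set ys \<subseteq> {..<n} \<and> length ys = k}" by (rule card_image_le[OF finL])
    also have "\<dots> = n ^ k" by (subst card_lists_length_eq) auto
    finally show ?thesis .
  qed
  have ball: "real (card (gball E R i)) \<le> (\<Sum>k\<le>R. \<Sum>xs\<in>P k. indicator {E. path_edges xs \<subseteq> E} E)"
    if E: "E \<subseteq> all_edges n" for E
  proof -
    have "gball E R i \<subseteq> (\<Union>k\<le>R. hd ` {xs \<in> P k. path_edges xs \<subseteq> E})"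
    proof
      fix j assume "j \<in> gball E R i"
      from gball_path[OF this] obtain xs where xs: "length xs \<le> R" "distinct (j # xs)" "last (j # xs) = i"
        "path_edges (j # xs) \<subseteq> E" "set (j # xs) \<subseteq> gball E R i" by blast
      have "set (j # xs) \<subseteq> {..<n}" using xs(5) gball_subset[OF E i] by (rule subset_trans)
      then have "j # xs \<in> {ys \<in> P (length xs). path_edges ys \<subseteq> E}"
        unfolding P_def by (intro CollectI conjI xs) simp_all
      then have "hd (j # xs) \<in> hd ` {ys \<in> P (length xs). path_edges ys \<subseteq> E}"
        by (rule imageI)
      then show "j \<in> (\<Union>k\<le>R. hd ` {xs \<in> P k. path_edges xs \<subseteq> E})" using xs(1) by auto
    qed
    then have "card (gball E R i) \<le> card (\<Union>k\<le>R. hd ` {xs \<in> P k. path_edges xs \<subseteq> E})"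
      by (intro card_mono) auto
    also have "\<dots> \<le> (\<Sum>k\<le>R. card (hd ` {xs \<in> P k. path_edges xs \<subseteq> E}))"
      by (rule card_UN_le) simp
    also have "\<dots> \<le> (\<Sum>k\<le>R. card {xs \<in> P k. path_edges xs \<subseteq> E})"
      by (intro sum_mono card_image_le) simp
    finally have "real (card (gball E R i)) \<le> real (\<Sum>k\<le>R. card {xs \<in> P k. path_edges xs \<subseteq> E})"
      by (rule of_nat_mono)
    also have "\<dots> = (\<Sum>k\<le>R. \<Sum>xs\<in>P k. indicator {E. path_edges xs \<subseteq> E} E)"
      by (simp add: indicator_def sum.If_cases Int_def)
    finally show ?thesis .
  qed
  have "measure_pmf.expectation (erdos_renyi n p) (\<lambda>E. real (card (gball E R i)))
      \<le> measure_pmf.expectation (erdos_renyi n p) (\<lambda>E. \<Sum>k\<le>R. \<Sum>xs\<in>P k. indicator {E. path_edges xs \<subseteq> E} E)"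
  proof (rule integral_mono_AE)
    show "AE E in measure_pmf (erdos_renyi n p).
        real (card (gball E R i)) \<le> (\<Sum>k\<le>R. \<Sum>xs\<in>P k. indicator {E. path_edges xs \<subseteq> E} E)"
      unfolding AE_measure_pmf_iff using ball set_erdos_renyi by blast
  qed simp_all
  also have "\<dots> = (\<Sum>k\<le>R. \<Sum>xs\<in>P k. measure_pmf.prob (erdos_renyi n p) {E. path_edges xs \<subseteq> E})"
    by simp
  also have "\<dots> = (\<Sum>k\<le>R. \<Sum>xs\<in>P k. p ^ k)"
  proof (intro sum.cong refl)
    fix k xs assume "xs \<in> P k"
    then have "path_edges xs \<subseteq> all_edges n" "card (path_edges xs) = k"
      using path_edges_all_edges[of xs n] card_path_edges[of xs] by (auto simp: P_def)
    then show "measure_pmf.prob (erdos_renyi n p) {E. path_edges xs \<subseteq> E} = p ^ k"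
      using erdos_renyi_prob_superset[OF p] by simp
  qed
  also have "\<dots> \<le> (\<Sum>k\<le>R. d ^ k)"
  proof (rule sum_mono)
    fix k
    have "real (card (P k)) * p ^ k \<le> real (n ^ k) * p ^ k"
      using cardP[of k] p(1) by (intro mult_right_mono) (simp_all only: of_nat_le_iff zero_le_power)
    then show "(\<Sum>xs\<in>P k. p ^ k) \<le> d ^ k" by (simp add: d power_mult_distrib)
  qed
  finally show ?thesis .
qed

lemma expected_ball_pairs:
  assumes p: "0 \<le> p" "p \<le> 1" and d: "d = real n * p"
  shows "measure_pmf.expectation (erdos_renyi n p) (ball_pairs n R) \<le> (\<Sum>k\<le>R. d ^ k) * n"
proof -
  have "measure_pmf.expectation (erdos_renyi n p) (ball_pairs n R)
      = (\<Sum>i<n. measure_pmf.expectation (erdos_renyi n p) (\<lambda>E. real (card (gball E R i))))"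
    unfolding ball_pairs_def by simp
  also have "\<dots> \<le> (\<Sum>i<n. \<Sum>k\<le>R. d ^ k)"
    by (rule sum_mono) (use expected_card_gball[OF p d] in auto)
  finally show ?thesis by (simp add: mult.commute)
qed

lemma erdos_renyi_laws:
  assumes d: "d \<ge> 0"
  shows "graph_laws sequentially (\<lambda>n. erdos_renyi n (d / real n))"
proof
  show "\<forall>\<^sub>F n in sequentially. set_pmf (erdos_renyi n (d / real n)) \<subseteq> Pow (all_edges n)"
    using set_erdos_renyi by simp
  show "\<exists>C::real. \<forall>\<^sub>F n in sequentially.
      measure_pmf.expectation (erdos_renyi n (d / real n)) (ball_pairs n R) \<le> C * n" for R
  proof (intro exI)
    show "\<forall>\<^sub>F n in sequentially.
      measure_pmf.expectation (erdos_renyi n (d / real n)) (ball_pairs n R) \<le> (\<Sum>k\<le>R. d ^ k) * n"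
      using eventually_ge_at_top[of "nat \<lceil>d\<rceil>"] eventually_gt_at_top[of 0]
    proof eventually_elim
      case (elim n)
      then have "d \<le> real n" by linarith
      then show ?case using elim d by (intro expected_ball_pairs) auto
    qed
  qed
qed simp

section \<open>Exploring a ball and counting its possible shapes\<close>

text \<open>All pairs of vertices in \<open>S\<close>.\<close>

definition inside :: "nat set \<Rightarrow> nat set set" where
  "inside S = {e. e \<subseteq> S \<and> card e = 2}"

lemma inside_lessThan: "inside {..<k} = all_edges k"
  by (simp add: inside_def all_edges_def)

lemma finite_inside: "finite S \<Longrightarrow> finite (inside S)"
  by (rule finite_subset[of _ "Pow S"]) (auto simp: inside_def)

lemma inside_subset: "S \<subseteq> {..<n} \<Longrightarrow> inside S \<subseteq> all_edges n"
  by (auto simp: inside_def all_edges_def)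

text \<open>The induced subgraph on \<open>S\<close>.\<close>

definition induced :: "nat set set \<Rightarrow> nat set \<Rightarrow> nat set set" where
  "induced E S = {e \<in> E. e \<subseteq> S}"

text \<open>The pairs of vertices that are inspected when a ball with vertex set \<open>S\<close> is explored and \<open>B\<close> is the ball
  with the same centre and a radius that is smaller by one: the pairs within \<open>S\<close>, and the pairs that
  contain a vertex of \<open>B\<close>, since the neighbours of \<open>B\<close> must be found to lie in \<open>S\<close>.\<close>

definition window :: "nat \<Rightarrow> nat set \<Rightarrow> nat set \<Rightarrow> nat set set" where
  "window n B S = {e \<in> all_edges n. e \<subseteq> S \<or> e \<inter> B \<noteq> {}}"

lemma gball_cong:
  assumes "\<And>u w. u < s \<Longrightarrow> w \<in> gball E u i \<Longrightarrow> nbrs E' w = nbrs E w"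
  shows "gball E' s i = gball E s i"
  using assms
proof (induction s)
  case (Suc s)
  have "gball E' s i = gball E s i" by (rule Suc.IH, rule Suc.prems) simp_all
  moreover have "nbrs E' w = nbrs E w" if "w \<in> gball E s i" for w using Suc.prems[of s w] that by simp
  ultimately show ?case by simp
qed simp

lemma nbrs_induced:
  assumes "w \<in> gball E u i" "u < r"
  shows "nbrs (induced E (gball E r i)) w = nbrs E w"
proof -
  have "w \<in> gball E r i" "nbrs E w \<subseteq> gball E r i"
    using assms gball_mono[of u r E i] gball_mono[of "Suc u" r E i] nbrs_gball[OF assms(1)] by auto
  then show ?thesis by (auto simp: induced_def)
qed

lemma gball_induced: "s \<le> r \<Longrightarrow> gball (induced E (gball E r i)) s i = gball E s i"
  by (rule gball_cong) (use nbrs_induced in auto)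

lemma gball_window:
  assumes E: "E \<subseteq> all_edges n" and H: "E \<inter> window n (gball H q i) S = H" and s: "s \<le> Suc q"
  shows "gball E s i = gball H s i"
proof (rule gball_cong)
  fix u w assume "u < s" "w \<in> gball H u i"
  then have w: "w \<in> gball H q i" using gball_mono[of u q H i] s by auto
  have "{w, j} \<in> E \<longleftrightarrow> {w, j} \<in> H" for j
  proof
    assume e: "{w, j} \<in> E"
    then have "{w, j} \<in> window n (gball H q i) S" using E w unfolding window_def by blast
    then show "{w, j} \<in> H" using e H by blast
  qed (use H in blast)
  then show "nbrs E w = nbrs H w" by (auto simp: set_eq_iff)
qed

text \<open>The ball of radius \<open>q + 1\<close> has vertex set \<open>S\<close> and induced subgraph \<open>H\<close> if and only if the graph
  agrees with \<open>H\<close> on the window.\<close>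

lemma window_event:
  assumes E: "E \<subseteq> all_edges n" and H: "H \<subseteq> inside S" "gball H (Suc q) i = S"
  shows "E \<inter> window n (gball H q i) S = H \<longleftrightarrow> gball E (Suc q) i = S \<and> induced E S = H"
proof
  assume *: "E \<inter> window n (gball H q i) S = H"
  have "gball E (Suc q) i = S" using gball_window[OF E *, of "Suc q"] H(2) by simp
  moreover have "induced E S = H"
  proof
    show "induced E S \<subseteq> H" using * E by (auto simp: induced_def window_def)
    show "H \<subseteq> induced E S" using * H(1) by (auto simp: induced_def inside_def)
  qed
  ultimately show "gball E (Suc q) i = S \<and> induced E S = H" by blast
next
  assume *: "gball E (Suc q) i = S \<and> induced E S = H"
  then have B: "gball H q i = gball E q i" using gball_induced[of q "Suc q" E i] by simp
  have "e \<subseteq> S" if e: "e \<in> E" "e \<inter> gball E q i \<noteq> {}" for e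
  proof -
    from e(2) obtain x where x: "x \<in> e" "x \<in> gball E q i" by blast
    from edge_obtain[OF E e(1)] obtain a b where ab: "e = {a, b}" .
    then have "a \<in> nbrs E b" "b \<in> nbrs E a" using e(1) by (simp_all add: insert_commute)
    then have "e \<subseteq> insert x (nbrs E x)" using x(1) ab by auto
    also have "\<dots> \<subseteq> gball E (Suc q) i" using x(2) nbrs_gball[OF x(2)] by (simp add: subset_iff)
    finally show ?thesis using * by simp
  qed
  then show "E \<inter> window n (gball H q i) S = H"
    using * E unfolding B by (auto simp: induced_def window_def)
qed

text \<open>Whether \<open>i\<close> flips is decided by the induced subgraph on its ball of radius \<open>t + 2\<close>. The degrees of the
  vertices at distance exactly \<open>t + 2\<close> can change, but these vertices never update within the relevant
  time.\<close>

lemma flip_prob_induced: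
  "flip_prob A (voters (induced E (gball E (t + 2) i))) t i = flip_prob A (voters E) t i"
proof -
  let ?H = "induced E (gball E (t + 2) i)"
  have "dyn (voters E) x u i = dyn (voters ?H) x u (id i)" if u: "u \<le> t + 2" for x u
  proof (rule dyn_covering[where A = "\<lambda>s. gball E (t + 2 - s) i"])
    fix s w assume s: "s < u" "w \<in> gball E (t + 2 - Suc s) i"
    then have "nbrs ?H w = nbrs E w" using nbrs_induced[of w E "t + 2 - Suc s" i "t + 2"] by simp
    then have "voters ?H w = voters E w" by (simp add: voters_def vertex_degree_def)
    moreover have "Suc (t + 2 - Suc s) = t + 2 - s" using s u by simp
    ultimately show "voters E w \<subseteq> gball E (t + 2 - s) i \<and> voters ?H (id w) = id ` voters E w \<and> inj_on id (voters E w)"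
      using voters_gball[OF s(2)] unfolding id_apply image_id by simp
  qed simp_all
  from this[of "t + 2"] this[of t] have "flips (voters ?H) t i = flips (voters E) t i"
    by (simp add: flips_def del: dyn.simps)
  then show ?thesis by (simp add: flip_prob_def)
qed

subsection \<open>Relabelling\<close>

text \<open>The image of a graph under a relabelling of its vertices.\<close>

definition relabel :: "(nat \<Rightarrow> nat) \<Rightarrow> nat set set \<Rightarrow> nat set set" where
  "relabel \<pi> H = (`) \<pi> ` H"

context
  fixes \<pi> :: "nat \<Rightarrow> nat" and k :: nat and H :: "nat set set"
  assumes inj: "inj_on \<pi> {..<k}" and H: "H \<subseteq> all_edges k"
begin

lemma nbrs_relabel: "w < k \<Longrightarrow> nbrs (relabel \<pi> H) (\<pi> w) = \<pi> ` nbrs H w"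
proof (intro equalityI subsetI)
  fix j assume w: "w < k" and "j \<in> nbrs (relabel \<pi> H) (\<pi> w)"
  then obtain e where e: "e \<in> H" "{\<pi> w, j} = \<pi> ` e" by (auto simp: relabel_def)
  obtain x y where xy: "e = {x, y}" "x < k" "y < k" using edge_obtain[OF H e(1)] by metis
  then consider "\<pi> w = \<pi> x" "j = \<pi> y" | "\<pi> w = \<pi> y" "j = \<pi> x"
    using e(2) by (auto simp: doubleton_eq_iff)
  then show "j \<in> \<pi> ` nbrs H w"
  proof cases
    case 1
    then have "w = x" using inj w xy by (auto simp: inj_on_def)
    then show ?thesis using 1 e(1) xy(1) by auto
  next
    case 2
    then have "w = y" using inj w xy by (auto simp: inj_on_def)
    then have "{w, x} \<in> H" using e(1) xy(1) by (simp add: insert_commute)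
    then show ?thesis using 2 by auto
  qed
next
  fix j assume "j \<in> \<pi> ` nbrs H w"
  then obtain y where y: "{w, y} \<in> H" "j = \<pi> y" by auto
  then have "\<pi> ` {w, y} \<in> relabel \<pi> H" unfolding relabel_def by (intro imageI)
  then show "j \<in> nbrs (relabel \<pi> H) (\<pi> w)" using y(2) by simp
qed

lemma voters_relabel:
  assumes w: "w < k"
  shows "voters (relabel \<pi> H) (\<pi> w) = \<pi> ` voters H w"
proof -
  have "inj_on \<pi> (nbrs H w)" using inj nbrs_subset[OF H] by (rule inj_on_subset)
  then have "vertex_degree (relabel \<pi> H) (\<pi> w) = vertex_degree H w"
    by (simp add: vertex_degree_def nbrs_relabel[OF w] card_image)
  then show ?thesis by (simp add: voters_def nbrs_relabel[OF w])
qed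

lemma gball_relabel: "i < k \<Longrightarrow> gball (relabel \<pi> H) r (\<pi> i) = \<pi> ` gball H r i"
proof (induction r)
  case (Suc r)
  have "nbrs (relabel \<pi> H) (\<pi> v) = \<pi> ` nbrs H v" if "v \<in> gball H r i" for v
    using nbrs_relabel[of v] gball_subset[OF H Suc.prems] that by blast
  then show ?case using Suc by (simp add: image_Un image_UN)
qed simp

lemma card_relabel: "card (relabel \<pi> H) = card H"
  unfolding relabel_def
proof (rule card_image)
  have "H \<subseteq> Pow {..<k}" using H by (auto simp: all_edges_def)
  then show "inj_on ((`) \<pi>) H" using inj_on_image_Pow[OF inj] inj_on_subset by blast
qed

lemma flip_prob_relabel:
  assumes "finite V" "\<pi> ` {..<k} \<subseteq> V" "i < k"
  shows "flip_prob V (voters (relabel \<pi> H)) t (\<pi> i) = flip_prob {..<k} (voters H) t i"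
  by (rule flip_prob_covering[where A = "\<lambda>_. {..<k}"])
    (use assms inj voters_relabel voters_subset[OF H] in auto)

end

lemma bij_betw_filter:
  assumes "bij_betw f A B" "\<And>a. a \<in> A \<Longrightarrow> P a \<longleftrightarrow> Q (f a)"
  shows "bij_betw f {a \<in> A. P a} {b \<in> B. Q b}"
  using assms unfolding bij_betw_def inj_on_def by auto

lemma bij_betw_inside:
  assumes "bij_betw \<pi> A S"
  shows "bij_betw ((`) \<pi>) (inside A) (inside S)"
proof -
  have "bij_betw ((`) \<pi>) {e \<in> Pow A. card e = 2} {e \<in> Pow S. card e = 2}"
  proof (rule bij_betw_filter[OF bij_betw_Pow[OF assms]])
    fix e assume "e \<in> Pow A"
    then have "card (\<pi> ` e) = card e"
      using assms by (intro card_image) (auto simp: bij_betw_def intro: inj_on_subset)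
    then show "card e = 2 \<longleftrightarrow> card (\<pi> ` e) = 2" by simp
  qed
  then show ?thesis by (simp add: inside_def)
qed

text \<open>The graphs on \<open>S\<close> in which every vertex is within distance \<open>r\<close> of \<open>i\<close>.\<close>

definition shapes :: "nat \<Rightarrow> nat set \<Rightarrow> nat \<Rightarrow> nat set set set" where
  "shapes r S i = {H. H \<subseteq> inside S \<and> gball H r i = S}"

lemma finite_shapes: "finite S \<Longrightarrow> finite (shapes r S i)"
  by (rule finite_subset[of _ "Pow (inside S)"]) (auto simp: shapes_def finite_inside)

lemma bij_betw_relabel_shapes:
  assumes \<pi>: "bij_betw \<pi> {..<k} S" and i: "i < k"
  shows "bij_betw (relabel \<pi>) (shapes r {..<k} i) (shapes r S (\<pi> i))"
proof -
  have inj: "inj_on \<pi> {..<k}" and im: "\<pi> ` {..<k} = S" using \<pi> by (auto simp: bij_betw_def)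
  have eq: "relabel \<pi> = (`) ((`) \<pi>)" by (auto simp: relabel_def fun_eq_iff)
  have "bij_betw (relabel \<pi>) {H \<in> Pow (inside {..<k}). gball H r i = {..<k}}
      {H \<in> Pow (inside S). gball H r (\<pi> i) = S}"
    unfolding eq
  proof (rule bij_betw_filter[OF bij_betw_Pow[OF bij_betw_inside[OF \<pi>]]])
    fix H assume "H \<in> Pow (inside {..<k})"
    then have H: "H \<subseteq> all_edges k" by (simp add: inside_lessThan)
    have "gball ((`) ((`) \<pi>) H) r (\<pi> i) = \<pi> ` gball H r i"
      using gball_relabel[OF inj H i] by (simp add: relabel_def)
    then show "gball H r i = {..<k} \<longleftrightarrow> gball ((`) ((`) \<pi>) H) r (\<pi> i) = S"
      using inj_on_image_eq_iff[OF inj gball_subset[OF H i] order_refl] im by simp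
  qed
  then show ?thesis by (simp add: shapes_def Collect_conj_eq)
qed

lemma card_inside: "finite S \<Longrightarrow> card (inside S) = card S choose 2"
  unfolding inside_def by (rule n_subsets)

lemma card_window:
  assumes S: "S \<subseteq> {..<n}" and B: "B \<subseteq> S"
  shows "card (window n B S) = (card S choose 2) + card B * (n - card S)"
proof -
  have fin: "finite S" "finite B" using S B finite_subset by (auto intro: finite_subset)
  let ?out = "(\<lambda>(x, y). {x, y}) ` (B \<times> ({..<n} - S))"
  have "window n B S = inside S \<union> ?out"
  proof (intro equalityI subsetI)
    fix e assume e: "e \<in> window n B S"
    show "e \<in> inside S \<union> ?out"
    proof (cases "e \<subseteq> S")
      case True
      then show ?thesis using e by (simp add: window_def inside_def all_edges_def)
    next
      case False
      then obtain x where x: "x \<in> e" "x \<in> B" using e by (auto simp: window_def)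
      have "e \<in> all_edges n" using e by (simp add: window_def)
      then obtain a b where ab: "e = {a, b}" "a < n" "b < n" using edge_obtain[OF order_refl] by metis
      then obtain y where y: "e = {x, y}" "y < n" using x(1) by (auto simp: insert_commute)
      then have "y \<notin> S" using False x(2) B by auto
      then show ?thesis using y x(2) by auto
    qed
  next
    fix e assume "e \<in> inside S \<union> ?out"
    then show "e \<in> window n B S"
    proof
      assume "e \<in> inside S"
      then show ?thesis using inside_subset[OF S] by (auto simp: window_def inside_def)
    next
      assume "e \<in> ?out"
      then obtain a b where ab: "e = {a, b}" "a \<in> B" "b < n" "b \<notin> S" by auto
      then have "a < n" "a \<noteq> b" using S B by auto
      then show ?thesis using ab by (simp add: window_def)
    qed
  qed
  moreover have "card ?out = card B * (n - card S)"
  proof -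
    have "inj_on (\<lambda>(x, y). {x, y}) (B \<times> ({..<n} - S))"
      using B by (auto simp: inj_on_def doubleton_eq_iff)
    then show ?thesis using fin S by (simp add: card_image card_cartesian_product card_Diff_subset)
  qed
  moreover have "inside S \<inter> ?out = {}" by (auto simp: inside_def)
  ultimately show ?thesis
    using fin by (simp add: card_Un_disjoint finite_inside card_inside)
qed

subsection \<open>The truncated flip probability\<close>

text \<open>The pairs of a vertex set \<open>S\<close> of at most \<open>K\<close> vertices and a graph on it which can be the ball of radius
  \<open>t + 2\<close> around \<open>i\<close>.\<close>

definition configs :: "nat \<Rightarrow> nat \<Rightarrow> nat \<Rightarrow> nat \<Rightarrow> (nat set \<times> nat set set) set" where
  "configs n K t i = (SIGMA S:{S. S \<subseteq> {..<n} \<and> i \<in> S \<and> card S \<le> K}. shapes (t + 2) S i)"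

text \<open>The event that the ball around \<open>i\<close> is the given one, expressed by the window.\<close>

definition config_event :: "nat \<Rightarrow> nat \<Rightarrow> nat \<Rightarrow> nat set \<times> nat set set \<Rightarrow> nat set set set" where
  "config_event n t i c = {E. E \<inter> window n (gball (snd c) (t + 1) i) (fst c) = snd c}"

text \<open>The flip probability of \<open>i\<close> if its ball of radius \<open>t + 2\<close> has at most \<open>K\<close> vertices, and 0 otherwise.\<close>

definition small_flip :: "nat \<Rightarrow> nat \<Rightarrow> nat \<Rightarrow> nat \<Rightarrow> nat set set \<Rightarrow> real" where
  "small_flip n K t i E =
    (if card (gball E (t + 2) i) \<le> K then flip_prob {..<n} (voters E) t i else 0)"

lemma finite_configs: "finite (configs n K t i)"
  unfolding configs_def
  by (intro finite_SigmaI finite_shapes) (auto intro: finite_subset)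

lemma config_event_iff:
  assumes E: "E \<subseteq> all_edges n" and c: "c \<in> configs n K t i"
  shows "E \<in> config_event n t i c \<longleftrightarrow> c = (gball E (t + 2) i, induced E (gball E (t + 2) i))"
proof -
  obtain S H where SH: "c = (S, H)" by force
  have Suc: "Suc (t + 1) = t + 2" by simp
  have "H \<subseteq> inside S" "gball H (Suc (t + 1)) i = S"
    using c unfolding SH configs_def shapes_def Suc by blast+
  from window_event[OF E this]
  have "E \<in> config_event n t i c \<longleftrightarrow> gball E (t + 2) i = S \<and> induced E S = H"
    unfolding config_event_def SH Suc fst_conv snd_conv mem_Collect_eq .
  then show ?thesis unfolding SH prod.inject by blast
qed

lemma small_flip_sum:
  assumes E: "E \<subseteq> all_edges n" and i: "i < n"
  shows "small_flip n K t i E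
    = (\<Sum>c\<in>configs n K t i. flip_prob {..<n} (voters (snd c)) t i * indicator (config_event n t i c) E)"
proof -
  let ?S = "gball E (t + 2) i"
  let ?c = "(?S, induced E ?S)"
  have mem: "?c \<in> configs n K t i \<longleftrightarrow> card ?S \<le> K"
  proof -
    have "induced E ?S \<subseteq> inside ?S" using E by (auto simp: induced_def inside_def all_edges_def)
    then show ?thesis using gball_subset[OF E i] gball_induced[of "t + 2" "t + 2" E i]
      by (simp add: configs_def shapes_def del: gball.simps add_2_eq_Suc')
  qed
  have "(\<Sum>c\<in>configs n K t i. flip_prob {..<n} (voters (snd c)) t i * indicator (config_event n t i c) E)
      = (\<Sum>c\<in>configs n K t i. if c = ?c then flip_prob {..<n} (voters (snd c)) t i else 0)"
    by (rule sum.cong[OF refl]) (simp add: indicator_def config_event_iff[OF E])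
  also have "\<dots> = (if ?c \<in> configs n K t i then flip_prob {..<n} (voters (snd ?c)) t i else 0)"
    by (simp only: sum.delta[OF finite_configs])
  also have "\<dots> = small_flip n K t i E"
    unfolding mem small_flip_def snd_conv flip_prob_induced ..
  finally show ?thesis ..
qed

lemma config_prob:
  assumes p: "0 \<le> p" "p \<le> 1" and c: "(S, H) \<in> configs n K t i"
  shows "measure_pmf.prob (erdos_renyi n p) (config_event n t i (S, H))
    = p ^ card H * (1 - p) ^ ((card S choose 2) + card (gball H (t + 1) i) * (n - card S) - card H)"
proof -
  have S: "S \<subseteq> {..<n}" and H: "H \<subseteq> inside S" "gball H (t + 2) i = S"
    using c by (auto simp: configs_def shapes_def)
  let ?W = "window n (gball H (t + 1) i) S"
  have B: "gball H (t + 1) i \<subseteq> S" using gball_mono[of "t + 1" "t + 2" H i] unfolding H(2) by simp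
  have "H \<subseteq> ?W" using H(1) inside_subset[OF S] by (auto simp: window_def inside_def)
  moreover have "?W \<subseteq> all_edges n" by (auto simp: window_def)
  ultimately show ?thesis
    unfolding config_event_def fst_conv snd_conv
    by (subst erdos_renyi_prob[OF p]) (simp_all only: card_window[OF S B])
qed

text \<open>The contribution of one fixed vertex set of size \<open>k\<close> to the expectation of \<open>small_flip\<close>. By symmetry it
  can be computed for the vertex set \<open>{..<k}\<close> and the centre 0.\<close>

definition shape_weight :: "nat \<Rightarrow> nat \<Rightarrow> real \<Rightarrow> nat \<Rightarrow> real" where
  "shape_weight t n p k = (\<Sum>H\<in>shapes (t + 2) {..<k} 0. flip_prob {..<k} (voters H) t 0 *
    (p ^ card H * (1 - p) ^ ((k choose 2) + card (gball H (t + 1) 0) * (n - k) - card H)))"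

lemma expected_small_flip_sum:
  assumes i: "i < n"
  shows "measure_pmf.expectation (erdos_renyi n p) (small_flip n K t i)
    = (\<Sum>c\<in>configs n K t i. flip_prob {..<n} (voters (snd c)) t i *
        measure_pmf.prob (erdos_renyi n p) (config_event n t i c))"
proof -
  have "measure_pmf.expectation (erdos_renyi n p) (small_flip n K t i)
      = measure_pmf.expectation (erdos_renyi n p)
        (\<lambda>E. \<Sum>c\<in>configs n K t i. flip_prob {..<n} (voters (snd c)) t i * indicator (config_event n t i c) E)"
  proof (rule integral_cong_AE)
    show "AE E in measure_pmf (erdos_renyi n p). small_flip n K t i E
      = (\<Sum>c\<in>configs n K t i. flip_prob {..<n} (voters (snd c)) t i * indicator (config_event n t i c) E)"
      unfolding AE_measure_pmf_iff using small_flip_sum[OF _ i] set_erdos_renyi by blast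
  qed simp_all
  then show ?thesis by simp
qed

lemma shape_weight_eq:
  assumes S: "S \<subseteq> {..<n}" "i \<in> S"
  shows "(\<Sum>H\<in>shapes (t + 2) S i. flip_prob {..<n} (voters H) t i *
      (p ^ card H * (1 - p) ^ ((card S choose 2) + card (gball H (t + 1) i) * (n - card S) - card H)))
    = shape_weight t n p (card S)"
proof -
  let ?k = "card S"
  have fin: "finite S" using S(1) finite_subset by auto
  have k: "0 < ?k" using fin S(2) by (auto simp: card_gt_0_iff)
  obtain f where f: "bij_betw f {..<?k} S" using ex_bij_betw_nat_finite[OF fin] by (auto simp: atLeast0LessThan)
  have "i \<in> f ` {..<?k}" using S(2) unfolding bij_betw_imp_surj_on[OF f] .
  then obtain j where j: "j < ?k" "f j = i" by blast
  define \<pi> where "\<pi> = f \<circ> Transposition.transpose 0 j"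
  have "bij_betw (Transposition.transpose 0 j) {..<?k} {..<?k}"
    using k j(1) by (intro bij_betw_transpose_iff) simp
  then have \<pi>: "bij_betw \<pi> {..<?k} S" unfolding \<pi>_def using f by (rule bij_betw_trans)
  have \<pi>0: "\<pi> 0 = i" by (simp add: \<pi>_def j)
  have inj: "inj_on \<pi> {..<?k}" and im: "\<pi> ` {..<?k} = S" using \<pi> by (auto simp: bij_betw_def)
  note bij = bij_betw_relabel_shapes[OF \<pi> k, of "t + 2", unfolded \<pi>0]
  show ?thesis
    unfolding shape_weight_def
  proof (rule sum.reindex_bij_betw[OF bij, symmetric, THEN trans], rule sum.cong[OF refl])
    fix H assume "H \<in> shapes (t + 2) {..<?k} 0"
    then have H: "H \<subseteq> all_edges ?k" by (simp add: shapes_def inside_lessThan)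
    have 1: "flip_prob {..<n} (voters (relabel \<pi> H)) t i = flip_prob {..<?k} (voters H) t 0"
      using flip_prob_relabel[OF inj H _ _ k, of "{..<n}" t] im S(1) \<pi>0 by simp
    have 2: "card (gball (relabel \<pi> H) (t + 1) i) = card (gball H (t + 1) 0)"
      using gball_relabel[OF inj H k, of "t + 1"] card_image[OF inj_on_subset[OF inj gball_subset[OF H k]]]
      unfolding \<pi>0 by metis
    show "flip_prob {..<n} (voters (relabel \<pi> H)) t i * (p ^ card (relabel \<pi> H) *
        (1 - p) ^ ((?k choose 2) + card (gball (relabel \<pi> H) (t + 1) i) * (n - ?k) - card (relabel \<pi> H)))
      = flip_prob {..<?k} (voters H) t 0 * (p ^ card H *
        (1 - p) ^ ((?k choose 2) + card (gball H (t + 1) 0) * (n - ?k) - card H))"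
      unfolding 1 2 card_relabel[OF inj H] ..
  qed
qed

lemma card_sets_containing:
  assumes "i < n" "k \<ge> 1"
  shows "card {S. S \<subseteq> {..<n} \<and> i \<in> S \<and> card S = k} = (n - 1) choose (k - 1)"
proof -
  have "bij_betw (insert i) {S. S \<subseteq> {..<n} - {i} \<and> card S = k - 1} {S. S \<subseteq> {..<n} \<and> i \<in> S \<and> card S = k}"
  proof (rule bij_betw_byWitness[where f' = "\<lambda>S. S - {i}"])
    show "insert i ` {S. S \<subseteq> {..<n} - {i} \<and> card S = k - 1} \<subseteq> {S. S \<subseteq> {..<n} \<and> i \<in> S \<and> card S = k}"
    proof (intro subsetI, elim imageE CollectE conjE)
      fix T S assume S: "T = insert i S" "S \<subseteq> {..<n} - {i}" "card S = k - 1"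
      then have "finite S" using finite_subset by blast
      then have "card T = k" using S assms(2) by (simp add: card_insert_if subset_Diff_insert)
      then show "T \<in> {S. S \<subseteq> {..<n} \<and> i \<in> S \<and> card S = k}" using S assms(1) by auto
    qed
    show "(\<lambda>S. S - {i}) ` {S. S \<subseteq> {..<n} \<and> i \<in> S \<and> card S = k} \<subseteq> {S. S \<subseteq> {..<n} - {i} \<and> card S = k - 1}"
      by auto
  qed auto
  from bij_betw_same_card[OF this] show ?thesis
    using n_subsets[of "{..<n} - {i}" "k - 1"] assms by simp
qed

text \<open>There are \<open>(n - 1) choose (k - 1)\<close> vertex sets of size \<open>k\<close> that contain \<open>i\<close>. In particular the
  expectation does not depend on \<open>i\<close>.\<close>

lemma expected_small_flip:
  assumes p: "0 \<le> p" "p \<le> 1" and i: "i < n"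
  shows "measure_pmf.expectation (erdos_renyi n p) (small_flip n K t i)
    = (\<Sum>k=1..K. real ((n - 1) choose (k - 1)) * shape_weight t n p k)"
proof -
  let ?Ss = "{S. S \<subseteq> {..<n} \<and> i \<in> S \<and> card S \<le> K}"
  let ?g = "\<lambda>S H. flip_prob {..<n} (voters H) t i *
      (p ^ card H * (1 - p) ^ ((card S choose 2) + card (gball H (t + 1) i) * (n - card S) - card H))"
  have fin: "finite ?Ss" by (rule finite_subset[of _ "Pow {..<n}"]) auto
  have finS: "finite S" if "S \<in> ?Ss" for S using that by (auto intro: finite_subset)
  have "measure_pmf.expectation (erdos_renyi n p) (small_flip n K t i)
      = (\<Sum>(S, H)\<in>configs n K t i. ?g S H)"
    unfolding expected_small_flip_sum[OF i]
  proof (rule sum.cong[OF refl], clarify)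
    fix S H assume c: "(S, H) \<in> configs n K t i"
    show "flip_prob {..<n} (voters (snd (S, H))) t i * measure_pmf.prob (erdos_renyi n p) (config_event n t i (S, H))
      = ?g S H" unfolding config_prob[OF p c] snd_conv ..
  qed
  also have "\<dots> = (\<Sum>S\<in>?Ss. \<Sum>H\<in>shapes (t + 2) S i. ?g S H)"
    unfolding configs_def by (rule sum.Sigma[symmetric, OF fin]) (intro ballI finite_shapes finS)
  also have "\<dots> = (\<Sum>S\<in>?Ss. shape_weight t n p (card S))"
    by (rule sum.cong[OF refl], rule shape_weight_eq) simp_all
  also have "\<dots> = (\<Sum>k=1..K. \<Sum>S\<in>{S \<in> ?Ss. card S = k}. shape_weight t n p (card S))"
  proof (rule sum.group[symmetric, OF fin])
    show "card ` ?Ss \<subseteq> {1..K}"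
    proof
      fix k assume "k \<in> card ` ?Ss"
      then obtain S where S: "S \<in> ?Ss" "k = card S" by blast
      then have "card S \<noteq> 0" using finS[OF S(1)] by auto
      then show "k \<in> {1..K}" using S by simp
    qed
  qed simp
  also have "\<dots> = (\<Sum>k=1..K. real ((n - 1) choose (k - 1)) * shape_weight t n p k)"
  proof (rule sum.cong[OF refl])
    fix k assume k: "k \<in> {1..K}"
    then have "{S \<in> ?Ss. card S = k} = {S. S \<subseteq> {..<n} \<and> i \<in> S \<and> card S = k}" by auto
    then have "card {S \<in> ?Ss. card S = k} = (n - 1) choose (k - 1)"
      using card_sets_containing[OF i] k by simp
    moreover have "(\<Sum>S\<in>{S \<in> ?Ss. card S = k}. shape_weight t n p (card S))
        = (\<Sum>S\<in>{S \<in> ?Ss. card S = k}. shape_weight t n p k)" by (rule sum.cong) auto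
    ultimately show "(\<Sum>S\<in>{S \<in> ?Ss. card S = k}. shape_weight t n p (card S))
      = real ((n - 1) choose (k - 1)) * shape_weight t n p k" by simp
  qed
  finally show ?thesis .
qed

section \<open>Convergence and concentration in the Erdos--Renyi graph\<close>

text \<open>A connected graph with \<open>k\<close> vertices has at least \<open>k - 1\<close> edges: each point that enters the ball when the
  radius grows brings an edge of its own.\<close>

lemma card_gball_le_edges:
  assumes H: "H \<subseteq> all_edges k"
  shows "card (gball H r i) \<le> card H + 1"
proof -
  have finH: "finite H" by (rule finite_subset[OF H]) simp
  let ?in = "\<lambda>r. {e \<in> H. e \<subseteq> gball H r i}"
  have "card (gball H r i) \<le> card (?in r) + 1"
  proof (induction r)
    case (Suc r)
    let ?S = "gball H r i" and ?S' = "gball H (Suc r) i"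
    have sub: "?S \<subseteq> ?S'" by (rule gball_Suc_mono)
    have "\<forall>v\<in>?S' - ?S. \<exists>u. u \<in> ?S \<and> {u, v} \<in> H" by auto
    from bchoice[OF this] obtain f where f: "f v \<in> ?S" "{f v, v} \<in> H" if "v \<in> ?S' - ?S" for v
      by blast
    have "card (?S' - ?S) \<le> card (?in (Suc r) - ?in r)"
    proof (rule card_inj_on_le)
      show "inj_on (\<lambda>v. {f v, v}) (?S' - ?S)"
      proof (rule inj_onI)
        fix v w assume "v \<in> ?S' - ?S" "w \<in> ?S' - ?S" "{f v, v} = {f w, w}"
        then show "v = w" using f(1)[of v] f(1)[of w] unfolding doubleton_eq_iff by blast
      qed
      show "(\<lambda>v. {f v, v}) ` (?S' - ?S) \<subseteq> ?in (Suc r) - ?in r"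
      proof (rule image_subsetI)
        fix v assume v: "v \<in> ?S' - ?S"
        then show "{f v, v} \<in> ?in (Suc r) - ?in r" using f[OF v] sub by blast
      qed
    qed (use finH in simp)
    moreover have "card ?S' = card ?S + card (?S' - ?S)"
      using card_Diff_subset[OF finite_gball[OF H] sub] card_mono[OF finite_gball[OF H] sub] by linarith
    moreover have "card (?in (Suc r)) = card (?in r) + card (?in (Suc r) - ?in r)"
    proof -
      have mono: "?in r \<subseteq> ?in (Suc r)" using sub by blast
      have fin: "finite (?in r)" "finite (?in (Suc r))" using finH by simp_all
      show ?thesis
        using card_Diff_subset[OF fin(1) mono] card_mono[OF fin(2) mono] by linarith
    qed
    ultimately show ?case using Suc by linarith
  qed simp
  also have "card (?in r) \<le> card H" by (rule card_mono[OF finH]) auto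
  finally show ?thesis by simp
qed

lemma over_n_tendsto_0: "(\<lambda>n. d / real n) \<longlonglongrightarrow> 0"
  by (rule lim_const_over_n)

lemma binomial_scaled_tendsto:
  "(\<lambda>n. real ((n - 1) choose j) * (d / real n) ^ j) \<longlonglongrightarrow> d ^ j / fact j"
proof -
  have "(\<lambda>n. (real (n - 1) - real i) * (d / real n)) \<longlonglongrightarrow> d" for i
  proof (rule Lim_transform_eventually)
    show "\<forall>\<^sub>F n in sequentially. d - (1 + real i) * (d / real n) = (real (n - 1) - real i) * (d / real n)"
      using eventually_gt_at_top[of 0] by eventually_elim (simp add: of_nat_diff field_simps)
    show "(\<lambda>n. d - (1 + real i) * (d / real n)) \<longlonglongrightarrow> d"
      by (rule tendsto_eq_intros over_n_tendsto_0 refl)+ simp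
  qed
  then have "(\<lambda>n. (\<Prod>i=0..<j. (real (n - 1) - real i) * (d / real n)) / fact j) \<longlonglongrightarrow> (\<Prod>i=0..<j. d) / fact j"
    by (intro tendsto_divide tendsto_prod tendsto_const) auto
  then show ?thesis
    unfolding binomial_gbinomial gbinomial_prod_rev prod.distrib by simp
qed

lemma one_minus_power_tendsto:
  "(\<lambda>n. (1 - d / real n) ^ (n - k)) \<longlonglongrightarrow> exp (- d)"
proof (rule Lim_transform_eventually)
  have "(\<lambda>n. (1 + (- d) / real n) ^ n / (1 - d / real n) ^ k) \<longlonglongrightarrow> exp (- d) / (1 - 0) ^ k"
    by (intro tendsto_divide tendsto_exp_limit_sequentially tendsto_power tendsto_diff tendsto_const
        over_n_tendsto_0) simp
  then show "(\<lambda>n. (1 + (- d) / real n) ^ n / (1 - d / real n) ^ k) \<longlonglongrightarrow> exp (- d)" by simp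
  have "\<forall>\<^sub>F n in sequentially. d / real n < 1"
    using over_n_tendsto_0 by (rule order_tendstoD) simp
  then show "\<forall>\<^sub>F n in sequentially. (1 + (- d) / real n) ^ n / (1 - d / real n) ^ k = (1 - d / real n) ^ (n - k)"
    using eventually_ge_at_top[of k]
  proof eventually_elim
    case (elim n)
    then have "1 - d / real n \<noteq> 0" by linarith
    from power_diff[OF this elim(2)] show ?case by simp
  qed
qed

lemma shape_weight_converges:
  assumes k: "k \<ge> 1"
  shows "\<exists>l. (\<lambda>n. real ((n - 1) choose (k - 1)) * shape_weight t n (d / real n) k) \<longlonglongrightarrow> l"
proof -
  let ?p = "\<lambda>n. d / real n"
  let ?m = "\<lambda>H. card (gball H (t + 1) 0)"
  let ?g = "\<lambda>H n. flip_prob {..<k} (voters H) t 0 * ((real ((n - 1) choose (k - 1)) * ?p n ^ (k - 1))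
      * ?p n ^ (card H - (k - 1)) * ((1 - ?p n) ^ ((k choose 2) - card H) * ((1 - ?p n) ^ (n - k)) ^ ?m H))"
  have conv: "?g H \<longlonglongrightarrow> flip_prob {..<k} (voters H) t 0 * ((d ^ (k - 1) / fact (k - 1))
      * 0 ^ (card H - (k - 1)) * ((1 - 0) ^ ((k choose 2) - card H) * exp (- d) ^ ?m H))" for H
    by (intro tendsto_mult tendsto_const tendsto_power tendsto_diff binomial_scaled_tendsto
        one_minus_power_tendsto over_n_tendsto_0)
  \<comment> \<open>The factor \<open>p ^ (k - 1)\<close> compensates the binomial coefficient. The remaining power of \<open>p\<close> has a
    non-negative exponent, which is 0 exactly for trees.\<close>
  have eq: "real ((n - 1) choose (k - 1)) * shape_weight t n (?p n) k
      = (\<Sum>H\<in>shapes (t + 2) {..<k} 0. ?g H n)" for n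
    unfolding shape_weight_def sum_distrib_left
  proof (rule sum.cong[OF refl])
    fix H assume "H \<in> shapes (t + 2) {..<k} 0"
    then have H: "H \<subseteq> all_edges k" "gball H (t + 2) 0 = {..<k}"
      by (simp_all add: shapes_def inside_lessThan)
    have lo: "k - 1 \<le> card H" using card_gball_le_edges[OF H(1), of "t + 2" 0] unfolding H(2) by simp
    have hi: "card H \<le> k choose 2"
      using card_mono[OF finite_all_edges H(1)] card_inside[of "{..<k}"] by (simp add: inside_lessThan)
    have "?p n ^ card H = ?p n ^ (k - 1) * ?p n ^ (card H - (k - 1))"
      using lo by (simp only: power_add[symmetric] le_add_diff_inverse)
    moreover have "(1 - ?p n) ^ ((k choose 2) + ?m H * (n - k) - card H)
        = (1 - ?p n) ^ ((k choose 2) - card H) * ((1 - ?p n) ^ (n - k)) ^ ?m H"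
    proof -
      have "(k choose 2) + ?m H * (n - k) - card H = ((k choose 2) - card H) + (n - k) * ?m H"
        using hi by (simp only: mult.commute[of "?m H"] Nat.add_diff_assoc2)
      then show ?thesis by (simp only: power_add power_mult)
    qed
    ultimately show "real ((n - 1) choose (k - 1)) * (flip_prob {..<k} (voters H) t 0 *
        (?p n ^ card H * (1 - ?p n) ^ ((k choose 2) + ?m H * (n - k) - card H))) = ?g H n"
      by (simp only: mult.assoc mult.left_commute)
  qed
  show ?thesis unfolding eq by (rule exI, rule tendsto_sum, rule conv)
qed

subsection \<open>Second moment\<close>

text \<open>Two disjoint balls are explored almost independently: the two windows share only pairs that join one
  ball to the other, of which there are at most \<open>K * K\<close>, and each of these costs at most one factor
  \<open>1 - p\<close>.\<close>

lemma config_pair_prob: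
  assumes p: "0 \<le> p" "p < 1"
    and c: "(S, H) \<in> configs n K t i" and c': "(S', H') \<in> configs n K t j" and disj: "S \<inter> S' = {}"
  shows "measure_pmf.prob (erdos_renyi n p) (config_event n t i (S, H) \<inter> config_event n t j (S', H'))
      * (1 - p) ^ (K * K)
    \<le> measure_pmf.prob (erdos_renyi n p) (config_event n t i (S, H))
      * measure_pmf.prob (erdos_renyi n p) (config_event n t j (S', H'))"
proof -
  have p': "0 \<le> p" "p \<le> 1" using p by auto
  let ?B = "gball H (t + 1) i" and ?B' = "gball H' (t + 1) j"
  let ?W = "window n ?B S" and ?W' = "window n ?B' S'"
  have S: "S \<subseteq> {..<n}" "card S \<le> K" and H: "H \<subseteq> inside S" "gball H (t + 2) i = S"
    using c unfolding configs_def shapes_def by blast+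
  have S': "S' \<subseteq> {..<n}" "card S' \<le> K" and H': "H' \<subseteq> inside S'" "gball H' (t + 2) j = S'"
    using c' unfolding configs_def shapes_def by blast+
  have fin: "finite S" "finite S'" using S(1) S'(1) by (auto intro: finite_subset)
  have B: "?B \<subseteq> S" using gball_mono[of "t + 1" "t + 2" H i] unfolding H(2) by simp
  have B': "?B' \<subseteq> S'" using gball_mono[of "t + 1" "t + 2" H' j] unfolding H'(2) by simp
  have in_window: "inside T \<subseteq> window n A T" if "T \<subseteq> {..<n}" for T A
    using inside_subset[OF that] by (auto simp: window_def inside_def)
  have HW: "H \<subseteq> ?W" "H' \<subseteq> ?W'"
    by (rule subset_trans[OF H(1) in_window[OF S(1)]], rule subset_trans[OF H'(1) in_window[OF S'(1)]])
  have W: "?W \<subseteq> all_edges n" "?W' \<subseteq> all_edges n" unfolding window_def by blast+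
  have finW: "finite ?W" "finite ?W'" by (rule finite_subset[OF W(1)], simp, rule finite_subset[OF W(2)], simp)
  have finH: "finite H" "finite H'" by (rule finite_subset[OF HW(1) finW(1)], rule finite_subset[OF HW(2) finW(2)])
  have HH: "H \<inter> H' = {}"
  proof -
    have "False" if "e \<in> H" "e \<in> H'" for e
    proof -
      have "e \<subseteq> S \<inter> S'" "card e = 2" using that H(1) H'(1) unfolding inside_def by blast+
      then show False using disj by simp
    qed
    then show ?thesis by blast
  qed
  have overlap: "card (?W \<inter> ?W') \<le> K * K"
  proof -
    have "?W \<inter> ?W' \<subseteq> (\<lambda>(x, y). {x, y}) ` (S \<times> S')"
    proof
      fix e assume e: "e \<in> ?W \<inter> ?W'"
      then have "e \<in> all_edges n" using W by blast
      then obtain a b where ab: "e = {a, b}" using edge_obtain[OF order_refl] by metis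
      have "e \<subseteq> S \<or> e \<inter> ?B \<noteq> {}" "e \<subseteq> S' \<or> e \<inter> ?B' \<noteq> {}"
        using e unfolding window_def by blast+
      then have "e \<inter> S \<noteq> {}" "e \<inter> S' \<noteq> {}" using ab B B' by blast+
      then obtain x y where xy: "x \<in> e" "x \<in> S" "y \<in> e" "y \<in> S'" by blast
      then have "x \<noteq> y" using disj by blast
      then have "e = {x, y}" using xy ab by auto
      then show "e \<in> (\<lambda>(x, y). {x, y}) ` (S \<times> S')" using xy by blast
    qed
    then have "card (?W \<inter> ?W') \<le> card ((\<lambda>(x, y). {x, y}) ` (S \<times> S'))"
      using fin by (intro card_mono) auto
    also have "\<dots> \<le> card (S \<times> S')" using fin by (intro card_image_le) auto
    also have "\<dots> \<le> K * K" using S(2) S'(2) by (simp add: card_cartesian_product mult_le_mono)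
    finally show ?thesis .
  qed
  have "measure_pmf.prob (erdos_renyi n p) (config_event n t i (S, H) \<inter> config_event n t j (S', H'))
      \<le> measure_pmf.prob (erdos_renyi n p) {E. E \<inter> (?W \<union> ?W') = H \<union> H'}"
    by (rule measure_pmf.finite_measure_mono) (auto simp: config_event_def)
  also have "\<dots> = p ^ (card H + card H') * (1 - p) ^ (card (?W \<union> ?W') - (card H + card H'))"
    unfolding card_Un_disjoint[OF finH HH, symmetric]
    by (rule erdos_renyi_prob[OF p' Un_least[OF W] Un_mono[OF HW]])
  finally have "measure_pmf.prob (erdos_renyi n p) (config_event n t i (S, H) \<inter> config_event n t j (S', H'))
      * (1 - p) ^ (K * K)
    \<le> p ^ (card H + card H') * (1 - p) ^ (card (?W \<union> ?W') - (card H + card H')) * (1 - p) ^ (K * K)"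
    using p by (intro mult_right_mono) auto
  also have "\<dots> = p ^ (card H + card H') * (1 - p) ^ (card (?W \<union> ?W') - (card H + card H') + K * K)"
    by (simp only: mult.assoc power_add)
  also have "\<dots> \<le> p ^ (card H + card H') * (1 - p) ^ ((card ?W - card H) + (card ?W' - card H'))"
  proof (intro mult_left_mono power_decreasing)
    have "card ?W + card ?W' = card (?W \<union> ?W') + card (?W \<inter> ?W')"
      by (rule card_Un_Int[OF finW])
    then show "(card ?W - card H) + (card ?W' - card H') \<le> card (?W \<union> ?W') - (card H + card H') + K * K"
      using overlap card_mono[OF finW(1) HW(1)] card_mono[OF finW(2) HW(2)] by linarith
  qed (use p in auto)
  also have "\<dots> = (p ^ card H * (1 - p) ^ (card ?W - card H)) * (p ^ card H' * (1 - p) ^ (card ?W' - card H'))"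
    by (simp add: power_add)
  also have "\<dots> = measure_pmf.prob (erdos_renyi n p) (config_event n t i (S, H))
      * measure_pmf.prob (erdos_renyi n p) (config_event n t j (S', H'))"
    unfolding config_event_def fst_conv snd_conv
    by (simp only: erdos_renyi_prob[OF p' W(1) HW(1)] erdos_renyi_prob[OF p' W(2) HW(2)])
  finally show ?thesis .
qed

lemma small_flip_correlation:
  assumes p: "0 \<le> p" "p < 1" and i: "i < n" and j: "j < n"
  shows "measure_pmf.expectation (erdos_renyi n p) (\<lambda>E. if gball E (t + 2) i \<inter> gball E (t + 2) j = {}
        then small_flip n K t i E * small_flip n K t j E else 0) * (1 - p) ^ (K * K)
    \<le> measure_pmf.expectation (erdos_renyi n p) (small_flip n K t i)
      * measure_pmf.expectation (erdos_renyi n p) (small_flip n K t j)"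
proof -
  let ?P = "measure_pmf.prob (erdos_renyi n p)"
  let ?f = "\<lambda>c. flip_prob {..<n} (voters (snd c)) t i" and ?g = "\<lambda>c. flip_prob {..<n} (voters (snd c)) t j"
  let ?A = "config_event n t i" and ?B = "config_event n t j"
  let ?C = "configs n K t i" and ?D = "configs n K t j"
  let ?\<delta> = "\<lambda>c c'. if fst c \<inter> fst c' = {} then 1 else 0 :: real"
  have point: "(if gball E (t + 2) i \<inter> gball E (t + 2) j = {}
        then small_flip n K t i E * small_flip n K t j E else 0)
      = (\<Sum>c\<in>?C. \<Sum>c'\<in>?D. ?\<delta> c c' * (?f c * ?g c') * indicator (?A c \<inter> ?B c') E)"
    if E: "E \<subseteq> all_edges n" for E
  proof -
    let ?\<delta>E = "if gball E (t + 2) i \<inter> gball E (t + 2) j = {} then 1 else 0 :: real"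
    have "(if gball E (t + 2) i \<inter> gball E (t + 2) j = {}
        then small_flip n K t i E * small_flip n K t j E else 0)
      = ?\<delta>E * (small_flip n K t i E * small_flip n K t j E)" by simp
    also have "\<dots> = (\<Sum>c\<in>?C. \<Sum>c'\<in>?D. ?\<delta>E * ((?f c * indicator (?A c) E) * (?g c' * indicator (?B c') E)))"
      unfolding small_flip_sum[OF E i] small_flip_sum[OF E j] unfolding sum_product unfolding sum_distrib_left ..
    also have "\<dots> = (\<Sum>c\<in>?C. \<Sum>c'\<in>?D. ?\<delta> c c' * (?f c * ?g c') * indicator (?A c \<inter> ?B c') E)"
    proof (intro sum.cong refl)
      fix c c' assume c: "c \<in> ?C" "c' \<in> ?D"
      show "?\<delta>E * ((?f c * indicator (?A c) E) * (?g c' * indicator (?B c') E))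
          = ?\<delta> c c' * (?f c * ?g c') * indicator (?A c \<inter> ?B c') E"
      proof (cases "E \<in> ?A c \<and> E \<in> ?B c'")
        case True
        then have "fst c = gball E (t + 2) i" "fst c' = gball E (t + 2) j"
          unfolding config_event_iff[OF E c(1)] config_event_iff[OF E c(2)] by simp_all
        then show ?thesis using True by simp
      next
        case False
        then show ?thesis by (auto simp: indicator_def)
      qed
    qed
    finally show ?thesis .
  qed
  have "measure_pmf.expectation (erdos_renyi n p) (\<lambda>E. if gball E (t + 2) i \<inter> gball E (t + 2) j = {}
        then small_flip n K t i E * small_flip n K t j E else 0)
      = measure_pmf.expectation (erdos_renyi n p)
        (\<lambda>E. \<Sum>c\<in>?C. \<Sum>c'\<in>?D. ?\<delta> c c' * (?f c * ?g c') * indicator (?A c \<inter> ?B c') E)"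
  proof (rule integral_cong_AE)
    show "AE E in measure_pmf (erdos_renyi n p). (if gball E (t + 2) i \<inter> gball E (t + 2) j = {}
        then small_flip n K t i E * small_flip n K t j E else 0)
      = (\<Sum>c\<in>?C. \<Sum>c'\<in>?D. ?\<delta> c c' * (?f c * ?g c') * indicator (?A c \<inter> ?B c') E)"
      unfolding AE_measure_pmf_iff using point set_erdos_renyi by blast
  qed simp_all
  also have "\<dots> = (\<Sum>c\<in>?C. \<Sum>c'\<in>?D. ?\<delta> c c' * (?f c * ?g c') * ?P (?A c \<inter> ?B c'))"
    by simp
  finally have "measure_pmf.expectation (erdos_renyi n p) (\<lambda>E. if gball E (t + 2) i \<inter> gball E (t + 2) j = {}
        then small_flip n K t i E * small_flip n K t j E else 0) * (1 - p) ^ (K * K)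
      = (\<Sum>c\<in>?C. \<Sum>c'\<in>?D. (?f c * ?g c') * (?\<delta> c c' * (?P (?A c \<inter> ?B c') * (1 - p) ^ (K * K))))"
    by (simp only: sum_distrib_right mult.assoc mult.left_commute)
  also have "\<dots> \<le> (\<Sum>c\<in>?C. \<Sum>c'\<in>?D. (?f c * ?g c') * (?P (?A c) * ?P (?B c')))"
  proof (intro sum_mono mult_left_mono)
    fix c c' assume c: "c \<in> ?C" "c' \<in> ?D"
    show "?\<delta> c c' * (?P (?A c \<inter> ?B c') * (1 - p) ^ (K * K)) \<le> ?P (?A c) * ?P (?B c')"
      using config_pair_prob[OF p, of "fst c" "snd c" n K t i "fst c'" "snd c'" j] c by simp
  qed (simp add: flip_prob_bounds)
  also have "\<dots> = (\<Sum>c\<in>?C. ?f c * ?P (?A c)) * (\<Sum>c'\<in>?D. ?g c' * ?P (?B c'))"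
    by (simp only: sum_product mult.assoc mult.left_commute)
  finally show ?thesis
    unfolding expected_small_flip_sum[OF i] expected_small_flip_sum[OF j] .
qed

lemma prob_large_ball:
  assumes p: "0 \<le> p" "p \<le> 1" and d: "d = real n * p" and i: "i < n" and K: "K > 0"
  shows "measure_pmf.prob (erdos_renyi n p) {E. card (gball E R i) > K} \<le> (\<Sum>k\<le>R. d ^ k) / K"
proof -
  have "measure_pmf.prob (erdos_renyi n p) {E. card (gball E R i) > K}
      \<le> measure_pmf.expectation (erdos_renyi n p) (\<lambda>E. real (card (gball E R i))) / K"
    by (rule markov_prob) (use K in auto)
  also have "\<dots> \<le> (\<Sum>k\<le>R. d ^ k) / K"
    by (intro divide_right_mono expected_card_gball[OF p d i]) simp
  finally show ?thesis .
qed

text \<open>The common expectation of \<open>small_flip n K t i\<close> for all vertices \<open>i\<close>.\<close>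

definition truncated_mean :: "nat \<Rightarrow> nat \<Rightarrow> nat \<Rightarrow> real \<Rightarrow> real" where
  "truncated_mean t K n p = (\<Sum>k=1..K. real ((n - 1) choose (k - 1)) * shape_weight t n p k)"

lemma small_flip_bounds: "0 \<le> small_flip n K t i E" "small_flip n K t i E \<le> 1"
  by (auto simp: small_flip_def flip_prob_bounds)

lemma expected_mean_flip_bounds:
  assumes p: "0 \<le> p" "p \<le> 1" and d: "d = real n * p" and n: "n > 0" and K: "K > 0"
  shows "truncated_mean t K n p \<le> measure_pmf.expectation (erdos_renyi n p) (mean_flip n t)"
    and "measure_pmf.expectation (erdos_renyi n p) (mean_flip n t) \<le> truncated_mean t K n p + (\<Sum>k\<le>t + 2. d ^ k) / K"
proof -
  let ?E = "measure_pmf.expectation (erdos_renyi n p)"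
  let ?\<phi> = "\<lambda>i E. flip_prob {..<n} (voters E) t i"
  have mean: "?E (mean_flip n t) = (\<Sum>i<n. ?E (?\<phi> i)) / n"
    unfolding mean_flip_def by simp
  have lo: "truncated_mean t K n p \<le> ?E (?\<phi> i)" if "i < n" for i
    unfolding truncated_mean_def expected_small_flip[OF p that, symmetric]
    by (rule integral_mono) (auto simp: small_flip_def flip_prob_bounds)
  have hi: "?E (?\<phi> i) \<le> truncated_mean t K n p + (\<Sum>k\<le>t + 2. d ^ k) / K" if "i < n" for i
  proof -
    have "?E (?\<phi> i) \<le> ?E (\<lambda>E. small_flip n K t i E + indicator {E. card (gball E (t + 2) i) > K} E)"
      by (rule integral_mono) (auto simp: small_flip_def flip_prob_bounds)
    also have "\<dots> = truncated_mean t K n p + measure_pmf.prob (erdos_renyi n p) {E. card (gball E (t + 2) i) > K}"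
      unfolding truncated_mean_def expected_small_flip[OF p that, symmetric] by simp
    also have "\<dots> \<le> truncated_mean t K n p + (\<Sum>k\<le>t + 2. d ^ k) / K"
      by (intro add_left_mono prob_large_ball p d that K)
    finally show ?thesis .
  qed
  have "(\<Sum>i<n. truncated_mean t K n p) \<le> (\<Sum>i<n. ?E (?\<phi> i))"
    by (intro sum_mono lo) simp
  then show "truncated_mean t K n p \<le> ?E (mean_flip n t)"
    unfolding mean using n by (simp add: pos_le_divide_eq mult.commute)
  have "(\<Sum>i<n. ?E (?\<phi> i)) \<le> (\<Sum>i<n. truncated_mean t K n p + (\<Sum>k\<le>t + 2. d ^ k) / K)"
    by (intro sum_mono hi) simp
  then show "?E (mean_flip n t) \<le> truncated_mean t K n p + (\<Sum>k\<le>t + 2. d ^ k) / K"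
    unfolding mean using n by (simp only: sum_constant card_lessThan) (simp add: pos_divide_le_eq mult.commute)
qed

text \<open>The terms on the right account for pairs of vertices with small disjoint balls, for pairs whose balls
  meet, and for pairs in which one of the balls has more than \<open>K\<close> vertices.\<close>

lemma expected_mean_flip_square:
  assumes p: "0 \<le> p" "p < 1" and d: "d = real n * p" and n: "n > 0" and K: "K > 0"
  shows "measure_pmf.expectation (erdos_renyi n p) (\<lambda>E. (mean_flip n t E)\<^sup>2)
    \<le> (truncated_mean t K n p)\<^sup>2 / (1 - p) ^ (K * K) + (\<Sum>k\<le>2 * (t + 2). d ^ k) / n + 2 * ((\<Sum>k\<le>t + 2. d ^ k) / K)"
proof -
  let ?E = "measure_pmf.expectation (erdos_renyi n p)"
  let ?\<phi> = "\<lambda>i E. flip_prob {..<n} (voters E) t i"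
  let ?R = "t + 2"
  let ?s = "\<lambda>i j E. if gball E ?R i \<inter> gball E ?R j = {} then small_flip n K t i E * small_flip n K t j E else 0"
  let ?large = "\<lambda>i. {E. card (gball E ?R i) > K}"
  \<comment> \<open>Two balls of radius \<open>t + 2\<close> that meet have centres at distance at most \<open>r\<close>.\<close>
  define r where "r = 2 * ?R"
  let ?meet = "\<lambda>i j E. indicator (gball E r i) j :: real"
  let ?\<alpha> = "(truncated_mean t K n p)\<^sup>2 / (1 - p) ^ (K * K)" and ?\<eta> = "(\<Sum>k\<le>?R. d ^ k) / K"
    and ?D = "\<Sum>k\<le>r. d ^ k"
  have p': "p \<le> 1" using p by simp
  have pair: "?\<phi> i E * ?\<phi> j E \<le> ?s i j E + ?meet i j E + indicator (?large i) E + indicator (?large j) E" for i j E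
  proof -
    have b: "0 \<le> ?\<phi> i E * ?\<phi> j E" "?\<phi> i E * ?\<phi> j E \<le> 1"
      by (simp_all add: flip_prob_bounds mult_le_one)
    have s: "0 \<le> ?s i j E" by (simp add: small_flip_bounds del: gball.simps)
    have ind: "0 \<le> ?meet i j E" "0 \<le> (indicator (?large i) E :: real)" "0 \<le> (indicator (?large j) E :: real)"
      by (rule indicator_pos_le)+
    consider "E \<in> ?large i" | "E \<in> ?large j" | "gball E ?R i \<inter> gball E ?R j \<noteq> {}"
      | "E \<notin> ?large i" "E \<notin> ?large j" "gball E ?R i \<inter> gball E ?R j = {}" by blast
    then show ?thesis
    proof cases
      case 1
      then have "indicator (?large i) E = (1 :: real)" by simp
      then show ?thesis using b s ind by linarith
    next
      case 2
      then have "indicator (?large j) E = (1 :: real)" by simp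
      then show ?thesis using b s ind by linarith
    next
      case 3
      from gball_meet[OF this] have "?meet i j E = 1" by (simp add: r_def del: gball.simps)
      then show ?thesis using b s ind by linarith
    next
      case 4
      then have "?s i j E = ?\<phi> i E * ?\<phi> j E" by (simp add: small_flip_def del: gball.simps add_2_eq_Suc')
      then show ?thesis using ind by linarith
    qed
  qed
  have linear: "?E (\<lambda>E. f E + g E + indicator A E + indicator B E)
      = ?E f + ?E g + measure_pmf.prob (erdos_renyi n p) A + measure_pmf.prob (erdos_renyi n p) B" for f g A B
    by simp
  have pairs: "(\<Sum>i<n. \<Sum>j<n. ?E (\<lambda>E. ?\<phi> i E * ?\<phi> j E))
      \<le> (\<Sum>i<n. \<Sum>j<n. ?\<alpha> + ?E (?meet i j) + ?\<eta> + ?\<eta>)"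
  proof (intro sum_mono)
    fix i j assume "i \<in> {..<n}" "j \<in> {..<n}"
    then have i: "i < n" and j: "j < n" by auto
    have "?E (\<lambda>E. ?\<phi> i E * ?\<phi> j E)
        \<le> ?E (\<lambda>E. ?s i j E + ?meet i j E + indicator (?large i) E + indicator (?large j) E)"
      by (rule integral_mono[OF integrable_erdos_renyi integrable_erdos_renyi pair])
    also have "\<dots> = ?E (?s i j) + ?E (?meet i j) + measure_pmf.prob (erdos_renyi n p) (?large i)
        + measure_pmf.prob (erdos_renyi n p) (?large j)" by (rule linear)
    also have "\<dots> \<le> ?\<alpha> + ?E (?meet i j) + ?\<eta> + ?\<eta>"
    proof (intro add_mono order_refl)
      show "?E (?s i j) \<le> ?\<alpha>"
      proof (rule pos_le_divide_eq[THEN iffD2])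
        show "?E (?s i j) * (1 - p) ^ (K * K) \<le> (truncated_mean t K n p)\<^sup>2"
          using small_flip_correlation[OF p i j, of t K]
          unfolding expected_small_flip[OF p(1) p' i] expected_small_flip[OF p(1) p' j]
            truncated_mean_def[symmetric] power2_eq_square .
      qed (use p in simp)
    qed (rule prob_large_ball[OF p(1) p' d i K] prob_large_ball[OF p(1) p' d j K])+
    finally show "?E (\<lambda>E. ?\<phi> i E * ?\<phi> j E) \<le> ?\<alpha> + ?E (?meet i j) + ?\<eta> + ?\<eta>" .
  qed
  have swap: "(\<Sum>i<n. \<Sum>j<n. ?E (f i j)) = ?E (\<lambda>E. \<Sum>i<n. \<Sum>j<n. f i j E)"
    for f :: "nat \<Rightarrow> nat \<Rightarrow> nat set set \<Rightarrow> real" by simp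
  have "(\<Sum>i<n. \<Sum>j<n. ?E (?meet i j)) = ?E (\<lambda>E. \<Sum>i<n. \<Sum>j<n. ?meet i j E)"
    by (rule swap)
  also have "\<dots> = ?E (ball_pairs n r)"
  proof (rule integral_cong_AE)
    have "(\<Sum>i<n. \<Sum>j<n. ?meet i j E) = ball_pairs n r E" if E: "E \<subseteq> all_edges n" for E
      unfolding ball_pairs_def
    proof (rule sum.cong[OF refl])
      fix i assume "i \<in> {..<n}"
      then have "{..<n} \<inter> gball E r i = gball E r i" using gball_subset[OF E, of i] by blast
      then show "(\<Sum>j<n. ?meet i j E) = real (card (gball E r i))"
        by (simp add: indicator_def sum.If_cases)
    qed
    then show "AE E in measure_pmf (erdos_renyi n p). (\<Sum>i<n. \<Sum>j<n. ?meet i j E) = ball_pairs n r E"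
      unfolding AE_measure_pmf_iff using set_erdos_renyi by blast
  qed simp_all
  also have "\<dots> \<le> ?D * n" by (rule expected_ball_pairs[OF p(1) p' d])
  finally have meets: "(\<Sum>i<n. \<Sum>j<n. ?E (?meet i j)) \<le> ?D * n" .
  have expand: "(\<Sum>i<n. \<Sum>j<n. x + f i j + y + y) = (real n)\<^sup>2 * (x + 2 * y) + (\<Sum>i<n. \<Sum>j<n. f i j)"
    for x y and f :: "nat \<Rightarrow> nat \<Rightarrow> real"
    by (simp add: sum.distrib power2_eq_square algebra_simps)
  have "?E (\<lambda>E. (mean_flip n t E)\<^sup>2) = ?E (\<lambda>E. (\<Sum>i<n. \<Sum>j<n. ?\<phi> i E * ?\<phi> j E) / (real n)\<^sup>2)"
    by (simp add: mean_flip_def power_divide power2_eq_square sum_product)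
  also have "\<dots> = (\<Sum>i<n. \<Sum>j<n. ?E (\<lambda>E. ?\<phi> i E * ?\<phi> j E)) / (real n)\<^sup>2" by simp
  also have "\<dots> \<le> ((real n)\<^sup>2 * (?\<alpha> + 2 * ?\<eta>) + ?D * n) / (real n)\<^sup>2"
  proof (rule divide_right_mono)
    have "(\<Sum>i<n. \<Sum>j<n. ?\<alpha> + ?E (?meet i j) + ?\<eta> + ?\<eta>)
        = (real n)\<^sup>2 * (?\<alpha> + 2 * ?\<eta>) + (\<Sum>i<n. \<Sum>j<n. ?E (?meet i j))" by (rule expand)
    then show "(\<Sum>i<n. \<Sum>j<n. ?E (\<lambda>E. ?\<phi> i E * ?\<phi> j E)) \<le> (real n)\<^sup>2 * (?\<alpha> + 2 * ?\<eta>) + ?D * n"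
      using pairs meets by linarith
  qed simp
  also have "\<dots> = ?\<alpha> + ?D / n + 2 * ?\<eta>"
  proof -
    have "((real n)\<^sup>2 * x + y * n) / (real n)\<^sup>2 = x + y / n" for x y :: real
      using n by (simp add: add_divide_distrib power2_eq_square)
    then show ?thesis by simp
  qed
  finally show ?thesis unfolding r_def .
qed

text \<open>Here \<open>u\<close> and \<open>v\<close> stand for a first and a second moment and \<open>\<alpha> K\<close> for the truncated first moment, which
  is a convergent sequence with uniform error \<open>C / K\<close>. Then \<open>u\<close> has a limit \<open>a\<close>, and the mean square
  distance \<open>v - 2 * a * u + a\<^sup>2\<close> from \<open>a\<close> becomes arbitrarily small.\<close>

lemma truncated_limit:
  fixes u v :: "nat \<Rightarrow> real" and \<alpha> \<rho> :: "nat \<Rightarrow> nat \<Rightarrow> real"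
  assumes conv: "\<And>K. K > 0 \<Longrightarrow> convergent (\<alpha> K)" and \<rho>: "\<And>K. K > 0 \<Longrightarrow> \<rho> K \<longlonglongrightarrow> 1"
    and lo: "\<And>K. K > 0 \<Longrightarrow> \<forall>\<^sub>F n in sequentially. 0 \<le> \<alpha> K n \<and> \<alpha> K n \<le> u n \<and> u n \<le> \<alpha> K n + C / K"
    and v: "\<And>K. K > 0 \<Longrightarrow> \<forall>\<^sub>F n in sequentially. v n \<le> (\<alpha> K n)\<^sup>2 / \<rho> K n + D / n + 2 * (C / K)"
  shows "\<exists>a. \<forall>e>0. \<forall>\<^sub>F n in sequentially. v n - 2 * a * u n + a\<^sup>2 < e"
proof -
  have large: "\<exists>K>0. C / real K < e" if "e > 0" for e
  proof -
    obtain K :: nat where K: "real K > C / e" "K > 0"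
      using reals_Archimedean2[of "max (C / e) 0"] by auto
    then show ?thesis using that by (intro exI[of _ K]) (simp add: field_simps)
  qed
  have "Cauchy u"
  proof (rule metric_CauchyI)
    fix e :: real assume e: "e > 0"
    obtain K where K: "K > 0" "C / real K < e / 4" using large[of "e / 4"] e by auto
    obtain l where l: "\<alpha> K \<longlonglongrightarrow> l" using conv[OF K(1)] by (auto simp: convergent_def)
    have "\<forall>\<^sub>F n in sequentially. dist (\<alpha> K n) l < e / 4" using l e by (intro tendstoD) auto
    then have "\<forall>\<^sub>F n in sequentially. \<bar>u n - l\<bar> < e / 2"
      using lo[OF K(1)]
    proof eventually_elim
      case (elim n)
      then show ?case using K(2) unfolding dist_real_def by linarith
    qed
    then obtain M where "\<And>n. n \<ge> M \<Longrightarrow> \<bar>u n - l\<bar> < e / 2" by (auto simp: eventually_sequentially)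
    then show "\<exists>M. \<forall>m\<ge>M. \<forall>n\<ge>M. dist (u m) (u n) < e"
    proof (intro exI[of _ M] allI impI)
      fix m n assume "m \<ge> M" "n \<ge> M"
      then have "\<bar>u m - l\<bar> < e / 2" "\<bar>u n - l\<bar> < e / 2"
        using \<open>\<And>n. n \<ge> M \<Longrightarrow> \<bar>u n - l\<bar> < e / 2\<close> by blast+
      then show "dist (u m) (u n) < e" unfolding dist_real_def by linarith
    qed
  qed
  then obtain a where a: "u \<longlonglongrightarrow> a" using Cauchy_convergent by (auto simp: convergent_def)
  have "\<forall>\<^sub>F n in sequentially. v n - 2 * a * u n + a\<^sup>2 < e" if e: "e > 0" for e
  proof -
    obtain K where K: "K > 0" "C / real K < e / 2" using large[of "e / 2"] e by auto
    obtain l where l: "\<alpha> K \<longlonglongrightarrow> l" using conv[OF K(1)] by (auto simp: convergent_def)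
    have "l \<le> a"
      by (rule tendsto_le[OF _ a l]) (use lo[OF K(1)] in \<open>auto elim: eventually_mono\<close>)
    moreover have "0 \<le> l"
      by (rule tendsto_lowerbound[OF l]) (use lo[OF K(1)] in \<open>auto elim: eventually_mono\<close>)
    ultimately have la: "l\<^sup>2 \<le> a\<^sup>2" by (rule power_mono)
    have "(\<lambda>n. (\<alpha> K n)\<^sup>2 / \<rho> K n + D / n + 2 * (C / K) - 2 * a * u n + a\<^sup>2)
        \<longlonglongrightarrow> l\<^sup>2 / 1 + 0 + 2 * (C / K) - 2 * a * a + a\<^sup>2"
      by (intro tendsto_intros l \<rho>[OF K(1)] a lim_const_over_n) simp
    moreover have "l\<^sup>2 / 1 + 0 + 2 * (C / K) - 2 * a * a + a\<^sup>2 < e"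
      using la K(2) unfolding power2_eq_square by linarith
    ultimately have "\<forall>\<^sub>F n in sequentially. (\<alpha> K n)\<^sup>2 / \<rho> K n + D / n + 2 * (C / K) - 2 * a * u n + a\<^sup>2 < e"
      by (rule order_tendstoD(2))
    then show ?thesis using v[OF K(1)] by eventually_elim linarith
  qed
  then show ?thesis by blast
qed

lemma erdos_renyi_mean_flip_tendsto:
  assumes d: "d \<ge> 0"
  shows "\<exists>a. (\<lambda>n. measure_pmf.expectation (erdos_renyi n (d / real n)) (\<lambda>E. (mean_flip n t E - a)\<^sup>2))
    \<longlonglongrightarrow> 0"
proof -
  let ?E = "\<lambda>n. measure_pmf.expectation (erdos_renyi n (d / real n))"
  let ?u = "\<lambda>n. ?E n (mean_flip n t)" and ?v = "\<lambda>n. ?E n (\<lambda>E. (mean_flip n t E)\<^sup>2)"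
  let ?\<alpha> = "\<lambda>K n. truncated_mean t K n (d / real n)"
  let ?C = "\<Sum>k\<le>t + 2. d ^ k" and ?D = "\<Sum>k\<le>2 * (t + 2). d ^ k"
  have small: "\<forall>\<^sub>F n in sequentially. n > 0 \<and> d / real n < 1"
    using eventually_conj[OF eventually_gt_at_top[of 0] order_tendstoD(2)[OF over_n_tendsto_0[of d], of 1]] by simp
  have "\<exists>a. \<forall>e>0. \<forall>\<^sub>F n in sequentially. ?v n - 2 * a * ?u n + a\<^sup>2 < e"
  proof (rule truncated_limit[where \<alpha> = ?\<alpha> and \<rho> = "\<lambda>K n. (1 - d / real n) ^ (K * K)" and C = ?C and D = ?D])
    fix K :: nat assume K: "K > 0"
    have "\<forall>k\<in>{1..K}. \<exists>l. (\<lambda>n. real ((n - 1) choose (k - 1)) * shape_weight t n (d / real n) k) \<longlonglongrightarrow> l"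
      by (intro ballI shape_weight_converges) simp
    from bchoice[OF this] obtain l where "\<forall>k\<in>{1..K}.
        (\<lambda>n. real ((n - 1) choose (k - 1)) * shape_weight t n (d / real n) k) \<longlonglongrightarrow> l k" by blast
    then have "?\<alpha> K \<longlonglongrightarrow> (\<Sum>k=1..K. l k)"
      unfolding truncated_mean_def by (intro tendsto_sum) blast
    then show "convergent (?\<alpha> K)" by (auto simp: convergent_def)
    have "(\<lambda>n. (1 - d / real n) ^ (K * K)) \<longlonglongrightarrow> (1 - 0) ^ (K * K)"
      by (intro tendsto_power tendsto_diff tendsto_const over_n_tendsto_0)
    then show "(\<lambda>n. (1 - d / real n) ^ (K * K)) \<longlonglongrightarrow> 1" by simp
    show "\<forall>\<^sub>F n in sequentially. 0 \<le> ?\<alpha> K n \<and> ?\<alpha> K n \<le> ?u n \<and> ?u n \<le> ?\<alpha> K n + ?C / K"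
      using small
    proof eventually_elim
      case (elim n)
      then have p: "0 \<le> d / real n" "d / real n \<le> 1" and dn: "d = real n * (d / real n)" using d by auto
      have "0 \<le> ?\<alpha> K n"
        unfolding truncated_mean_def expected_small_flip[OF p, of 0, symmetric, OF elim[THEN conjunct1]]
        by (simp add: small_flip_bounds)
      then show ?case
        using expected_mean_flip_bounds[OF p dn elim[THEN conjunct1] K, of t] by blast
    qed
    show "\<forall>\<^sub>F n in sequentially. ?v n \<le> (?\<alpha> K n)\<^sup>2 / (1 - d / real n) ^ (K * K) + ?D / n + 2 * (?C / K)"
      using small
    proof eventually_elim
      case (elim n)
      then have p: "0 \<le> d / real n" "d / real n < 1" and dn: "d = real n * (d / real n)" using d by auto
      show ?case by (rule expected_mean_flip_square[OF p dn elim[THEN conjunct1] K])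
    qed
  qed
  then obtain a where a: "\<forall>\<^sub>F n in sequentially. ?v n - 2 * a * ?u n + a\<^sup>2 < e" if "e > 0" for e by blast
  have eq: "?E n (\<lambda>E. (mean_flip n t E - a)\<^sup>2) = ?v n - 2 * a * ?u n + a\<^sup>2" for n
    by (simp add: power2_diff mult.assoc mult.commute[of _ a] mult.left_commute[of _ a])
  have "(\<lambda>n. ?E n (\<lambda>E. (mean_flip n t E - a)\<^sup>2)) \<longlonglongrightarrow> 0"
  proof (rule order_tendstoI)
    fix e :: real assume "e < 0"
    then show "\<forall>\<^sub>F n in sequentially. e < ?E n (\<lambda>E. (mean_flip n t E - a)\<^sup>2)"
      by (intro always_eventually allI) (auto intro: less_le_trans)
  next
    fix e :: real assume "e > 0"
    then show "\<forall>\<^sub>F n in sequentially. ?E n (\<lambda>E. (mean_flip n t E - a)\<^sup>2) < e"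
      unfolding eq by (rule a)
  qed
  then show ?thesis by blast
qed

theorem corollary1p4:
  shows "(\<forall>d::nat. d \<ge> 3 \<longrightarrow> (\<forall>\<epsilon>::real. \<epsilon> > 0 \<longrightarrow> (\<exists>t::nat.
            whp (admissible d) (\<lambda>n. random_regular n d) (almost_two_periodic \<epsilon> t) \<and>
            whp (admissible d) (\<lambda>n. random_regular n d) (almost_balanced \<epsilon> t))))
       \<and> (\<forall>d::real. d > 1 \<longrightarrow> (\<forall>\<epsilon>::real. \<epsilon> > 0 \<longrightarrow> (\<exists>t::nat.
            whp sequentially (\<lambda>n. erdos_renyi n (d / real n)) (almost_two_periodic \<epsilon> t) \<and>
            whp sequentially (\<lambda>n. erdos_renyi n (d / real n)) (almost_balanced \<epsilon> t))))"
proof (intro conjI allI impI)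
  fix d :: nat and \<epsilon> :: real
  assume d: "d \<ge> 3" and \<epsilon>: "\<epsilon> > 0"
  interpret graph_laws "admissible d" "\<lambda>n. random_regular n d" by (rule regular_graph_laws)
  show "\<exists>t. whp (admissible d) (\<lambda>n. random_regular n d) (almost_two_periodic \<epsilon> t) \<and>
      whp (admissible d) (\<lambda>n. random_regular n d) (almost_balanced \<epsilon> t)"
    using regular_mean_flip_tendsto[of d] d by (intro exists_settling_time[OF _ \<epsilon>]) auto
next
  fix d \<epsilon> :: real
  assume d: "d > 1" and \<epsilon>: "\<epsilon> > 0"
  interpret graph_laws sequentially "\<lambda>n. erdos_renyi n (d / real n)"
    by (rule erdos_renyi_laws) (use d in simp)
  show "\<exists>t. whp sequentially (\<lambda>n. erdos_renyi n (d / real n)) (almost_two_periodic \<epsilon> t) \<and>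
      whp sequentially (\<lambda>n. erdos_renyi n (d / real n)) (almost_balanced \<epsilon> t)"
    by (rule exists_settling_time[OF erdos_renyi_mean_flip_tendsto \<epsilon>]) (use d in simp)
qed

end
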